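(* Let $\mathcal{A}$ be a free arrangement in $V$. Then for any $H\in\mathcal{A}$ one has $$\Xi(\mathcal{A},H)=\mathrm{NFT}(\mathcal{A},H).$$
   Context: Let $\mathbb{K}$ be a field, $V$ an $\ell$-dimensional $\mathbb{K}$-vector space, $x_1,\dots,x_\ell$ a basis of $V^*$ and $S=\mathrm{Sym}(V^* )=\mathbb{K}[x_1,\dots,x_\ell]$. An arrangement in $V$ is a finite set $\mathcal{A}$ of linear hyperplanes (through the origin) of $V$. For a hyperplane $H$, $\alpha_H\in V^*$ denotes a fixed defining linear form, and $Q(\mathcal{A})=\prod_{H\in\mathcal{A}}\alpha_H$. Let $\Omega_V^1=\bigoplus_i S\,dx_i$, $\Omega_V^2=\bigwedge^2\Omega_V^1$, and for $\alpha=\sum c_ix_i$ let $d\alpha=\sum c_i\,dx_i$. Define $$\Omega^1(\mathcal{A})=\{\omega\in \tfrac{1}{Q(\mathcal{A})}\Omega^1_V \mid Q(\mathcal{A})\,\omega\wedge d\alpha_L\in\alpha_L\Omega_V^2\ \text{for all } L\in\mathcal{A}\}.$$ $\mathcal{A}$ is free if $\Omega^1(\mathcal{A})$ is a free $S$-module (equivalently, if $D(\mathcal{A})=\{\theta\in\bigoplus_i S\,\partial_{x_i}\mid \theta(\alpha_L)\in(\alpha_L)\ \forall L\in\mathcal{A}\}$ is free). For $H\in\mathcal{A}$: $\mathcal{A}\setminus H=\mathcal{A}\setminus\{H\}$; the restriction is $\mathcal{A}^H=\{H\cap L\mid L\in\mathcal{A}\setminus H\}$, an arrangement in $H$ with coordinate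 ring $\overline S=S/(\alpha_H)=\mathrm{Sym}(H^* )$; $\overline g$ is the image in $\overline S$ of $g\in S$. The residue map $\mathrm{res}^H_{\mathcal{A}}:\Omega^1(\mathcal{A})\to\overline S$ is $$\mathrm{res}^H_{\mathcal{A}}\big(f\,d\alpha_H+f_2\,d\alpha_2+\cdots+f_\ell\,d\alpha_\ell\big)=\frac{1}{Q(\mathcal{A}^H)}\,\overline{Q(\mathcal{A})f},$$ where $\alpha_H,\alpha_2,\dots,\alpha_\ell$ is any basis of $V^*$ (well defined, independent of the choice of $\alpha_2,\dots,\alpha_\ell$, with values in $\overline S$). The residue ideal $J_{\mathcal{A}}^H\subset\overline S$ is the image of $\mathrm{res}^H_{\mathcal{A}}$. $L(\mathcal{A}^H)$ is the set of all subspaces of $H$ that are intersections of hyperplanes of $\mathcal{A}^H$ (including $H$ as the empty intersection). For a subspace $X$, $\mathcal{A}_X=\{L\in\mathcal{A}\mid X\subseteq L\}$. Define $$\Xi(\mathcal{A},H)=\{X\in L(\mathcal{A}^H)\mid J_{\mathcal{A}_X}^H\ne\overline S\},\qquad \mathrm{NFT}(\mathcal{A},H)=\{X\in L(\mathcal{A}^H)\mid\mathcal{A}_X\setminus H\text{ is not free}\}.$$ *)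

theory Defs
  imports
    "HOL-Analysis.Cartesian_Space"
    "HOL-Library.Poly_Mapping"
    "HOL-Computational_Algebra.Polynomial_Factorial"
    "HOL-Algebra.QuotRing"
begin

text \<open>
  The ambient space is \<open>V = 'k ^ 'n\<close>, with \<open>x\<^sub>i\<close> the coordinate functions, so that
  \<open>S = Sym(V\<^sup>*)\<close> is the polynomial ring with one variable for each element of \<open>'n\<close>. The linear
  order on the index type \<open>'n\<close> serves only to obtain the integral domain instance of \<open>poly_mapping\<close>
  (monomial order), which the field of fractions of \<open>S\<close> needs.

  A linear form \<open>\<Sum>i. c\<^sub>i x\<^sub>i\<close> in \<open>V\<^sup>*\<close> is given by its coefficient vector \<open>c\<close>.
\<close>

type_synonym ('k, 'n) pring = "('n \<Rightarrow>\<^sub>0 nat) \<Rightarrow>\<^sub>0 'k"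

type_synonym ('k, 'n) rat_one_form = "(('k, 'n) pring fract, 'n) vec"

definition const_poly :: "'k::field \<Rightarrow> ('k, 'n::{finite, linorder}) pring" where
  "const_poly c = Poly_Mapping.single 0 c"

definition pvar :: "'n \<Rightarrow> ('k::field, 'n::{finite, linorder}) pring" where
  "pvar i = Poly_Mapping.single (Poly_Mapping.single i 1) 1"

definition lin_poly :: "('k::field, 'n) vec \<Rightarrow> ('k, 'n::{finite, linorder}) pring" where
  "lin_poly c = (\<Sum>i\<in>UNIV. const_poly (c $ i) * pvar i)"

definition eval_form :: "('k::field, 'n::finite) vec \<Rightarrow> ('k, 'n) vec \<Rightarrow> 'k" where
  "eval_form c v = (\<Sum>i\<in>UNIV. c $ i * v $ i)"

definition hyperplane :: "('k::field, 'n::finite) vec set \<Rightarrow> bool" where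
  "hyperplane H \<longleftrightarrow> (\<exists>c. c \<noteq> 0 \<and> H = {v. eval_form c v = 0})"

definition arrangement :: "('k::field, 'n::finite) vec set set \<Rightarrow> bool" where
  "arrangement A \<longleftrightarrow> finite A \<and> (\<forall>H\<in>A. hyperplane H)"

text \<open>
  A fixed defining linear form of a hyperplane \<open>X\<close> of a subspace \<open>W\<close>; it is used for \<open>W = V\<close>, and
  for \<open>W\<close> a hyperplane \<open>H\<close>, where the linear forms on \<open>H\<close> are the restrictions of those on \<open>V\<close>.
\<close>

definition def_form :: "('k::field, 'n::finite) vec set \<Rightarrow> ('k, 'n) vec set \<Rightarrow> ('k, 'n) vec" where
  "def_form W X = (SOME c. X = {v \<in> W. eval_form c v = 0})"

abbreviation alpha :: "('k::field, 'n::finite) vec set \<Rightarrow> ('k, 'n) vec" where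
  "alpha H \<equiv> def_form UNIV H"

text \<open>
  For an arrangement \<open>B\<close> in \<open>W\<close>, a representative in \<open>S\<close> of \<open>Q(B)\<close>, which lies in \<open>Sym(W\<^sup>*)\<close>.
\<close>

definition def_poly ::
    "('k::field, 'n) vec set \<Rightarrow> ('k, 'n) vec set set \<Rightarrow> ('k, 'n::{finite, linorder}) pring" where
  "def_poly W B = (\<Prod>X\<in>B. lin_poly (def_form W X))"


subsection \<open>Logarithmic forms and freeness\<close>

text \<open>
  A \<open>1\<close>-form is given by its coefficients with respect to \<open>dx\<^sub>i\<close>. A \<open>2\<close>-form
  \<open>\<Sum>i<j. g\<^sub>i\<^sub>j dx\<^sub>i \<and> dx\<^sub>j\<close> is given by the alternating matrix with entries \<open>g\<^sub>i\<^sub>j\<close> above the diagonal;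
  the zero diagonal is a separate condition because \<open>'k\<close> may have characteristic two.
\<close>

definition dform :: "('k::field, 'n) vec \<Rightarrow> (('k, 'n::{finite, linorder}) pring, 'n) vec" where
  "dform c = (\<chi> i. const_poly (c $ i))"

definition two_forms :: "((('k::field, 'n::{finite, linorder}) pring, 'n) vec, 'n) vec set" where
  "two_forms = {\<theta>. (\<forall>i. \<theta> $ i $ i = 0) \<and> (\<forall>i j. \<theta> $ j $ i = - \<theta> $ i $ j)}"

definition wedge ::
    "(('k::field, 'n::{finite, linorder}) pring, 'n) vec \<Rightarrow> (('k, 'n) pring, 'n) vec \<Rightarrow>
     ((('k, 'n) pring, 'n) vec, 'n) vec" where
  "wedge \<eta> \<zeta> = (\<chi> i j. \<eta> $ i * \<zeta> $ j - \<eta> $ j * \<zeta> $ i)"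

definition to_rat_form ::
    "(('k::field, 'n::{finite, linorder}) pring, 'n) vec \<Rightarrow> ('k, 'n) rat_one_form" where
  "to_rat_form \<eta> = (\<chi> i. to_fract (\<eta> $ i))"

definition scale_form ::
    "('k::field, 'n::{finite, linorder}) pring \<Rightarrow> ('k, 'n) rat_one_form \<Rightarrow> ('k, 'n) rat_one_form"
  where "scale_form p \<omega> = to_fract p *s \<omega>"

interpretation forms: Modules.module
  "scale_form :: ('k::field, 'n::{finite, linorder}) pring \<Rightarrow> _"
  by unfold_locales
    (simp_all add: scale_form_def vector_scalar_mult_def vec_eq_iff algebra_simps)

definition log_forms ::
    "('k::field, 'n) vec set set \<Rightarrow> ('k, 'n::{finite, linorder}) rat_one_form set" where
  "log_forms A =
    {\<omega>. \<exists>\<eta>. scale_form (def_poly UNIV A) \<omega> = to_rat_form \<eta> \<and>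
         (\<forall>L\<in>A. \<exists>\<theta>\<in>two_forms.
            wedge \<eta> (dform (alpha L)) = (\<chi> i j. lin_poly (alpha L) * \<theta> $ i $ j))}"

definition free_arrangement :: "('k::field, 'n::{finite, linorder}) vec set set \<Rightarrow> bool" where
  "free_arrangement A \<longleftrightarrow> (\<exists>B. forms.independent B \<and> forms.span B = log_forms A)"


subsection \<open>Restriction, localization and the residue map\<close>

definition restriction :: "('k, 'n::finite) vec set set \<Rightarrow> ('k, 'n) vec set \<Rightarrow> ('k, 'n) vec set set" where
  "restriction A H = {H \<inter> L | L. L \<in> A - {H}}"

definition localization :: "('k, 'n::finite) vec set set \<Rightarrow> ('k, 'n) vec set \<Rightarrow> ('k, 'n) vec set set" where
  "localization A X = {L \<in> A. X \<subseteq> L}"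

text \<open>The intersection lattice of an arrangement \<open>B\<close> in \<open>W\<close>; \<open>W\<close> is the empty intersection.\<close>

definition intersections :: "('k, 'n::finite) vec set \<Rightarrow> ('k, 'n) vec set set \<Rightarrow> ('k, 'n) vec set set" where
  "intersections W B = {W \<inter> \<Inter>C | C. C \<subseteq> B}"

definition poly_ring :: "('k::field, 'n::{finite, linorder}) pring ring" where
  "poly_ring = \<lparr>carrier = UNIV, monoid.mult = (*), one = 1, ring.zero = 0, add = (+)\<rparr>"

lemma cring_poly_ring: "cring (poly_ring :: ('k::field, 'n::{finite, linorder}) pring ring)"
proof -
  have "\<exists>y. x + y = 0" for x :: "('k, 'n) pring"
    using add.right_inverse by blast
  then show ?thesis
    unfolding poly_ring_def using add.right_inverse
    by unfold_locales (auto simp: algebra_simps Units_def)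
qed

definition alpha_ideal :: "('k::field, 'n) vec set \<Rightarrow> ('k, 'n::{finite, linorder}) pring set" where
  "alpha_ideal H = PIdl\<^bsub>poly_ring\<^esub> (lin_poly (alpha H))"

definition coord_ring :: "('k::field, 'n) vec set \<Rightarrow> ('k, 'n::{finite, linorder}) pring set ring" where
  "coord_ring H = poly_ring Quot (alpha_ideal H)"

definition bar ::
    "('k::field, 'n) vec set \<Rightarrow> ('k, 'n::{finite, linorder}) pring \<Rightarrow> ('k, 'n) pring set" where
  "bar H g = alpha_ideal H +>\<^bsub>poly_ring\<^esub> g"

definition is_basis :: "('n \<Rightarrow> ('k::field, 'n::finite) vec) \<Rightarrow> bool" where
  "is_basis b \<longleftrightarrow> inj b \<and> vec.independent (range b) \<and> vec.span (range b) = UNIV"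

text \<open>
  The quotient \<open>1/Q(A\<^sup>H) \<cdot> bar (Q(A) f)\<close> is the element of the domain \<open>S/(\<alpha>\<^sub>H)\<close> whose product with
  \<open>Q(A\<^sup>H)\<close> is \<open>bar (Q(A) f)\<close>. The coefficient \<open>f\<close> is a fraction; \<open>p\<close> is the polynomial \<open>Q(A) f\<close>.
  The value is only meaningful for \<open>\<omega>\<close> in \<open>log_forms A\<close> and \<open>H \<in> A\<close>, where it exists and does not
  depend on the basis \<open>b\<close> that extends \<open>\<alpha>\<^sub>H\<close>.
\<close>

definition residue ::
    "('k::field, 'n) vec set set \<Rightarrow> ('k, 'n) vec set \<Rightarrow> ('k, 'n::{finite, linorder}) rat_one_form \<Rightarrow>
     ('k, 'n) pring set" where
  "residue A H \<omega> =
    (THE g. g \<in> carrier (coord_ring H) \<and>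
      (\<exists>b h f p. is_basis b \<and> b h = alpha H \<and>
         \<omega> = (\<Sum>i\<in>UNIV. f i *s to_rat_form (dform (b i))) \<and>
         to_fract p = to_fract (def_poly UNIV A) * f h \<and>
         bar H (def_poly H (restriction A H)) \<otimes>\<^bsub>coord_ring H\<^esub> g = bar H p))"

definition residue_ideal ::
    "('k::field, 'n) vec set set \<Rightarrow> ('k, 'n) vec set \<Rightarrow> ('k, 'n::{finite, linorder}) pring set set" where
  "residue_ideal A H = residue A H ` log_forms A"

definition Xi ::
    "('k::field, 'n::{finite, linorder}) vec set set \<Rightarrow> ('k, 'n) vec set \<Rightarrow> ('k, 'n) vec set set" where
  "Xi A H = {X \<in> intersections H (restriction A H).
               residue_ideal (localization A X) H \<noteq> carrier (coord_ring H)}"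

definition NFT ::
    "('k::field, 'n::{finite, linorder}) vec set set \<Rightarrow> ('k, 'n) vec set \<Rightarrow> ('k, 'n) vec set set" where
  "NFT A H = {X \<in> intersections H (restriction A H).
                \<not> free_arrangement (localization A X - {H})}"

end

theory Submission
  imports Defs "HOL-Analysis.Determinants"
begin

text \<open>
  Freeness is expressed by Saito's criterion, that some logarithmic forms have determinant \<open>1/Q\<close> up
  to a unit. The multilinearity of the determinant allows replacing their numerators by homogeneous
  components for any grading in which the forms \<open>\<alpha>\<^sub>L\<close> in question are homogeneous. The total degree
  yields homogeneous bases; the grading by the monomials in coordinates of \<open>X\<close> together with the
  degree in the forms vanishing on \<open>X\<close> shows that localizations of free arrangements are free.

  Hence it suffices that, for a free arrangement \<open>A\<close>, the residue ideal \<open>J\<close> along \<open>H\<close> contains \<open>1\<close>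
  iff \<open>A - H\<close> is free. The kernel of the residue map is \<open>\<Omega>\<^sup>1(A - H)\<close>. If \<open>J\<close> contains \<open>1\<close>, some member of a homogeneous
  basis has a non-zero constant as residue, and a basis of the kernel can be read off. Conversely, if
  the deletion is free, the transition matrix between the bases has determinant \<open>\<alpha>\<^sub>H\<close> up to a unit,
  hence a minor of corank one does not vanish at the origin; the residues are therefore multiples
  of a single homogeneous one, and this is a unit because the forms
  \<open>(\<alpha>\<^sub>L d\<alpha>\<^sub>H - \<alpha>\<^sub>H d\<alpha>\<^sub>L) / (Q(A\<^sub>Y))\<close>, \<open>Y = H \<inter> L\<close>, have residues without common prime factor.
\<close>

subsection \<open>Polynomials and substitution\<close>

text \<open>Three things shape the argument. The ring is graded, not local: that 1 lies in the
  residue ideal only says that the residues of a basis generate the unit ideal, and a minor that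
  does not vanish at the origin need not be invertible. Both facts become usable by comparing
  homogeneous components, where only the constant term of such a factor contributes; hence the
  homogeneous bases. Unique factorization is not invoked. Linear forms are shown to be prime, and
  the cofactor in Saito's criterion as well as the generating residue are recognized as units
  because they divide a product of linear forms none of which divides them. Freeness asks for some
  basis of a module of forms with fractional coefficients, without fixing its size. It is therefore
  translated to polynomial vectors, the numerators over \<open>Q\<close>; the fraction field serves
  only to translate the definitions. Polynomials are never differentiated, so the characteristic is
  arbitrary.\<close>

lemma const_poly_0 [simp]: "const_poly 0 = 0"
  and const_poly_1 [simp]: "const_poly 1 = 1"
  and const_poly_add: "const_poly (a + b) = const_poly a + const_poly b"
  and const_poly_mult: "const_poly (a * b) = const_poly a * const_poly b"
  and const_poly_uminus: "const_poly (- a) = - const_poly a"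
  and const_poly_diff: "const_poly (a - b) = const_poly a - const_poly b"
  by (simp_all add: const_poly_def single_add mult_single single_uminus single_diff)

lemma const_poly_sum: "const_poly (sum f I) = (\<Sum>i\<in>I. const_poly (f i))"
  by (induction I rule: infinite_finite_induct) (simp_all add: const_poly_add)

lemma const_poly_eq_0_iff [simp]: "const_poly a = 0 \<longleftrightarrow> a = 0"
  unfolding const_poly_def by (metis lookup_single_eq lookup_zero single_zero)

lemma const_poly_dvd_1: "a \<noteq> 0 \<Longrightarrow> const_poly a dvd 1"
  by (metis const_poly_1 const_poly_mult dvdI field_class.field_inverse mult.commute)

lemma lookup_const_poly_mult:
  "Poly_Mapping.lookup (const_poly a * f) m = a * Poly_Mapping.lookup f m"
  unfolding const_poly_def mult_map_scale_conv_mult[symmetric]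
  by (simp add: Poly_Mapping.map.rep_eq when_def)

lemma poly_mapping_sum_single:
  "f = (\<Sum>m\<in>Poly_Mapping.keys f. Poly_Mapping.single m (Poly_Mapping.lookup f m))"
proof (rule poly_mapping_eqI)
  fix k
  have "(\<Sum>m\<in>Poly_Mapping.keys f. Poly_Mapping.lookup (Poly_Mapping.single m (Poly_Mapping.lookup f m)) k)
     = (\<Sum>m\<in>Poly_Mapping.keys f. if k = m then Poly_Mapping.lookup f m else 0)"
    by (intro sum.cong) (auto simp: lookup_single when_def)
  then show "Poly_Mapping.lookup f k =
     Poly_Mapping.lookup (\<Sum>m\<in>Poly_Mapping.keys f. Poly_Mapping.single m (Poly_Mapping.lookup f m)) k"
    by (simp add: lookup_sum sum.delta in_keys_iff)
qed

lemma pvar_power: "(pvar i :: ('k::field, 'n::{finite,linorder}) pring) ^ k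
    = Poly_Mapping.single (Poly_Mapping.single i k) 1"
proof (induction k)
  case (Suc k)
  then show ?case by (simp add: pvar_def mult_single single_add[symmetric])
qed simp

lemma prod_single: "finite I \<Longrightarrow>
    (\<Prod>i\<in>I. Poly_Mapping.single (e i) (1::'k::comm_semiring_1)) = Poly_Mapping.single (\<Sum>i\<in>I. e i) 1"
  by (induction I rule: finite_induct) (simp_all add: mult_single)

lemma single_eq_monomial:
  fixes m :: "'n::{finite,linorder} \<Rightarrow>\<^sub>0 nat"
  shows "Poly_Mapping.single m a = const_poly a * (\<Prod>i\<in>UNIV. pvar i ^ Poly_Mapping.lookup m i)"
proof -
  have "m = (\<Sum>i\<in>UNIV. Poly_Mapping.single i (Poly_Mapping.lookup m i))"
    by (rule poly_mapping_eqI) (simp add: lookup_sum lookup_single when_def sum.delta)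
  then have "(\<Prod>i\<in>UNIV. pvar i ^ Poly_Mapping.lookup m i) = Poly_Mapping.single m (1::'a)"
    by (simp add: pvar_power prod_single)
  then show ?thesis
    by (simp add: const_poly_def mult_single)
qed

lemma pring_induct [case_names const pvar add mult]:
  fixes f :: "('k::field, 'n::{finite,linorder}) pring"
  assumes const: "\<And>a. P (const_poly a)" and pvar: "\<And>i. P (pvar i)"
    and add: "\<And>f g. P f \<Longrightarrow> P g \<Longrightarrow> P (f + g)" and mult: "\<And>f g. P f \<Longrightarrow> P g \<Longrightarrow> P (f * g)"
  shows "P f"
proof -
  have power: "P (pvar i ^ k)" for i k
    by (induction k) (use const[of 1] pvar mult in auto)
  have "P (\<Prod>i\<in>I. pvar i ^ e i)" if "finite I" for e :: "'n \<Rightarrow> nat" and I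
    using that by (induction I rule: finite_induct) (use const[of 1] power mult in auto)
  then have "P (Poly_Mapping.single m a)" for m a
    using const mult by (simp add: single_eq_monomial)
  note single = this
  have "P (\<Sum>m\<in>K. Poly_Mapping.single m (Poly_Mapping.lookup f m))" if "finite K" for K
    using that by (induction K rule: finite_induct) (use const[of 0] single add in auto)
  then show ?thesis
    by (subst poly_mapping_sum_single) simp
qed

text \<open>The algebra endomorphism with \<open>u i\<close> as image of the variable
  \<open>i\<close>. Reduction modulo a linear form, evaluation at the origin, setting some variables
  to zero and linear changes of coordinates are all instances of it.\<close>

definition subst ::
    "('n \<Rightarrow> ('k::field, 'n) pring) \<Rightarrow> ('k, 'n::{finite,linorder}) pring \<Rightarrow> ('k, 'n) pring" where
  "subst u f = (\<Sum>m\<in>Poly_Mapping.keys f.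
     const_poly (Poly_Mapping.lookup f m) * (\<Prod>i\<in>UNIV. u i ^ Poly_Mapping.lookup m i))"

lemma subst_superset:
  assumes "finite K" "Poly_Mapping.keys f \<subseteq> K"
  shows "subst u f = (\<Sum>m\<in>K.
     const_poly (Poly_Mapping.lookup f m) * (\<Prod>i\<in>UNIV. u i ^ Poly_Mapping.lookup m i))"
  unfolding subst_def
  by (rule sum.mono_neutral_left) (use assms in \<open>auto simp: in_keys_iff\<close>)

lemma subst_0 [simp]: "subst u 0 = 0"
  by (simp add: subst_def)

lemma subst_add [simp]: "subst u (f + g) = subst u f + subst u g"
proof -
  let ?K = "Poly_Mapping.keys f \<union> Poly_Mapping.keys g"
  have "Poly_Mapping.keys (f + g) \<subseteq> ?K"
    by (rule keys_add)
  then show ?thesis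
    by (simp add: subst_superset[of ?K] lookup_add const_poly_add distrib_right sum.distrib)
qed

lemma subst_sum [simp]: "subst u (sum f I) = (\<Sum>i\<in>I. subst u (f i))"
  by (induction I rule: infinite_finite_induct) simp_all

lemma subst_single:
  "subst u (Poly_Mapping.single m a) = const_poly a * (\<Prod>i\<in>UNIV. u i ^ Poly_Mapping.lookup m i)"
  by (simp add: subst_superset[of "{m}"])

lemma subst_mult [simp]: "subst u (f * g) = subst u f * subst u g"
proof -
  let ?s = Poly_Mapping.single and ?l = Poly_Mapping.lookup and ?k = Poly_Mapping.keys
  have single: "subst u (?s m a * ?s m' a') = subst u (?s m a) * subst u (?s m' a')" for m m' a a'
    by (simp add: mult_single subst_single const_poly_mult lookup_add power_add prod.distrib algebra_simps)
  have "subst u ((\<Sum>m\<in>?k f. ?s m (?l f m)) * (\<Sum>m\<in>?k g. ?s m (?l g m)))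
      = subst u (\<Sum>m\<in>?k f. ?s m (?l f m)) * subst u (\<Sum>m\<in>?k g. ?s m (?l g m))"
    by (simp add: sum_product single)
  then show ?thesis
    by (simp flip: poly_mapping_sum_single)
qed

lemma subst_const [simp]: "subst u (const_poly a) = const_poly a"
  unfolding const_poly_def by (simp add: subst_single const_poly_def)

lemma subst_1 [simp]: "subst u 1 = 1"
  using subst_const[of u 1] by simp

lemma subst_pvar [simp]: "subst u (pvar i) = u i"
proof -
  have "(\<Prod>j\<in>UNIV. u j ^ (Poly_Mapping.lookup (Poly_Mapping.single i 1) j)) = u i"
    by (simp add: lookup_single when_def if_distrib[of "\<lambda>x. _ ^ x"] prod.delta cong: if_cong)
  then show ?thesis by (simp add: pvar_def subst_single)
qed

lemma subst_uminus [simp]: "subst u (- f) = - subst u f"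
  using subst_add[of u f "- f"] by (simp add: eq_neg_iff_add_eq_0 add.commute)

lemma subst_diff [simp]: "subst u (f - g) = subst u f - subst u g"
  using subst_add[of u f "- g"] by simp

lemma subst_prod [simp]: "subst u (prod f I) = (\<Prod>i\<in>I. subst u (f i))"
  by (induction I rule: infinite_finite_induct) simp_all

lemma subst_power [simp]: "subst u (f ^ k) = subst u f ^ k"
  by (induction k) simp_all

lemma subst_dvd: "f dvd g \<Longrightarrow> subst u f dvd subst u g"
  by (metis dvd_def subst_mult)

lemma subst_det:
  fixes E :: "((('k::field, 'n::{finite,linorder}) pring, 'n) vec, 'n) vec"
  shows "subst u (det E) = det (\<chi> i j. subst u (E $ i $ j))"
proof -
  have "subst u (of_int (sign p)) = of_int (sign p)" for p :: "'n \<Rightarrow> 'n"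
    by (cases "evenperm p") (simp_all add: sign_def)
  then show ?thesis by (simp add: det_def)
qed

text \<open>Congruent variables give congruent polynomials: the \<open>f\<close> in question form a
  subring that contains the constants and the variables.\<close>

lemma dvd_diff_subst:
  assumes "\<And>i. a dvd pvar i - u i"
  shows "a dvd f - subst u f"
proof (induction f rule: pring_induct)
  case (add f g)
  then show ?case using dvd_add[OF add] by (simp add: algebra_simps)
next
  case (mult f g)
  have "f * g - subst u (f * g) = (f - subst u f) * g + subst u f * (g - subst u g)"
    by (simp add: algebra_simps)
  then show ?case using mult by (simp add: dvd_add dvd_mult dvd_mult2)
qed (use assms in auto)

lemma subst_zero:
  fixes f :: "('k::field, 'n::{finite,linorder}) pring"
  shows "subst (\<lambda>_. 0) f = const_poly (Poly_Mapping.lookup f 0)"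
proof -
  have "(\<Prod>i\<in>UNIV. (0 :: ('k, 'n) pring) ^ Poly_Mapping.lookup m i)
      = (if m = 0 then 1 else 0)" for m :: "'n \<Rightarrow>\<^sub>0 nat"
  proof (cases "m = 0")
    case False
    then obtain i where "Poly_Mapping.lookup m i \<noteq> 0"
      by (auto simp: poly_mapping_eq_iff fun_eq_iff)
    then have "(0 :: ('k, 'n) pring) ^ Poly_Mapping.lookup m i = 0" by simp
    with False show ?thesis
      by (simp only: if_False) (intro prod_zero[OF finite bexI[OF _ UNIV_I]])
  qed simp
  then show ?thesis
    by (simp add: subst_superset[of "insert 0 (Poly_Mapping.keys f)"] if_distrib[of "\<lambda>x. _ * x"]
        sum.delta subset_insertI cong: if_cong)
qed

subsection \<open>Linear forms\<close>

lemma lin_poly_0 [simp]: "lin_poly 0 = 0"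
  and lin_poly_add: "lin_poly (c + d) = lin_poly c + lin_poly d"
  and lin_poly_diff: "lin_poly (c - d) = lin_poly c - lin_poly d"
  and lin_poly_smult: "lin_poly (a *s c) = const_poly a * lin_poly c"
  by (simp_all add: lin_poly_def const_poly_add const_poly_diff const_poly_mult algebra_simps
      sum.distrib sum_subtractf sum_distrib_left)

lemma single_1_eq_iff: "Poly_Mapping.single i (1::nat) = Poly_Mapping.single j 1 \<longleftrightarrow> i = j"
  by (metis lookup_single_eq lookup_single_not_eq one_neq_zero)

lemma lookup_lin_poly: "Poly_Mapping.lookup (lin_poly c) (Poly_Mapping.single i 1) = c $ i"
  by (simp add: lin_poly_def lookup_sum lookup_const_poly_mult pvar_def lookup_single when_def
      single_1_eq_iff[simplified] if_distrib[of "\<lambda>x. _ * x"] sum.delta cong: if_cong)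

lemma lin_poly_eq_0_iff [simp]: "lin_poly c = 0 \<longleftrightarrow> c = 0"
  by (metis lin_poly_0 lookup_lin_poly lookup_zero vec_eq_iff zero_index)

lemma eval_form_add: "eval_form (c + d) v = eval_form c v + eval_form d v"
  and eval_form_diff: "eval_form (c - d) v = eval_form c v - eval_form d v"
  and eval_form_smult: "eval_form (a *s c) v = a * eval_form c v"
  and eval_form_diff_right: "eval_form c (v - w) = eval_form c v - eval_form c w"
  and eval_form_smult_right: "eval_form c (a *s v) = a * eval_form c v"
  and eval_form_0 [simp]: "eval_form 0 v = 0" "eval_form c 0 = 0"
  by (simp_all add: eval_form_def algebra_simps sum.distrib sum_subtractf sum_distrib_left)

lemma eval_form_axis [simp]: "eval_form c (axis i a) = c $ i * a"
  by (simp add: eval_form_def axis_def if_distrib[of "\<lambda>x. _ * x"] sum.delta cong: if_cong)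

lemma ex_eval_form_1:
  assumes "c \<noteq> 0"
  shows "\<exists>v. eval_form c v = 1"
proof -
  obtain i where "c $ i \<noteq> 0" using assms by (auto simp: vec_eq_iff)
  then have "eval_form c (axis i (inverse (c $ i))) = 1" by simp
  then show ?thesis ..
qed

text \<open>Substitution along the projection of \<open>V\<close> onto the kernel of \<open>c\<close> with direction \<open>v\<close>, where
  \<open>c(v) = 1\<close>: a model of the reduction modulo \<open>c\<close> inside the polynomial ring itself.\<close>

definition reduce ::
    "('k::field, 'n) vec \<Rightarrow> ('k, 'n) vec \<Rightarrow> ('k, 'n::{finite,linorder}) pring \<Rightarrow> ('k, 'n) pring" where
  "reduce c v = subst (\<lambda>i. pvar i - const_poly (v $ i) * lin_poly c)"

lemma reduce_lin_poly: "reduce c v (lin_poly d) = lin_poly (d - eval_form d v *s c)"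
proof -
  have "reduce c v (lin_poly d)
      = (\<Sum>i\<in>UNIV. const_poly (d $ i) * (pvar i - const_poly (v $ i) * lin_poly c))"
    by (subst lin_poly_def) (simp add: reduce_def)
  also have "\<dots> = lin_poly d - const_poly (eval_form d v) * lin_poly c"
    by (simp add: algebra_simps sum_subtractf eval_form_def const_poly_sum const_poly_mult
        sum_distrib_left sum_distrib_right lin_poly_def[of d])
  finally show ?thesis by (simp add: lin_poly_diff lin_poly_smult)
qed

lemma reduce_simps [simp]:
  "reduce c v (f + g) = reduce c v f + reduce c v g"
  "reduce c v (f - g) = reduce c v f - reduce c v g"
  "reduce c v (f * g) = reduce c v f * reduce c v g"
  "reduce c v (const_poly a) = const_poly a" "reduce c v 1 = 1" "reduce c v 0 = 0"
  "reduce c v (sum h I) = (\<Sum>i\<in>I. reduce c v (h i))"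
  by (simp_all add: reduce_def)

lemma reduce_prod: "reduce c v (prod h I) = (\<Prod>i\<in>I. reduce c v (h i))"
  by (simp add: reduce_def)

text \<open>Reduction changes \<open>f\<close> only by a multiple of \<open>c\<close>, and it kills
  \<open>c\<close> because \<open>c(v) = 1\<close>. So it is a projection of the ring with kernel
  the ideal \<open>(c)\<close>.\<close>

lemma reduce_eq_0_iff:
  assumes "eval_form c v = 1"
  shows "reduce c v f = 0 \<longleftrightarrow> lin_poly c dvd f"
proof
  have "lin_poly c dvd f - reduce c v f"
    unfolding reduce_def by (rule dvd_diff_subst) simp
  then show "lin_poly c dvd f" if "reduce c v f = 0"
    using that by simp
next
  assume "lin_poly c dvd f"
  then obtain g where "f = lin_poly c * g" ..
  then show "reduce c v f = 0"
    using assms by (simp add: reduce_lin_poly)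
qed

lemma reduce_eq_iff:
  assumes "eval_form c v = 1"
  shows "reduce c v f = reduce c v g \<longleftrightarrow> lin_poly c dvd f - g"
  using reduce_eq_0_iff[OF assms, of "f - g"] by simp

lemma reduce_reduce [simp]:
  assumes "eval_form c v = 1"
  shows "reduce c v (reduce c v f) = reduce c v f"
  unfolding reduce_eq_iff[OF assms] 
proof -
  have "lin_poly c dvd f - reduce c v f"
    unfolding reduce_def by (rule dvd_diff_subst) simp
  then show "lin_poly c dvd reduce c v f - f"
    by (metis dvd_minus_iff minus_diff_eq)
qed

lemma lin_poly_dvd_lin_poly_iff:
  assumes "c \<noteq> 0"
  shows "lin_poly c dvd lin_poly d \<longleftrightarrow> (\<exists>a. d = a *s c)"
proof -
  obtain v where v: "eval_form c v = 1" using ex_eval_form_1[OF assms] ..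
  show ?thesis
    unfolding reduce_eq_0_iff[OF v, symmetric] reduce_lin_poly
    using v by (auto simp: eval_form_smult)
qed

lemma not_unit_lin_poly: "\<not> lin_poly c dvd 1"
proof (cases "c = 0")
  case False
  then obtain v where v: "eval_form c v = 1" using ex_eval_form_1 by blast
  show ?thesis by (simp add: reduce_eq_0_iff[OF v, symmetric])
qed simp

text \<open>The ideal \<open>(c)\<close> is the kernel of \<open>reduce c v\<close>, a ring
  homomorphism into a domain.\<close>

lemma prime_lin_poly:
  assumes "c \<noteq> 0"
  shows "prime_elem (lin_poly c)"
proof -
  obtain v where v: "eval_form c v = 1" using ex_eval_form_1[OF assms] ..
  show ?thesis
    by (rule prime_elemI) (use assms not_unit_lin_poly in \<open>simp_all flip: reduce_eq_0_iff[OF v]\<close>)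
qed

subsection \<open>Gradings of the polynomial ring\<close>

text \<open>The weights have an arbitrary type, because localization grades by pairs of a monomial
  and a degree.\<close>

definition hpart ::
    "(('n \<Rightarrow>\<^sub>0 nat) \<Rightarrow> 'g) \<Rightarrow> 'g \<Rightarrow> ('k::field, 'n::{finite,linorder}) pring \<Rightarrow> ('k, 'n) pring" where
  "hpart w g f = (\<Sum>m | m \<in> Poly_Mapping.keys f \<and> w m = g.
     Poly_Mapping.single m (Poly_Mapping.lookup f m))"

definition homog ::
    "(('n \<Rightarrow>\<^sub>0 nat) \<Rightarrow> 'g) \<Rightarrow> 'g \<Rightarrow> ('k::field, 'n::{finite,linorder}) pring \<Rightarrow> bool" where
  "homog w g f \<longleftrightarrow> (\<forall>m\<in>Poly_Mapping.keys f. w m = g)"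

lemma lookup_hpart:
  "Poly_Mapping.lookup (hpart w g f) m = (if w m = g then Poly_Mapping.lookup f m else 0)"
  by (auto simp: hpart_def lookup_sum lookup_single when_def sum.delta in_keys_iff)

lemma hpart_0 [simp]: "hpart w g 0 = 0"
  and hpart_add: "hpart w g (f + h) = hpart w g f + hpart w g h"
  and hpart_diff: "hpart w g (f - h) = hpart w g f - hpart w g h"
  by (auto intro!: poly_mapping_eqI simp: lookup_hpart lookup_add lookup_minus)

lemma hpart_sum: "hpart w g (sum f I) = (\<Sum>i\<in>I. hpart w g (f i))"
  by (induction I rule: infinite_finite_induct) (simp_all add: hpart_add)

lemma hpart_const_mult: "hpart w g (const_poly a * f) = const_poly a * hpart w g f"
  by (auto intro!: poly_mapping_eqI simp: lookup_hpart lookup_const_poly_mult)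

lemma sum_hpart:
  assumes "finite G" "w ` Poly_Mapping.keys f \<subseteq> G"
  shows "(\<Sum>g\<in>G. hpart w g f) = f"
proof (rule poly_mapping_eqI)
  fix m
  show "Poly_Mapping.lookup (\<Sum>g\<in>G. hpart w g f) m = Poly_Mapping.lookup f m"
    using assms by (cases "m \<in> Poly_Mapping.keys f")
      (auto simp: lookup_sum lookup_hpart sum.delta' in_keys_iff)
qed

lemma homog_hpart [simp]: "homog w g (hpart w g f)"
  by (auto simp: homog_def in_keys_iff lookup_hpart split: if_splits)

lemma homog_0 [simp]: "homog w g 0"
  by (simp add: homog_def)

lemma hpart_homog: "homog w h f \<Longrightarrow> hpart w g f = (if g = h then f else 0)"
  by (rule poly_mapping_eqI) (auto simp: lookup_hpart homog_def in_keys_iff)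

lemma hpart_neq_0_iff: "hpart w g f \<noteq> 0 \<longleftrightarrow> (\<exists>m\<in>Poly_Mapping.keys f. w m = g)"
  by (auto simp: poly_mapping_eq_iff fun_eq_iff lookup_hpart in_keys_iff split: if_splits)

lemma homog_add: "homog w g f \<Longrightarrow> homog w g h \<Longrightarrow> homog w g (f + h)"
  using keys_add[of f h] by (auto simp: homog_def)

lemma homog_sum: "(\<And>i. i \<in> I \<Longrightarrow> homog w g (f i)) \<Longrightarrow> homog w g (sum f I)"
  by (induction I rule: infinite_finite_induct) (auto intro: homog_add)

lemma homog_uminus: "homog w g f \<Longrightarrow> homog w g (- f)"
  by (auto simp: homog_def in_keys_iff)

text \<open>Cancellation in the monoid of weights ensures that multiplication by a homogeneous
  polynomial shifts the components without merging any two of them.\<close>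

locale weight =
  fixes w :: "('n::{finite,linorder} \<Rightarrow>\<^sub>0 nat) \<Rightarrow> 'g::cancel_comm_monoid_add"
  assumes w_0: "w 0 = 0" and w_add: "w (m + m') = w m + w m'"
begin

lemma homog_mult: "homog w g f \<Longrightarrow> homog w h f' \<Longrightarrow> homog w (g + h) (f * f')"
  using keys_mult[of f f'] by (fastforce simp: homog_def w_add)

lemma homog_const: "homog w 0 (const_poly a)"
  by (auto simp: homog_def const_poly_def w_0 split: if_splits)

lemma homog_1: "homog w 0 1"
  using homog_const[of 1] by simp

lemma homog_const_mult: "homog w g f \<Longrightarrow> homog w g (const_poly a * f)"
  using homog_mult[OF homog_const] by simp

lemma homog_prod: "(\<And>i. i \<in> I \<Longrightarrow> homog w (d i) (f i)) \<Longrightarrow> homog w (sum d I) (prod f I)"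
  by (induction I rule: infinite_finite_induct) (auto intro: homog_mult homog_1)

lemma homog_lin_poly:
  assumes "\<And>i. c $ i \<noteq> 0 \<Longrightarrow> w (Poly_Mapping.single i 1) = g"
  shows "homog w g (lin_poly c)"
  unfolding lin_poly_def
proof (rule homog_sum)
  fix i
  show "homog w g (const_poly (c $ i) * pvar i)"
    by (cases "c $ i = 0", simp, rule homog_const_mult)
      (use assms in \<open>auto simp: pvar_def homog_def\<close>)
qed

lemma homog_det:
  fixes E :: "((('k::field, 'n) pring, 'n) vec, 'n) vec"
  assumes "\<And>i j. homog w (d i) (E $ i $ j)"
  shows "homog w (\<Sum>i\<in>UNIV. d i) (det E)"
  unfolding det_def
proof (rule homog_sum)
  fix p :: "'n \<Rightarrow> 'n"
  have "homog w (\<Sum>i\<in>UNIV. d i) (\<Prod>i\<in>UNIV. E $ i $ p i)"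
    by (rule homog_prod) (rule assms)
  then show "homog w (\<Sum>i\<in>UNIV. d i) (of_int (sign p) * (\<Prod>i\<in>UNIV. E $ i $ p i))"
    by (cases "evenperm p") (simp_all add: sign_def homog_uminus)
qed

lemma hpart_mult_homog:
  assumes "homog w h a"
  shows "hpart w (h + g) (a * f) = a * hpart w g f"
proof -
  let ?G = "insert g (w ` Poly_Mapping.keys f)"
  have "hpart w (h + g) (a * f) = hpart w (h + g) (a * (\<Sum>g'\<in>?G. hpart w g' f))"
    by (subst sum_hpart) auto
  also have "\<dots> = (\<Sum>g'\<in>?G. hpart w (h + g) (a * hpart w g' f))"
    by (simp only: sum_distrib_left hpart_sum)
  also have "\<dots> = (\<Sum>g'\<in>?G. if g' = g then a * hpart w g f else 0)"
    by (intro sum.cong refl) (auto simp: hpart_homog[OF homog_mult[OF assms homog_hpart]])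
  also have "\<dots> = a * hpart w g f"
    by (subst sum.delta) auto
  finally show ?thesis .
qed

text \<open>The weight \<open>g\<close> need not have the form \<open>h + g'\<close>: each product
  of \<open>a\<close> with a component of the cofactor is homogeneous, so taking the part of weight
  \<open>g\<close> either keeps it or drops it.\<close>

lemma hpart_mult_homog_dvd:
  assumes "homog w h a" "a dvd f"
  shows "a dvd hpart w g f"
proof -
  obtain k where f: "f = a * k" using assms by blast
  let ?G = "w ` Poly_Mapping.keys k"
  have "hpart w g f = hpart w g (a * (\<Sum>g'\<in>?G. hpart w g' k))"
    unfolding f by (subst sum_hpart) auto
  also have "\<dots> = (\<Sum>g'\<in>?G. hpart w g (a * hpart w g' k))"
    by (simp only: sum_distrib_left hpart_sum)
  finally show ?thesis
    by (auto intro!: dvd_sum simp: hpart_homog[OF homog_mult[OF assms(1) homog_hpart]])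
qed

text \<open>Every row is the sum of its components and the determinant is additive in each row, so
  some choice of components keeps the part of weight \<open>g\<close> non-zero. The induction runs
  over the set \<open>R\<close> of rows already replaced. In the end the determinant is homogeneous,
  which forces the weights of the rows to add up to \<open>g\<close>.\<close>

lemma det_hpart_rows:
  fixes E :: "((('k::field, 'n) pring, 'n) vec, 'n) vec"
  assumes "hpart w g (det E) \<noteq> 0"
  shows "\<exists>d. (\<Sum>i\<in>UNIV. d i) = g \<and> hpart w g (det (\<chi> i j. hpart w (d i) (E $ i $ j))) \<noteq> 0"
proof -
  have "\<exists>d. hpart w g (det (\<chi> i. if i \<in> R then (\<chi> j. hpart w (d i) (E $ i $ j)) else E $ i)) \<noteq> 0"
    if "finite R" for R :: "'n set"
    using that
  proof (induction R rule: finite_induct)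
    case empty
    then show ?case using assms by simp
  next
    case (insert r R)
    then obtain d where
      d: "hpart w g (det (\<chi> i. if i \<in> R then (\<chi> j. hpart w (d i) (E $ i $ j)) else E $ i)) \<noteq> 0"
      by blast
    define G where "G = (\<Union>j. w ` Poly_Mapping.keys (E $ r $ j))"
    define c where "c = (\<lambda>i. if i \<in> R then (\<chi> j. hpart w (d i) (E $ i $ j)) else E $ i)"
    have "finite G" by (simp add: G_def)
    have row: "E $ r = (\<Sum>h\<in>G. (\<chi> j. hpart w h (E $ r $ j)))"
    proof -
      have "E $ r $ j = (\<Sum>h\<in>G. hpart w h (E $ r $ j))" for j
        by (rule sum_hpart[symmetric]) (use \<open>finite G\<close> in \<open>auto simp: G_def\<close>)
      then show ?thesis by (simp add: vec_eq_iff)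
    qed
    have "(\<chi> i. if i \<in> R then (\<chi> j. hpart w (d i) (E $ i $ j)) else E $ i)
        = (\<chi> i. if i = r then (\<Sum>h\<in>G. (\<chi> j. hpart w h (E $ r $ j))) else c i)"
      using insert row by (auto simp: vec_eq_iff c_def)
    then have "det (\<chi> i. if i \<in> R then (\<chi> j. hpart w (d i) (E $ i $ j)) else E $ i)
        = (\<Sum>h\<in>G. det (\<chi> i. if i = r then (\<chi> j. hpart w h (E $ r $ j)) else c i))"
      using det_linear_row_sum[OF \<open>finite G\<close>, of r "\<lambda>_ h. \<chi> j. hpart w h (E $ r $ j)" c] by simp
    with d have "(\<Sum>h\<in>G. hpart w g (det (\<chi> i. if i = r then (\<chi> j. hpart w h (E $ r $ j)) else c i))) \<noteq> 0"
      by (simp add: hpart_sum)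
    then obtain h where
      "hpart w g (det (\<chi> i. if i = r then (\<chi> j. hpart w h (E $ r $ j)) else c i)) \<noteq> 0"
      by (meson sum.neutral)
    moreover have "(\<chi> i. if i = r then (\<chi> j. hpart w h (E $ r $ j)) else c i)
       = (\<chi> i. if i \<in> insert r R then (\<chi> j. hpart w ((d(r := h)) i) (E $ i $ j)) else E $ i)"
      using insert by (auto simp: vec_eq_iff c_def)
    ultimately show ?case by (intro exI[of _ "d(r := h)"]) (simp only: not_False_eq_True)
  qed
  from this[OF finite, of UNIV] obtain d
    where d: "hpart w g (det (\<chi> i j. hpart w (d i) (E $ i $ j))) \<noteq> 0"
    unfolding if_P[OF UNIV_I] ..
  have "homog w (\<Sum>i\<in>UNIV. d i) (det (\<chi> i j. hpart w (d i) (E $ i $ j)))"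
    by (rule homog_det) simp
  with d have "(\<Sum>i\<in>UNIV. d i) = g"
    by (auto simp: hpart_homog split: if_splits)
  with d show ?thesis by blast
qed

end

definition tdeg :: "('n::finite \<Rightarrow>\<^sub>0 nat) \<Rightarrow> nat" where
  "tdeg m = (\<Sum>i\<in>UNIV. Poly_Mapping.lookup m i)"

interpretation tdeg: weight tdeg
  by unfold_locales (simp_all add: tdeg_def lookup_add sum.distrib)

lemma tdeg_single [simp]: "tdeg (Poly_Mapping.single i k) = k"
  by (simp add: tdeg_def lookup_single when_def sum.delta)

lemma tdeg_eq_0_iff: "tdeg m = 0 \<longleftrightarrow> m = 0"
  by (auto simp: tdeg_def poly_mapping_eq_iff fun_eq_iff)

lemma homog_tdeg_lin_poly: "homog tdeg 1 (lin_poly c)"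
  by (rule tdeg.homog_lin_poly) simp

lemma hpart_tdeg_0: "hpart tdeg 0 f = const_poly (Poly_Mapping.lookup f 0)"
  by (rule poly_mapping_eqI)
    (auto simp: lookup_hpart const_poly_def lookup_single tdeg_eq_0_iff)

subsection \<open>Determinants and divisibility\<close>

text \<open>Only the summand \<open>j = k\<close> survives; any other one repeats row
  \<open>j\<close> at position \<open>k\<close>.\<close>

lemma det_replace_row:
  fixes A :: "'a::comm_ring_1^'n^'n"
  shows "det (\<chi> i. if i = k then (\<Sum>j\<in>UNIV. x j *s A $ j) else A $ i) = x k * det A"
proof -
  have "det (\<chi> i. if i = k then A $ j else A $ i) = (if j = k then det A else 0)" for j
  proof (cases "j = k")
    case True
    then have "(\<chi> i. if i = k then A $ j else A $ i) = A" by (simp add: vec_eq_iff)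
    with True show ?thesis by simp
  next
    case False
    then show ?thesis
      using det_identical_rows[of k j "\<chi> i. if i = k then A $ j else A $ i"]
      by (simp add: row_def vec_eq_iff)
  qed
  then show ?thesis
    using det_linear_row_sum[of UNIV k "\<lambda>_ j. x j *s A $ j" "\<lambda>i. A $ i"]
    by (simp add: det_row_mul[of k _ "\<lambda>_. A $ _"] if_distrib[of "\<lambda>y. _ * y"] sum.delta cong: if_cong)
qed

text \<open>Laplace expansion. The cofactors are written as determinants with a unit vector as row
  \<open>i\<close>, which avoids submatrices of another index type.\<close>

lemma det_expand_row:
  fixes E :: "'a::comm_ring_1^'n^'n"
  shows "det (\<chi> r. if r = i then z else E $ r)
    = (\<Sum>k\<in>UNIV. z $ k * det (\<chi> r. if r = i then axis k 1 else E $ r))"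
proof -
  have "(\<Sum>k\<in>UNIV. z $ k *s axis k 1) = z"
    by (simp add: vec_eq_iff axis_def if_distrib[of "\<lambda>x. _ * x"] sum.delta cong: if_cong)
  then show ?thesis
    using det_linear_row_sum[of UNIV i "\<lambda>_ k. z $ k *s axis k 1" "\<lambda>r. E $ r"]
    by (simp only: det_row_mul[of i _ "\<lambda>_. axis _ 1"] finite)
qed

lemma det_columns_mul:
  fixes A :: "'a::comm_ring_1^'n^'n"
  shows "det (\<chi> i j. s j * A $ i $ j) = prod s UNIV * det A"
proof -
  have "(\<chi> i j. s j * A $ i $ j) = transpose (\<chi> j. s j *s transpose A $ j)"
    by (simp add: vec_eq_iff transpose_def)
  moreover have "(\<chi> j. transpose A $ j) = transpose A"
    by (simp add: vec_eq_iff)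
  ultimately show ?thesis
    by (simp add: det_rows_mul)
qed

text \<open>Cramer's rule modulo \<open>a\<close>: replacing column \<open>k\<close> of
  \<open>A\<close> by \<open>A x\<close> multiplies the determinant by \<open>x k\<close>, and that
  new column is divisible by \<open>a\<close>.\<close>

lemma dvd_mult_det:
  fixes A :: "'a::comm_ring_1^'n^'n"
  assumes "\<And>i. a dvd (\<Sum>l\<in>UNIV. A $ i $ l * x l)"
  shows "a dvd x k * det A"
proof -
  obtain y where y: "\<And>i. (\<Sum>l\<in>UNIV. A $ i $ l * x l) = a * y i"
    using assms unfolding dvd_def by metis
  have "x k * det A = x k * det (transpose A)" by simp
  also have "\<dots> = det (\<chi> i. if i = k then (\<Sum>j\<in>UNIV. x j *s transpose A $ j) else transpose A $ i)"
    by (rule det_replace_row[symmetric])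
  also have "(\<Sum>j\<in>UNIV. x j *s transpose A $ j) = a *s (\<chi> i. y i)"
    by (simp add: vec_eq_iff transpose_def y[symmetric] mult.commute)
  also have "det (\<chi> i. if i = k then a *s (\<chi> i. y i) else transpose A $ i)
      = a * det (\<chi> i. if i = k then (\<chi> i. y i) else transpose A $ i)"
    by (rule det_row_mul)
  finally show ?thesis by simp
qed

text \<open>Cramer's rule for rows, with \<open>C\<close> the matrix of cofactors. \<open>EC\<close>
  comes from replacing one row by another. For the opposite order \<open>CE\<close>, the columns of
  the difference between \<open>C E\<close> and \<open>det E\<close> times the identity are
  annihilated by \<open>E\<close>, and \<open>det E\<close> can be cancelled.\<close>

lemma det_smult_eq_sum_rows:
  fixes E :: "'a::idom^'n^'n"
  assumes "det E \<noteq> 0"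
  shows "det E *s y = (\<Sum>i\<in>UNIV. det (\<chi> r. if r = i then y else E $ r) *s E $ i)"
proof -
  define C where "C = (\<lambda>k i. det (\<chi> r. if r = i then axis k 1 else E $ r))"
  have expand: "det (\<chi> r. if r = i then z else E $ r) = (\<Sum>k\<in>UNIV. z $ k * C k i)" for i z
    unfolding C_def by (rule det_expand_row)
  have EC: "(\<Sum>k\<in>UNIV. E $ i' $ k * C k i) = (if i' = i then det E else 0)" for i i'
  proof -
    have "(\<Sum>j\<in>UNIV. (if j = i' then 1 else 0) *s E $ j) = E $ i'"
      by (simp add: vec_eq_iff if_distrib[of "\<lambda>x. x * _"] sum.delta cong: if_cong)
    then show ?thesis
      using det_replace_row[of i "\<lambda>j. if j = i' then 1 else 0" E]
      by (simp only: flip: expand) simp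
  qed
  have CE: "(\<Sum>i\<in>UNIV. C k i * E $ i $ j) = (if k = j then det E else 0)" for k j
  proof -
    have "(\<Sum>l\<in>UNIV. E $ i' $ l * ((\<Sum>i\<in>UNIV. C l i * E $ i $ j) - (if l = j then det E else 0))) = 0"
      for i'
    proof -
      have "(\<Sum>l\<in>UNIV. E $ i' $ l * (\<Sum>i\<in>UNIV. C l i * E $ i $ j))
          = (\<Sum>l\<in>UNIV. \<Sum>i\<in>UNIV. E $ i' $ l * C l i * E $ i $ j)"
        by (simp add: sum_distrib_left mult.assoc)
      also have "\<dots> = (\<Sum>i\<in>UNIV. \<Sum>l\<in>UNIV. E $ i' $ l * C l i * E $ i $ j)"
        by (rule sum.swap)
      also have "\<dots> = (\<Sum>i\<in>UNIV. (if i' = i then det E else 0) * E $ i $ j)"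
        by (simp add: EC flip: sum_distrib_right)
      also have "\<dots> = E $ i' $ j * det E"
        by (simp add: if_distrib[of "\<lambda>x. x * _"] sum.delta' cong: if_cong)
      finally show ?thesis
        by (simp add: right_diff_distrib sum_subtractf if_distrib[of "\<lambda>x. _ * x"] sum.delta cong: if_cong)
    qed
    \<comment> \<open>With modulus 0, \<open>dvd_mult_det\<close> says that a vector killed by a
      matrix is killed by its determinant.\<close>
    then have "0 dvd ((\<Sum>i\<in>UNIV. C k i * E $ i $ j) - (if k = j then det E else 0)) * det E"
      by (intro dvd_mult_det) simp
    with assms show ?thesis by simp
  qed
  have "(\<Sum>i\<in>UNIV. det (\<chi> r. if r = i then y else E $ r) * E $ i $ j) = det E * y $ j" for j
  proof -
    have "(\<Sum>i\<in>UNIV. (\<Sum>k\<in>UNIV. y $ k * C k i) * E $ i $ j)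
        = (\<Sum>i\<in>UNIV. \<Sum>k\<in>UNIV. y $ k * (C k i * E $ i $ j))"
      by (simp add: sum_distrib_right mult.assoc)
    also have "\<dots> = (\<Sum>k\<in>UNIV. \<Sum>i\<in>UNIV. y $ k * (C k i * E $ i $ j))"
      by (rule sum.swap)
    also have "\<dots> = (\<Sum>k\<in>UNIV. y $ k * (if k = j then det E else 0))"
      by (simp add: CE flip: sum_distrib_left)
    finally show ?thesis
      by (simp add: expand if_distrib[of "\<lambda>x. _ * x"] sum.delta mult.commute cong: if_cong)
  qed
  then show ?thesis by (simp add: vec_eq_iff)
qed

section \<open>Divisibility by products of pairwise non-associated primes\<close>

lemma prime_power_dvd_multD:
  fixes p :: "'a::idom"
  assumes "prime_elem p" "\<not> p dvd a" "p ^ N dvd a * b"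
  shows "p ^ N dvd b"
  using assms(3)
proof (induction N arbitrary: b)
  case (Suc N)
  then have "p dvd a * b" by (auto elim: dvd_mult_left)
  with assms obtain b' where b: "b = p * b'"
    by (auto simp: prime_elem_dvd_mult_iff)
  have "p * p ^ N dvd p * (a * b')"
    using Suc.prems by (simp add: b mult_ac)
  then have "p ^ N dvd a * b'"
    using assms(1) by (simp add: prime_elem_def)
  then have "p ^ N dvd b'" by (rule Suc.IH)
  then show ?case unfolding b power_Suc by (rule mult_dvd_mono[OF dvd_refl])
qed simp

lemma prime_not_dvd_prod:
  fixes p :: "'a::idom"
  assumes "prime_elem p" "\<And>i. i \<in> I \<Longrightarrow> \<not> p dvd f i"
  shows "\<not> p dvd prod f I"
  using assms(2)
  by (induction I rule: infinite_finite_induct)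
    (use prime_elem_not_unit[OF assms(1)] in \<open>auto simp: prime_elem_dvd_mult_iff[OF assms(1)]\<close>)

lemma prod_prime_power_dvd:
  fixes p :: "'i \<Rightarrow> 'a::idom"
  assumes "finite I" "\<And>i. i \<in> I \<Longrightarrow> prime_elem (p i)"
    and "\<And>i j. i \<in> I \<Longrightarrow> j \<in> I \<Longrightarrow> p i dvd p j \<Longrightarrow> i = j"
    and "\<And>i. i \<in> I \<Longrightarrow> p i ^ N dvd f"
  shows "prod p I ^ N dvd f"
  using assms
proof (induction I rule: finite_induct)
  case (insert i I)
  then obtain k where f: "f = prod p I ^ N * k" by auto
  have "\<not> p i dvd prod p I"
    by (rule prime_not_dvd_prod) (use insert in auto)
  then have "\<not> p i dvd prod p I ^ N"
    using insert.prems(1)[of i] by (auto dest: prime_elem_dvd_power)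
  then have "p i ^ N dvd k"
    by (rule prime_power_dvd_multD[rotated]) (use insert.prems(1,3)[of i] in \<open>auto simp: f\<close>)
  then have "p i ^ N * prod p I ^ N dvd k * prod p I ^ N"
    by (rule mult_dvd_mono[OF _ dvd_refl])
  then show ?case
    using insert.hyps by (simp add: f power_mult_distrib mult.commute)
qed simp

text \<open>If \<open>f * k\<close> is the product, each prime misses \<open>f\<close>, hence
  divides \<open>k\<close> and can be cancelled, until \<open>f\<close> divides 1.\<close>

lemma dvd_prod_primes_imp_unit:
  fixes f :: "'a::idom"
  assumes "finite I" "\<And>i. i \<in> I \<Longrightarrow> prime_elem (p i)" "\<And>i. i \<in> I \<Longrightarrow> \<not> p i dvd f" "f dvd prod p I"
  shows "f dvd 1"
  using assms
proof (induction I rule: finite_induct)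
  case (insert i I)
  then have "f dvd p i * prod p I" by simp
  then obtain k where k: "p i * prod p I = f * k" by (rule dvdE)
  then have "p i dvd f * k" by (metis dvd_triv_left)
  then have "p i dvd k"
    using insert.prems(1,2)[of i] by (auto simp: prime_elem_dvd_mult_iff)
  then obtain k' where "k = p i * k'" by (rule dvdE)
  with k have "p i * prod p I = p i * (f * k')" by (simp only: mult.left_commute)
  then have "prod p I = f * k'"
    using insert.prems(1)[of i] by simp
  then show ?case using insert by auto
qed simp

subsection \<open>Logarithmic modules and Saito's criterion\<close>

text \<open>The contraction of the form \<eta> with the constant vector field
  \<open>v\<close>.\<close>

definition dot ::
    "('k::field, 'n) vec \<Rightarrow> (('k, 'n::{finite,linorder}) pring, 'n) vec \<Rightarrow> ('k, 'n) pring" where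
  "dot v \<eta> = (\<Sum>i\<in>UNIV. const_poly (v $ i) * \<eta> $ i)"

lemma dot_add: "dot v (\<eta> + \<zeta>) = dot v \<eta> + dot v \<zeta>"
  and dot_diff: "dot v (\<eta> - \<zeta>) = dot v \<eta> - dot v \<zeta>"
  and dot_0 [simp]: "dot v 0 = 0" "dot 0 \<eta> = 0"
  and dot_smult: "dot v (f *s \<eta>) = f * dot v \<eta>"
  and dot_diff_left: "dot (v - w) \<eta> = dot v \<eta> - dot w \<eta>"
  and dot_smult_left: "dot (a *s v) \<eta> = const_poly a * dot v \<eta>"
  by (simp_all add: dot_def algebra_simps sum.distrib sum_subtractf sum_distrib_left
      const_poly_add const_poly_diff const_poly_mult)

lemma dot_sum: "dot v (\<Sum>i\<in>I. \<eta> i) = (\<Sum>i\<in>I. dot v (\<eta> i))"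
  by (induction I rule: infinite_finite_induct) (simp_all add: dot_add)

lemma dot_dform: "dot v (dform c) = const_poly (eval_form c v)"
  by (simp add: dot_def dform_def eval_form_def const_poly_sum const_poly_mult mult.commute)

lemma dot_axis: "dot (axis i 1) \<eta> = \<eta> $ i"
  by (simp add: dot_def axis_def if_distrib[of "\<lambda>x. const_poly x * _"] sum.delta cong: if_cong)

text \<open>A form \<open>\<eta>\<close> satisfies \<open>\<eta> \<and> dc \<in> c \<Omega>\<^sup>2\<close> iff \<open>\<eta>\<close> maps the vectors in the kernel of \<open>c\<close> into \<open>(c)\<close>,
  so that the members of \<open>log_module C\<close> are the numerators of the logarithmic forms.\<close>

definition log_module ::
    "('k::field, 'n) vec set \<Rightarrow> (('k, 'n::{finite,linorder}) pring, 'n) vec set" where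
  "log_module C = {\<eta>. \<forall>c\<in>C. \<forall>v. eval_form c v = 0 \<longrightarrow> lin_poly c dvd dot v \<eta>}"

definition reduced :: "('k::field, 'n::finite) vec set \<Rightarrow> bool" where
  "reduced C \<longleftrightarrow> finite C \<and> 0 \<notin> C \<and> (\<forall>c\<in>C. \<forall>d\<in>C. \<forall>a. d = a *s c \<longrightarrow> d = c)"

abbreviation lin_prod :: "('k::field, 'n::{finite,linorder}) vec set \<Rightarrow> ('k, 'n) pring" where
  "lin_prod C \<equiv> prod lin_poly C"

text \<open>The forms with numerators \<open>E $ i\<close> over the product \<open>Q\<close> of
  \<open>C\<close> have determinant \<open>det E / Q^n\<close>. It equals \<open>1/Q\<close> up to a
  unit iff \<open>det E\<close> is \<open>Q^(n-1)\<close> up to a unit, which explains the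
  exponent.\<close>

definition saito_free :: "('k::field, 'n::{finite,linorder}) vec set \<Rightarrow> bool" where
  "saito_free C \<longleftrightarrow> (\<exists>E u. (\<forall>i. E $ i \<in> log_module C) \<and> u dvd 1 \<and>
     det E = u * lin_prod C ^ (CARD('n) - 1))"

lemma reduced_finite: "reduced C \<Longrightarrow> finite C"
  by (simp add: reduced_def)

lemma reduced_nonzero: "reduced C \<Longrightarrow> c \<in> C \<Longrightarrow> c \<noteq> 0"
  by (auto simp: reduced_def)

lemma reduced_subset: "reduced C \<Longrightarrow> D \<subseteq> C \<Longrightarrow> reduced D"
  by (auto simp: reduced_def intro: finite_subset)

lemma reduced_dvd:
  assumes "reduced C" "c \<in> C" "d \<in> C" "lin_poly c dvd lin_poly d"
  shows "c = d"
  using assms lin_poly_dvd_lin_poly_iff[OF reduced_nonzero[OF assms(1,2)]]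
  unfolding reduced_def by metis

lemma reduced_prime: "reduced C \<Longrightarrow> c \<in> C \<Longrightarrow> prime_elem (lin_poly c)"
  by (rule prime_lin_poly) (rule reduced_nonzero)

lemma lin_prod_neq_0: "reduced C \<Longrightarrow> lin_prod C \<noteq> 0"
  by (auto simp: reduced_def)

lemma reduced_not_dvd_lin_prod:
  assumes "reduced C" "c \<in> C" "D \<subseteq> C" "c \<notin> D"
  shows "\<not> lin_poly c dvd lin_prod D"
  by (rule prime_not_dvd_prod[OF reduced_prime[OF assms(1,2)]]) (use assms reduced_dvd in blast)

lemma log_moduleD: "\<eta> \<in> log_module C \<Longrightarrow> c \<in> C \<Longrightarrow> eval_form c v = 0 \<Longrightarrow> lin_poly c dvd dot v \<eta>"
  by (auto simp: log_module_def)

lemma log_moduleI: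
  "(\<And>c v. c \<in> C \<Longrightarrow> eval_form c v = 0 \<Longrightarrow> lin_poly c dvd dot v \<eta>) \<Longrightarrow> \<eta> \<in> log_module C"
  by (auto simp: log_module_def)

lemma log_module_smult: "\<eta> \<in> log_module C \<Longrightarrow> f *s \<eta> \<in> log_module C"
  by (auto simp: log_module_def dot_smult)

lemma log_module_0: "0 \<in> log_module C"
  by (auto simp: log_module_def)

lemma log_module_add: "\<eta> \<in> log_module C \<Longrightarrow> \<zeta> \<in> log_module C \<Longrightarrow> \<eta> + \<zeta> \<in> log_module C"
  by (auto simp: log_module_def dot_add)

lemma log_module_diff: "\<eta> \<in> log_module C \<Longrightarrow> \<zeta> \<in> log_module C \<Longrightarrow> \<eta> - \<zeta> \<in> log_module C"
  by (auto simp: log_module_def dot_diff)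

lemma log_module_sum: "(\<And>i. i \<in> I \<Longrightarrow> \<eta> i \<in> log_module C) \<Longrightarrow> (\<Sum>i\<in>I. \<eta> i) \<in> log_module C"
  by (induction I rule: infinite_finite_induct) (auto intro: log_module_0 log_module_add)

lemma log_module_mono: "C \<subseteq> D \<Longrightarrow> log_module D \<subseteq> log_module C"
  by (auto simp: log_module_def)

lemma log_module_if_dvd: "\<eta> = f *s \<zeta> \<Longrightarrow> (\<And>c. c \<in> C \<Longrightarrow> lin_poly c dvd f) \<Longrightarrow> \<eta> \<in> log_module C"
  by (auto simp: log_module_def dot_smult)

text \<open>In a basis of \<open>V\<close> with all vectors but one in the kernel of
  \<open>c\<close>, the contractions of the rows with these \<open>n - 1\<close> vectors are
  divisible by \<open>c\<close>. So \<open>n - 1\<close> columns of the transformed matrix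
  are.\<close>

lemma det_dvd_lin_poly_power:
  fixes E :: "((('k::field, 'n::{finite,linorder}) pring, 'n) vec, 'n) vec"
  assumes E: "\<And>i. E $ i \<in> log_module C" and "c \<in> C" "c \<noteq> 0"
  shows "lin_poly c ^ (CARD('n) - 1) dvd det E"
proof -
  obtain k where k: "c $ k \<noteq> 0" using assms(3) by (auto simp: vec_eq_iff)
  \<comment> \<open>The value \<open>r k = 0\<close> makes \<open>v k\<close> the axis vector
    \<open>axis k 1\<close>, the one basis vector outside the kernel of \<open>c\<close>.\<close>
  define r where "r = (\<lambda>j. if j = k then 0 else c $ j / c $ k)"
  define v where "v = (\<lambda>j. axis j 1 - r j *s axis k 1 :: ('k, 'n) vec)"
  have "eval_form c (v j) = 0" if "j \<noteq> k" for j
    using k that by (simp add: v_def r_def eval_form_diff_right eval_form_smult_right)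
  then have ex: "\<exists>f. dot (v j) (E $ i) = lin_poly c * f" if "j \<noteq> k" for i j
    using log_moduleD[OF E \<open>c \<in> C\<close>, of "v j" i] that by (auto simp: dvd_def)
  define F where "F = (\<lambda>i j. SOME f. dot (v j) (E $ i) = lin_poly c * f)"
  have F: "dot (v j) (E $ i) = lin_poly c * F i j" if "j \<noteq> k" for i j
    unfolding F_def by (rule someI_ex[OF ex[OF that]])
  define s where "s = (\<lambda>j. if j = k then 1 else lin_poly c)"
  define F' where "F' = (\<chi> i j. if j = k then E $ i $ k else F i j)"
  \<comment> \<open>\<open>W\<close> undoes the change of basis: column \<open>j\<close> of
    \<open>E\<close> is the contraction with \<open>v j\<close> plus \<open>r j\<close> times column
    \<open>k\<close>.\<close>
  define W :: "((('k, 'n) pring, 'n) vec, 'n) vec"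
    where "W = (\<chi> l j. (if l = j then 1 else 0) + (if l = k then const_poly (r j) else 0))"
  have v: "dot (v j) \<eta> = \<eta> $ j - const_poly (r j) * \<eta> $ k" for j \<eta>
    by (simp add: v_def dot_diff_left dot_smult_left dot_axis)
  have sF: "s l * F' $ i $ l = E $ i $ l - const_poly (r l) * E $ i $ k" for i l
    using F[of l i] by (auto simp: s_def F'_def v r_def)
  have "E = (\<chi> i j. s j * F' $ i $ j) ** W"
  proof -
    have "(\<Sum>l\<in>UNIV. s l * F' $ i $ l * ((if l = j then 1 else 0) + (if l = k then const_poly (r j) else 0)))
       = E $ i $ j" for i j
    proof -
      have "(\<Sum>l\<in>UNIV. s l * F' $ i $ l * ((if l = j then 1 else 0) + (if l = k then const_poly (r j) else 0)))
        = s j * F' $ i $ j + s k * F' $ i $ k * const_poly (r j)"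
        by (simp add: distrib_left sum.distrib if_distrib[of "\<lambda>x. _ * x"] sum.delta cong: if_cong)
      then show ?thesis by (simp add: sF) (simp add: r_def)
    qed
    then show ?thesis
      by (simp add: vec_eq_iff matrix_matrix_mult_def W_def)
  qed
  then have "det E = prod s UNIV * det F' * det W"
    by (simp add: det_mul det_columns_mul)
  moreover have "prod s UNIV = lin_poly c ^ (CARD('n) - 1)"
    by (simp add: s_def prod.remove[of UNIV k])
  ultimately show ?thesis by (simp add: mult.assoc)
qed

lemma lin_prod_power_dvd_det:
  fixes E :: "((('k::field, 'n::{finite,linorder}) pring, 'n) vec, 'n) vec"
  assumes "\<And>i. E $ i \<in> log_module C" and "reduced C"
  shows "lin_prod C ^ (CARD('n) - 1) dvd det E"
  by (rule prod_prime_power_dvd)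
    (use assms reduced_prime reduced_finite reduced_dvd det_dvd_lin_poly_power reduced_nonzero in blast)+

text \<open>By Cramer's rule the coefficients of \<eta> are quotients by \<open>det E\<close> of
  determinants with one row replaced by \<eta>. All rows still belong to the module, so these
  determinants are divisible by \<open>lin_prod C ^ (CARD('n) - 1)\<close>, which is
  \<open>det E\<close> up to a unit.\<close>

lemma saito_free_span:
  fixes E :: "((('k::field, 'n::{finite,linorder}) pring, 'n) vec, 'n) vec"
  assumes E: "\<And>i. E $ i \<in> log_module C" and C: "reduced C"
    and u: "u dvd 1" and det: "det E = u * lin_prod C ^ (CARD('n) - 1)"
    and \<eta>: "\<eta> \<in> log_module C"
  shows "\<exists>a. \<eta> = (\<Sum>i\<in>UNIV. a i *s E $ i)"
proof -
  let ?q = "lin_prod C ^ (CARD('n) - 1)"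
  obtain u' where u': "u * u' = 1" using u by (auto simp: dvd_def)
  have q: "?q \<noteq> 0" using lin_prod_neq_0[OF C] by simp
  then have "det E \<noteq> 0" using det u' by auto
  have "?q dvd det (\<chi> r. if r = i then \<eta> else E $ r)" for i
    by (rule lin_prod_power_dvd_det[OF _ C]) (use \<eta> E in simp)
  then obtain y where y: "\<And>i. det (\<chi> r. if r = i then \<eta> else E $ r) = ?q * y i"
    unfolding dvd_def by metis
  have "?q * (u * \<eta> $ j) = ?q * (\<Sum>i\<in>UNIV. y i * E $ i $ j)" for j
    using arg_cong[OF det_smult_eq_sum_rows[OF \<open>det E \<noteq> 0\<close>, of \<eta>], of "\<lambda>z. z $ j"]
    unfolding det y by (simp add: sum_component sum_distrib_left mult_ac)
  then have "u * \<eta> $ j = (\<Sum>i\<in>UNIV. y i * E $ i $ j)" for j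
    using mult_left_cancel[OF q] by blast
  then have "u' * (u * \<eta> $ j) = u' * (\<Sum>i\<in>UNIV. y i * E $ i $ j)" for j
    by simp
  then have "\<eta> $ j = (\<Sum>i\<in>UNIV. (u' * y i) * E $ i $ j)" for j
    using u' by (simp add: sum_distrib_left mult.assoc[symmetric] mult.commute[of u'])
  then have "\<eta> = (\<Sum>i\<in>UNIV. (u' * y i) *s E $ i)"
    by (simp add: vec_eq_iff sum_component)
  then show ?thesis by (intro exI[of _ "\<lambda>i. u' * y i"])
qed

text \<open>\<open>det E\<close> divides the determinant of any \<open>n\<close> members of the
  module, and this bounds the cofactor \<open>u\<close>. With \<open>Q\<close> the product of
  \<open>C\<close>, the test matrix for \<open>c\<close> has \<open>(Q/c) dc\<close> as row
  \<open>k\<close> and \<open>Q dx_i\<close> as the other rows; it shows that \<open>u\<close>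
  divides \<open>Q/c\<close>. Therefore \<open>u\<close> divides \<open>Q\<close>, but no
  \<open>c\<close> divides \<open>u\<close>.\<close>

lemma saito_freeI:
  fixes E :: "((('k::field, 'n::{finite,linorder}) pring, 'n) vec, 'n) vec"
  assumes E: "\<And>i. E $ i \<in> log_module C" and C: "reduced C"
    and span: "\<And>\<eta>. \<eta> \<in> log_module C \<Longrightarrow> \<exists>a. \<eta> = (\<Sum>i\<in>UNIV. a i *s E $ i)"
  shows "saito_free C"
proof -
  let ?q = "lin_prod C ^ (CARD('n) - 1)"
  have q: "?q \<noteq> 0" using lin_prod_neq_0[OF C] by simp
  obtain u where u: "det E = ?q * u"
    using lin_prod_power_dvd_det[OF E C] by (auto simp: dvd_def)
  have dvd_det: "det E dvd det F" if "\<And>i. F $ i \<in> log_module C" for F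
  proof -
    have "\<forall>i. \<exists>a. F $ i = (\<Sum>j\<in>UNIV. a j *s E $ j)"
      using span[OF that] by blast
    then obtain a where "\<forall>i. F $ i = (\<Sum>j\<in>UNIV. a i j *s E $ j)"
      unfolding choice_iff by (rule exE)
    then have "F = (\<chi> i j. a i j) ** E"
      by (simp add: vec_eq_iff matrix_matrix_mult_def sum_component)
    then show ?thesis by (simp add: det_mul)
  qed
  have dvd: "u dvd lin_prod (C - {c})" if c: "c \<in> C" for c
  proof -
    obtain k where k: "c $ k \<noteq> 0" using reduced_nonzero[OF C c] by (auto simp: vec_eq_iff)
    define s where "s = (\<lambda>i. if i = k then lin_prod (C - {c}) else lin_prod C)"
    define D :: "((('k, 'n) pring, 'n) vec, 'n) vec"
      where "D = (\<chi> i. if i = k then dform c else axis i 1)"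
    have split: "lin_prod C = lin_poly c * lin_prod (C - {c})"
      using reduced_finite[OF C] that by (simp add: prod.remove)
    have "(\<chi> i. s i *s D $ i) $ i \<in> log_module C" for i
    proof (cases "i = k")
      case True
      show ?thesis
      proof (rule log_moduleI)
        fix d v assume d: "d \<in> C" "eval_form d v = 0"
        show "lin_poly d dvd dot v ((\<chi> i. s i *s D $ i) $ i)"
        proof (cases "d = c")
          case True
          then show ?thesis using d \<open>i = k\<close> by (simp add: D_def dot_smult dot_dform)
        next
          case False
          then have "lin_poly d dvd lin_prod (C - {c})"
            using d reduced_finite[OF C] by (intro dvd_prodI) auto
          then show ?thesis using \<open>i = k\<close> by (simp add: s_def dot_smult)
        qed
      qed
    next
      case False
      then show ?thesis
        using reduced_finite[OF C] by (intro log_module_if_dvd[of _ "lin_prod C"]) (auto simp: s_def)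
    qed
    then have "det E dvd det (\<chi> i. s i *s D $ i)" by (rule dvd_det)
    also have "det (\<chi> i. s i *s D $ i) = prod s UNIV * det D"
      by (simp add: det_rows_mul)
    also have "prod s UNIV = ?q * lin_prod (C - {c})"
      by (simp add: s_def prod.remove[of UNIV k])
    also have "det D = const_poly (c $ k)"
    proof -
      have "D = (\<chi> i. if i = k then (\<Sum>j\<in>UNIV. const_poly (c $ j) *s mat 1 $ j) else mat 1 $ i)"
        by (auto simp: D_def vec_eq_iff mat_def dform_def sum_component axis_def
            if_distrib[of "\<lambda>x. _ * x"] sum.delta cong: if_cong)
      then show ?thesis using det_replace_row[of k "\<lambda>j. const_poly (c $ j)" "mat 1"] by simp
    qed
    finally have "?q * u dvd ?q * (lin_prod (C - {c}) * const_poly (c $ k))"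
      by (simp add: u mult.assoc)
    then have "u dvd lin_prod (C - {c}) * const_poly (c $ k)"
      using q by (simp only: dvd_mult_cancel_left) simp
    moreover obtain e :: "('k, 'n) pring" where "const_poly (c $ k) * e = 1"
      using const_poly_dvd_1[OF k] by (metis dvdE)
    ultimately show ?thesis
      using dvd_mult2[of u "lin_prod (C - {c}) * const_poly (c $ k)" e] by (simp add: mult.assoc)
  qed
  have "u dvd 1"
  proof (cases "C = {}")
    case True
    then show ?thesis using u dvd_det[of "mat 1"] by (simp add: log_module_def)
  next
    case False
    show ?thesis
    proof (rule dvd_prod_primes_imp_unit)
      show "finite C" by (rule reduced_finite) fact
      show "prime_elem (lin_poly c)" if "c \<in> C" for c by (rule reduced_prime) fact+
      show "\<not> lin_poly c dvd u" if "c \<in> C" for c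
        using dvd[OF that] reduced_not_dvd_lin_prod[OF C that, of "C - {c}"] dvd_trans by blast
      obtain c where "c \<in> C" using False by blast
      then show "u dvd lin_prod C"
        using dvd reduced_finite[OF C] by (simp add: prod.remove)
    qed
  qed
  with E u show ?thesis unfolding saito_free_def by (metis mult.commute)
qed

subsection \<open>Bases of the dual space\<close>

lemma is_basis_inverse:
  assumes "is_basis b"
  obtains G where "(\<chi> i. b i) ** G = mat 1" "G ** (\<chi> i. b i) = mat 1"
proof -
  have "rows (\<chi> i. b i) = range b"
    by (auto simp: rows_def row_def)
  then obtain G where "G ** (\<chi> i. b i) = mat 1"
    using assms matrix_left_invertible_span_rows_gen[of "\<chi> i. b i"] unfolding is_basis_def by metis
  then show thesis
    using that matrix_left_right_inverse by blast
qed

lemma ex_is_basis: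
  fixes B :: "('k::field ^ 'n) set"
  assumes "vec.independent B"
  obtains b where "is_basis b" "B \<subseteq> range b"
proof -
  let ?E = "vec.extend_basis B"
  have ind: "vec.independent ?E" and span: "vec.span ?E = UNIV" and sup: "B \<subseteq> ?E"
    using assms by (simp_all add: vec.independent_extend_basis vec.extend_basis_superset)
  have "card ?E = CARD('n)"
    using vec.basis_card_eq_dim[OF _ _ ind, of UNIV] span by (simp add: vec_dim_card card_cart_basis)
  then obtain b where "bij_betw b (UNIV :: 'n set) ?E"
    using vec.finiteI_independent[OF ind] by (metis finite_same_card_bij finite_class.finite_UNIV)
  then have "range b = ?E" "inj b"
    by (auto simp: bij_betw_def)
  then show thesis
    using that[of b] ind span sup by (simp add: is_basis_def)
qed

lemma ex_is_basis_at:
  fixes c :: "'k::field ^ 'n"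
  assumes "c \<noteq> 0"
  obtains b h where "is_basis b" "b h = c"
proof -
  have "vec.independent {c}" using assms by simp
  from ex_is_basis[OF this] obtain b where "is_basis b" "c \<in> range b" by auto
  then show thesis using that by auto
qed

lemma vector_matrix_mult_eq_sum_rows: "a v* (\<chi> i. b i) = (\<Sum>i\<in>UNIV. a $ i *s b i)"
  by (simp add: vec_eq_iff vector_matrix_mult_def sum_component mult.commute)

text \<open>Take a basis \<open>b\<close> of the whole space that extends one of \<open>U\<close>.
  Then \<open>c v* G\<close> lists the coefficients of \<open>c\<close> in \<open>b\<close>, and
  \<open>I\<close> marks the members of \<open>b\<close> chosen in \<open>U\<close>.\<close>

lemma subspace_coordinates:
  fixes U :: "('k::field ^ 'n) set"
  assumes "vec.subspace U"
  obtains G G' :: "'k ^ 'n ^ 'n" and I where "G ** G' = mat 1"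
    "\<And>c. c \<in> U \<longleftrightarrow> (\<forall>i. i \<notin> I \<longrightarrow> (c v* G) $ i = 0)"
proof -
  obtain B where B: "B \<subseteq> U" "vec.independent B" "U \<subseteq> vec.span B"
    using vec.basis_exists[of U] by metis
  obtain b where b: "is_basis b" "B \<subseteq> range b"
    using ex_is_basis[OF B(2)] by blast
  obtain G where G: "(\<chi> i. b i) ** G = mat 1" "G ** (\<chi> i. b i) = mat 1"
    using is_basis_inverse[OF b(1)] by blast
  define I where "I = {i. b i \<in> B}"
  have B_eq: "B = b ` I" using b(2) by (auto simp: I_def)
  have inj: "inj_on b I" using b(1) by (auto simp: is_basis_def intro: inj_on_subset)
  have "c \<in> U \<longleftrightarrow> (\<forall>i. i \<notin> I \<longrightarrow> (c v* G) $ i = 0)" for c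
  proof
    assume "c \<in> U"
    then have "c \<in> vec.span (b ` I)" using B(3) B_eq by auto
    then obtain t where "c = (\<Sum>v\<in>b ` I. t v *s v)"
      using vec.span_finite[of "b ` I"] by auto
    then have "c = (\<Sum>i\<in>I. t (b i) *s b i)"
      by (simp add: sum.reindex[OF inj])
    also have "\<dots> = (\<Sum>i\<in>UNIV. (\<chi> i. if i \<in> I then t (b i) else 0) $ i *s b i)"
      by (rule sum.mono_neutral_cong_left) auto
    finally have "c = (\<chi> i. if i \<in> I then t (b i) else 0) v* (\<chi> i. b i)"
      by (simp only: vector_matrix_mult_eq_sum_rows)
    then have "c v* G = (\<chi> i. if i \<in> I then t (b i) else 0)"
      by (simp add: vector_matrix_mul_assoc G)
    then show "\<forall>i. i \<notin> I \<longrightarrow> (c v* G) $ i = 0" by simp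
  next
    assume 0: "\<forall>i. i \<notin> I \<longrightarrow> (c v* G) $ i = 0"
    have "c = (c v* G) v* (\<chi> i. b i)"
      by (simp add: vector_matrix_mul_assoc G)
    also have "\<dots> = (\<Sum>i\<in>UNIV. (c v* G) $ i *s b i)"
      by (rule vector_matrix_mult_eq_sum_rows)
    also have "\<dots> \<in> U"
    proof (rule vec.subspace_sum[OF assms])
      fix i
      show "(c v* G) $ i *s b i \<in> U"
        by (cases "i \<in> I")
          (use 0 B(1) in \<open>auto simp: I_def intro: vec.subspace_scale[OF assms] vec.subspace_0[OF assms]\<close>)
    qed
    finally show "c \<in> U" .
  qed
  then show thesis using that[OF G(2)] by blast
qed

subsection \<open>Change of coordinates\<close>

lemma eval_form_vector_matrix_mult: "eval_form (c v* G) v = eval_form c (G *v v)"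
proof -
  have "eval_form (c v* G) v = (\<Sum>j\<in>UNIV. \<Sum>i\<in>UNIV. c $ i * (G $ i $ j * v $ j))"
    by (simp add: eval_form_def vector_matrix_mult_def sum_distrib_left sum_distrib_right mult_ac)
  also have "\<dots> = (\<Sum>i\<in>UNIV. \<Sum>j\<in>UNIV. c $ i * (G $ i $ j * v $ j))"
    by (rule sum.swap)
  finally show ?thesis
    by (simp add: eval_form_def matrix_vector_mult_def sum_distrib_left)
qed

lemma subst_lin_poly: "subst (\<lambda>i. lin_poly (G $ i)) (lin_poly c) = lin_poly (c v* G)"
proof -
  have "lin_poly (\<Sum>i\<in>I. c $ i *s G $ i) = (\<Sum>i\<in>I. const_poly (c $ i) * lin_poly (G $ i))" for I
    by (induction I rule: infinite_finite_induct) (simp_all add: lin_poly_add lin_poly_smult)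
  moreover have "c v* G = (\<Sum>i\<in>UNIV. c $ i *s G $ i)"
    using vector_matrix_mult_eq_sum_rows[of c "\<lambda>i. G $ i"] by simp
  ultimately show ?thesis
    by (subst lin_poly_def) simp
qed

text \<open>Pull-back of forms along \<open>G\<close>: the substitution acts on the coefficients,
  right multiplication by the constant matrix \<open>cm G\<close> on the differentials. Contracting
  the pull-back with \<open>v\<close> amounts to contracting with \<open>G *v v\<close> and then
  substituting.\<close>

lemma saito_free_transport:
  fixes G G' :: "(('k::field, 'n::{finite,linorder}) vec, 'n) vec"
  assumes G: "G ** G' = mat 1" and "saito_free C"
  shows "saito_free ((\<lambda>c. c v* G) ` C)"
proof -
  obtain E :: "((('k, 'n) pring, 'n) vec, 'n) vec" and u where
    E: "\<And>i. E $ i \<in> log_module C" and u: "u dvd 1" "det E = u * lin_prod C ^ (CARD('n) - 1)"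
    using assms(2) unfolding saito_free_def by blast
  define \<sigma> :: "('k, 'n) pring \<Rightarrow> ('k, 'n) pring" where "\<sigma> = subst (\<lambda>i. lin_poly (G $ i))"
  define cm :: "(('k, 'n) vec, 'n) vec \<Rightarrow> ((('k, 'n) pring, 'n) vec, 'n) vec"
    where "cm = (\<lambda>M. \<chi> i j. const_poly (M $ i $ j))"
  have "cm G ** cm G' = cm (G ** G')"
    by (simp add: cm_def vec_eq_iff matrix_matrix_mult_def const_poly_sum const_poly_mult)
  also have "\<dots> = mat 1"
    by (simp add: G cm_def vec_eq_iff mat_def)
  finally have unit: "det (cm G) dvd 1"
    by (metis det_I det_mul dvd_triv_left)
  define E' where "E' = (\<chi> i j. \<sigma> (E $ i $ j)) ** cm G"
  have "det E' = \<sigma> (det E) * det (cm G)"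
    by (simp add: E'_def det_mul \<sigma>_def subst_det)
  moreover have inj: "inj_on (\<lambda>c. c v* G) C"
    by (rule inj_on_inverseI[of _ "\<lambda>c. c v* G'"]) (simp add: vector_matrix_mul_assoc G)
  ultimately have "det E' = (\<sigma> u * det (cm G)) * lin_prod ((\<lambda>c. c v* G) ` C) ^ (CARD('n) - 1)"
    by (simp add: u \<sigma>_def subst_lin_poly prod.reindex mult_ac)
  moreover have "\<sigma> u dvd 1"
    using subst_dvd[OF u(1)] by (simp add: \<sigma>_def)
  then have "\<sigma> u * det (cm G) dvd 1"
    using mult_dvd_mono[OF _ unit] by fastforce
  moreover have "E' $ i \<in> log_module ((\<lambda>c. c v* G) ` C)" for i
  proof (rule log_moduleI)
    fix c' v assume "c' \<in> (\<lambda>c. c v* G) ` C" and v: "eval_form c' v = 0"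
    then obtain c where c: "c \<in> C" "c' = c v* G" by blast
    have "lin_poly c dvd dot (G *v v) (E $ i)"
      using log_moduleD[OF E c(1)] v by (simp add: c eval_form_vector_matrix_mult)
    then have "lin_poly c' dvd \<sigma> (dot (G *v v) (E $ i))"
      unfolding \<sigma>_def c(2) subst_lin_poly[symmetric] by (rule subst_dvd)
    also have "\<sigma> (dot (G *v v) (E $ i)) = dot v (E' $ i)"
    proof -
      have "\<sigma> (dot (G *v v) (E $ i))
          = (\<Sum>l\<in>UNIV. \<Sum>j\<in>UNIV. const_poly (v $ j) * (\<sigma> (E $ i $ l) * const_poly (G $ l $ j)))"
        by (simp add: dot_def \<sigma>_def matrix_vector_mult_def const_poly_sum const_poly_mult
            sum_distrib_left sum_distrib_right mult_ac)
      also have "\<dots> = (\<Sum>j\<in>UNIV. \<Sum>l\<in>UNIV. const_poly (v $ j) * (\<sigma> (E $ i $ l) * const_poly (G $ l $ j)))"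
        by (rule sum.swap)
      finally show ?thesis
        by (simp add: dot_def E'_def matrix_matrix_mult_def cm_def sum_distrib_left)
    qed
    finally show "lin_poly c' dvd dot v (E' $ i)" .
  qed
  ultimately show ?thesis unfolding saito_free_def by blast
qed

lemma reduced_transport:
  assumes G: "G ** G' = mat 1" and "reduced C"
  shows "reduced ((\<lambda>c. c v* G) ` C)"
proof -
  have inv: "(c v* G) v* G' = c" for c
    by (simp add: vector_matrix_mul_assoc G)
  have "c v* G \<noteq> 0" if "c \<in> C" for c
  proof
    assume "c v* G = 0"
    then have "c = 0" using inv[of c] by simp
    with that assms(2) show False by (simp add: reduced_def)
  qed
  moreover have "d v* G = c v* G" if "c \<in> C" "d \<in> C" "d v* G = a *s (c v* G)" for a c d
  proof -
    have "d = a *s c"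
      using arg_cong[OF that(3), of "\<lambda>x. x v* G'"] by (simp only: inv scalar_vector_matrix_assoc)
    then have "d = c" using that(1,2) assms(2) unfolding reduced_def by blast
    then show ?thesis by simp
  qed
  ultimately show ?thesis
    using reduced_finite[OF assms(2)] unfolding reduced_def by (auto simp: image_iff)
qed

subsection \<open>Homogeneous bases and localization\<close>

lemma ex_key_if_subst_0_neq_0:
  fixes f :: "('k::field, 'n::{finite,linorder}) pring"
  assumes "subst (\<lambda>i. if i \<in> I then 0 else pvar i) f \<noteq> 0"
  shows "\<exists>m\<in>Poly_Mapping.keys f. \<forall>i\<in>I. Poly_Mapping.lookup m i = 0"
proof (rule ccontr)
  assume no: "\<not> (\<exists>m\<in>Poly_Mapping.keys f. \<forall>i\<in>I. Poly_Mapping.lookup m i = 0)"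
  have "(\<Prod>i\<in>UNIV. (if i \<in> I then 0 else pvar i :: ('k, 'n) pring) ^ Poly_Mapping.lookup m i) = 0"
    if m: "m \<in> Poly_Mapping.keys f" for m
  proof -
    from no m have "\<exists>i\<in>I. Poly_Mapping.lookup m i \<noteq> 0" by auto
    then obtain i where "i \<in> I" "Poly_Mapping.lookup m i \<noteq> 0" ..
    then have "(if i \<in> I then 0 else pvar i :: ('k, 'n) pring) ^ Poly_Mapping.lookup m i = 0"
      by simp
    then show ?thesis by (intro prod_zero[OF finite bexI[OF _ UNIV_I]])
  qed
  then have "subst (\<lambda>i. if i \<in> I then 0 else pvar i) f = 0"
    unfolding subst_def by (simp add: sum.neutral)
  with assms show False by simp
qed

lemma unit_lookup_0_neq_0:
  assumes "u dvd (1 :: ('k::field, 'n::{finite,linorder}) pring)"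
  shows "Poly_Mapping.lookup u 0 \<noteq> 0"
proof -
  have "subst (\<lambda>i. if i \<in> UNIV then 0 else pvar i) u dvd 1"
    using subst_dvd[OF assms, of "\<lambda>i. if i \<in> UNIV then 0 else pvar i"] by (simp only: subst_1)
  then have "subst (\<lambda>i. if i \<in> UNIV then 0 else pvar i) u \<noteq> 0" by auto
  from ex_key_if_subst_0_neq_0[OF this] obtain m where
    "m \<in> Poly_Mapping.keys u" "\<forall>i. Poly_Mapping.lookup m i = 0" by blast
  moreover from this have "m = 0" by (intro poly_mapping_eqI) simp
  ultimately show ?thesis by (simp add: in_keys_iff)
qed

context weight
begin

lemma homog_power: "homog w g f \<Longrightarrow> homog w (\<Sum>_<k. g) (f ^ k)" for k :: nat
  using homog_prod[of "{..<k}" "\<lambda>_. g" "\<lambda>_. f"] by simp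

text \<open>All \<open>dx_i\<close> get weight zero, so that contraction with a constant vector
  commutes with taking components even when the variables have different weights.\<close>

lemma log_module_hpart:
  assumes "\<eta> \<in> log_module C" "\<And>c. c \<in> C \<Longrightarrow> homog w h (lin_poly c)"
  shows "(\<chi> j. hpart w g (\<eta> $ j)) \<in> log_module C"
proof (rule log_moduleI)
  fix c v assume c: "c \<in> C" "eval_form c v = 0"
  have "dot v (\<chi> j. hpart w g (\<eta> $ j)) = hpart w g (dot v \<eta>)"
    by (simp add: dot_def hpart_sum hpart_const_mult)
  then show "lin_poly c dvd dot v (\<chi> j. hpart w g (\<eta> $ j))"
    using hpart_mult_homog_dvd[OF assms(2)[OF c(1)]] log_moduleD[OF assms(1) c] by simp
qed

text \<open>The part of \<open>det E\<close> to look at has the weight of the power of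
  \<open>lin_prod C\<close> plus \<open>g\<close>; it is that power times the part of
  \<open>f\<close> of weight \<open>g\<close>. The factor \<open>f\<close> is not assumed to be a
  unit: in a localization it contains the forms that are dropped.\<close>

lemma homog_rows:
  fixes E :: "((('k::field, 'n) pring, 'n) vec, 'n) vec"
  assumes E: "\<And>i. E $ i \<in> log_module C" and C: "reduced C"
    and homog: "\<And>c. c \<in> C \<Longrightarrow> homog w h (lin_poly c)"
    and det: "det E = f * lin_prod C ^ (CARD('n) - 1)" and g: "hpart w g f \<noteq> 0"
  obtains F d s where "\<And>i. F $ i \<in> log_module C" "\<And>i j. homog w (d i) (F $ i $ j)"
    "(\<Sum>i\<in>UNIV. d i) = (\<Sum>_<CARD('n) - 1. \<Sum>_\<in>C. h) + g"
    "det F = s * lin_prod C ^ (CARD('n) - 1)" "s \<noteq> 0" "homog w g s"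
proof -
  let ?q = "lin_prod C ^ (CARD('n) - 1)" and ?h = "\<Sum>_<CARD('n) - 1. \<Sum>_\<in>C. h"
  have q: "?q \<noteq> 0" using lin_prod_neq_0[OF C] by simp
  have hq: "homog w ?h ?q"
    by (rule homog_power, rule homog_prod, rule homog)
  have "hpart w (?h + g) (det E) = ?q * hpart w g f"
    using hpart_mult_homog[OF hq, of g f] by (simp add: det mult.commute)
  then have "hpart w (?h + g) (det E) \<noteq> 0" using q g by simp
  from det_hpart_rows[OF this] obtain d where d: "(\<Sum>i\<in>UNIV. d i) = ?h + g"
    "hpart w (?h + g) (det (\<chi> i j. hpart w (d i) (E $ i $ j))) \<noteq> 0" by blast
  define F where "F = (\<chi> i j. hpart w (d i) (E $ i $ j))"
  have F: "F $ i \<in> log_module C" for i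
    using log_module_hpart[OF E homog, of "d i" i] by (simp add: F_def)
  have hF: "homog w (d i) (F $ i $ j)" for i j
    by (simp add: F_def)
  obtain s where s: "det F = ?q * s"
    using lin_prod_power_dvd_det[OF F C] by (auto simp: dvd_def)
  have "homog w (?h + g) (det F)"
    using homog_det[of d F] hF d(1) by simp
  then have "det F = hpart w (?h + g) (det F)"
    by (simp add: hpart_homog)
  also have "\<dots> = ?q * hpart w g s"
    unfolding s by (rule hpart_mult_homog[OF hq])
  finally have "s = hpart w g s" using mult_left_cancel[OF q] unfolding s by blast
  then have "homog w g s" by (metis homog_hpart)
  moreover have "s \<noteq> 0" using d(2) s by (auto simp: F_def)
  moreover have "det F = s * ?q" by (simp add: s mult.commute)
  ultimately show thesis using that F hF d(1) by blast
qed

end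

text \<open>A unit has a non-zero part of degree 0. With \<open>g = 0\<close> the new cofactor is
  non-zero of degree 0, hence an invertible constant.\<close>

lemma saito_free_homog:
  fixes C :: "('k::field, 'n::{finite,linorder}) vec set"
  assumes "saito_free C" "reduced C"
  obtains E :: "((('k, 'n) pring, 'n) vec, 'n) vec" and d u
  where "\<And>i. E $ i \<in> log_module C" "u dvd 1" "det E = u * lin_prod C ^ (CARD('n) - 1)"
    "\<And>i j. homog tdeg (d i) (E $ i $ j)"
proof -
  obtain E :: "((('k, 'n) pring, 'n) vec, 'n) vec" and u where
    E: "\<And>i. E $ i \<in> log_module C" and u: "u dvd 1" "det E = u * lin_prod C ^ (CARD('n) - 1)"
    using assms(1) unfolding saito_free_def by blast
  have "hpart tdeg 0 u \<noteq> 0"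
    using unit_lookup_0_neq_0[OF u(1)] by (simp add: hpart_tdeg_0)
  from tdeg.homog_rows[OF E assms(2) homog_tdeg_lin_poly u(2) this] obtain F d s where
    F: "\<And>i. F $ i \<in> log_module C" "\<And>i j. homog tdeg (d i) (F $ i $ j)"
    "det F = s * lin_prod C ^ (CARD('n) - 1)" "s \<noteq> 0" "homog tdeg 0 s" by metis
  have "s = const_poly (Poly_Mapping.lookup s 0)"
    using hpart_homog[OF F(5), of 0] by (simp add: hpart_tdeg_0)
  then have "s dvd 1" using F(4) by (metis const_poly_dvd_1 const_poly_eq_0_iff)
  then show thesis using that F by blast
qed

section \<open>Localization in adapted coordinates\<close>

definition restr :: "'n set \<Rightarrow> ('n::finite \<Rightarrow>\<^sub>0 nat) \<Rightarrow> ('n \<Rightarrow>\<^sub>0 nat)" where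
  "restr I m = (\<Sum>i\<in>I. Poly_Mapping.single i (Poly_Mapping.lookup m i))"

lemma lookup_restr: "Poly_Mapping.lookup (restr I m) i = (if i \<in> I then Poly_Mapping.lookup m i else 0)"
  by (simp add: restr_def lookup_sum lookup_single when_def sum.delta)

lemma restr_0 [simp]: "restr I 0 = 0"
  and restr_add: "restr I (m + m') = restr I m + restr I m'"
  by (rule poly_mapping_eqI, simp add: lookup_restr lookup_add)+

lemma monomial_dvd:
  fixes f :: "('k::field, 'n::{finite,linorder}) pring"
  assumes "\<And>m. m \<in> Poly_Mapping.keys f \<Longrightarrow> restr I m = e"
  shows "Poly_Mapping.single e 1 dvd f"
proof -
  have "Poly_Mapping.single e 1 dvd Poly_Mapping.single m (Poly_Mapping.lookup f m)"
    if "m \<in> Poly_Mapping.keys f" for m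
  proof -
    have "m = e + restr (- I) m"
      by (rule poly_mapping_eqI) (simp add: lookup_add lookup_restr flip: assms[OF that])
    then have "Poly_Mapping.single m (Poly_Mapping.lookup f m)
        = Poly_Mapping.single e 1 * Poly_Mapping.single (restr (- I) m) (Poly_Mapping.lookup f m)"
      by (simp add: mult_single)
    then show ?thesis by simp
  qed
  then show ?thesis
    by (subst poly_mapping_sum_single) (rule dvd_sum)
qed

text \<open>Every monomial is graded by its part in the variables outside \<open>I\<close> and its degree in those in \<open>I\<close>.
  The forms in \<open>C\<close> that involve only the variables in \<open>I\<close> are homogeneous, and the minor that survives
  in the degree of a monomial \<open>m\<close> of the product of the other forms is a multiple of \<open>m\<close>.\<close>

lemma saito_free_coordinate_localization:
  fixes C :: "('k::field, 'n::{finite,linorder}) vec set"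
  assumes "saito_free C" and C: "reduced C"
  shows "saito_free {c \<in> C. \<forall>i. i \<notin> I \<longrightarrow> c $ i = 0}"
proof -
  define C' where "C' = {c \<in> C. \<forall>i. i \<notin> I \<longrightarrow> c $ i = 0}"
  let ?N = "CARD('n) - 1"
  obtain E :: "((('k, 'n) pring, 'n) vec, 'n) vec" and u where
    E: "\<And>i. E $ i \<in> log_module C" and u: "u dvd 1" "det E = u * lin_prod C ^ ?N"
    using assms(1) unfolding saito_free_def by blast
  have "C' \<subseteq> C" by (auto simp: C'_def)
  then have E': "E $ i \<in> log_module C'" for i
    using E log_module_mono by blast
  have C': "reduced C'" using C \<open>C' \<subseteq> C\<close> by (rule reduced_subset)
  define f where "f = u * lin_prod (C - C') ^ ?N"
  have "lin_prod C = lin_prod (C - C') * lin_prod C'"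
    by (rule prod.subset_diff) (use \<open>C' \<subseteq> C\<close> C reduced_finite in auto)
  then have detf: "det E = f * lin_prod C' ^ ?N"
    by (simp add: u f_def power_mult_distrib mult_ac)
  \<comment> \<open>Setting the variables in \<open>I\<close> to zero kills exactly those members of
    \<open>C\<close> that lie in \<open>C'\<close>. Therefore \<open>f\<close> survives, and it has
    a monomial \<open>m\<close> without variables in \<open>I\<close>.\<close>
  define \<tau> :: "('k, 'n) pring \<Rightarrow> ('k, 'n) pring" where "\<tau> = subst (\<lambda>i. if i \<in> I then 0 else pvar i)"
  have \<tau>_lin: "\<tau> (lin_poly c) = lin_poly (\<chi> i. if i \<in> I then 0 else c $ i)" for c
    by (subst (1) lin_poly_def, subst lin_poly_def)
      (auto simp: \<tau>_def intro!: sum.cong)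
  have "\<tau> u dvd 1"
    using subst_dvd[OF u(1)] by (simp add: \<tau>_def)
  moreover have "\<tau> (lin_poly c) \<noteq> 0" if "c \<in> C - C'" for c
    using that by (auto simp: \<tau>_lin C'_def vec_eq_iff)
  ultimately have "\<tau> f \<noteq> 0"
    using C by (auto simp: f_def \<tau>_def reduced_def)
  then obtain m where m: "m \<in> Poly_Mapping.keys f" "\<forall>i\<in>I. Poly_Mapping.lookup m i = 0"
    using ex_key_if_subst_0_neq_0[of I f] by (auto simp: \<tau>_def)
  define w where "w = (\<lambda>m :: 'n \<Rightarrow>\<^sub>0 nat. (restr (- I) m, tdeg (restr I m)))"
  interpret weight w
    by unfold_locales (simp_all add: w_def tdeg.w_add tdeg.w_0 restr_add zero_prod_def)
  have "restr I m = 0" "restr (- I) m = m"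
    by (auto intro!: poly_mapping_eqI simp: lookup_restr m(2))
  then have "w m = (m, 0)" by (simp add: w_def tdeg_eq_0_iff)
  then have g: "hpart w (m, 0) f \<noteq> 0" using m(1) by (auto simp: hpart_neq_0_iff)
  have homog: "homog w (0, 1) (lin_poly c)" if "c \<in> C'" for c
  proof (rule homog_lin_poly)
    fix i assume "c $ i \<noteq> 0"
    then have "i \<in> I" using that by (auto simp: C'_def)
    then have "restr (- I) (Poly_Mapping.single i 1) = 0"
      "restr I (Poly_Mapping.single i 1) = Poly_Mapping.single i 1"
      by (auto intro!: poly_mapping_eqI simp: lookup_restr lookup_single when_def)
    then show "w (Poly_Mapping.single i 1) = (0, 1)" by (simp add: w_def)
  qed
  obtain F d s where F: "\<And>i. F $ i \<in> log_module C'" and hF: "\<And>i j. homog w (d i) (F $ i $ j)"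
    and d: "(\<Sum>i\<in>UNIV. d i) = (\<Sum>_<?N. \<Sum>_\<in>C'. (0, 1)) + (m, 0)"
    and s: "det F = s * lin_prod C' ^ ?N" "s \<noteq> 0" "homog w (m, 0) s"
    using homog_rows[OF E' C' homog detf g] by blast
  define e where "e = (\<lambda>i. fst (d i))"
  have fst_sum: "fst (sum t J) = (\<Sum>i\<in>J. fst (t i))" for t :: "'x \<Rightarrow> ('n \<Rightarrow>\<^sub>0 nat) \<times> nat" and J
    by (induction J rule: infinite_finite_induct) simp_all
  have sum_e: "(\<Sum>i\<in>UNIV. e i) = m"
    using arg_cong[OF d, of fst] by (simp add: fst_sum e_def)
  let ?Z = "\<lambda>e. Poly_Mapping.single e (1 :: 'k)"
  obtain k where sk: "s = const_poly k * ?Z m" and k: "k \<noteq> 0"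
  proof -
    have "m' = m" if "m' \<in> Poly_Mapping.keys s" for m'
    proof -
      have "w m' = (m, 0)" using s(3) that by (auto simp: homog_def)
      then have "restr (- I) m' = m" "restr I m' = 0" by (auto simp: w_def tdeg_eq_0_iff)
      moreover have "m' = restr (- I) m' + restr I m'"
        by (rule poly_mapping_eqI) (simp add: lookup_add lookup_restr)
      ultimately show ?thesis by simp
    qed
    then have "s = const_poly (Poly_Mapping.lookup s m) * ?Z m"
      by (intro poly_mapping_eqI) (auto simp: lookup_const_poly_mult lookup_single when_def in_keys_iff)
    moreover from this have "Poly_Mapping.lookup s m \<noteq> 0" using s(2) by auto
    ultimately show thesis using that by blast
  qed
  \<comment> \<open>All monomials in row \<open>i\<close> have the same part \<open>e i\<close>
    outside \<open>I\<close>. Dividing the rows by these parts removes their product, the monomial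
    \<open>m\<close>, from the determinant, and only a constant remains besides the power of
    \<open>lin_prod C'\<close>.\<close>
  have "?Z (e i) dvd F $ i $ j" for i j
    by (rule monomial_dvd[of _ "- I"]) (use hF[of i j] in \<open>simp add: homog_def w_def e_def prod_eq_iff\<close>)
  then have "\<forall>i j. \<exists>x. F $ i $ j = ?Z (e i) * x" by (auto simp: dvd_def)
  then obtain x where x: "\<forall>i j. F $ i $ j = ?Z (e i) * x i j"
    unfolding choice_iff by (elim exE)
  define K :: "((('k, 'n) pring, 'n) vec, 'n) vec" where "K = (\<chi> i j. x i j)"
  have FK: "F $ i = ?Z (e i) *s K $ i" for i
    by (simp add: vec_eq_iff x K_def)
  have "F = (\<chi> i. ?Z (e i) *s K $ i)" by (simp add: vec_eq_iff x K_def)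
  then have "det F = ?Z m * det K"
    by (simp add: det_rows_mul prod_single sum_e)
  moreover have "det F = ?Z m * (const_poly k * lin_prod C' ^ ?N)"
    unfolding s(1) sk by (simp only: mult_ac)
  ultimately have "?Z m * det K = ?Z m * (const_poly k * lin_prod C' ^ ?N)"
    by (rule trans[OF sym])
  moreover have "?Z m \<noteq> 0" by (metis lookup_single_eq lookup_zero one_neq_zero)
  ultimately have "det K = const_poly k * lin_prod C' ^ ?N"
    by (metis mult_left_cancel)
  moreover have "K $ i \<in> log_module C'" for i
  proof (rule log_moduleI)
    fix c v assume c: "c \<in> C'" "eval_form c v = 0"
    have "lin_poly c dvd ?Z (e i) * dot v (K $ i)"
      using log_moduleD[OF F c, of i] by (simp add: FK dot_smult)
    \<comment> \<open>The \<open>e i\<close> add up to \<open>m\<close>, so none of them involves a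
      variable in \<open>I\<close>: \<tau> fixes \<open>?Z (e i)\<close> but kills
      \<open>lin_poly c\<close>.\<close>
    moreover have "\<not> lin_poly c dvd ?Z (e i)"
    proof
      assume "lin_poly c dvd ?Z (e i)"
      then have "\<tau> (lin_poly c) dvd \<tau> (?Z (e i))" unfolding \<tau>_def by (rule subst_dvd)
      moreover have "\<tau> (lin_poly c) = 0"
        using c by (auto simp: \<tau>_lin C'_def vec_eq_iff)
      moreover have "\<tau> (?Z (e i)) = ?Z (e i)"
      proof -
        have "Poly_Mapping.lookup (e i) j = 0" if "j \<in> I" for j
        proof -
          have "(\<Sum>i\<in>UNIV. Poly_Mapping.lookup (e i) j) = 0"
            using m(2) that by (simp add: sum_e flip: lookup_sum)
          then show ?thesis by simp
        qed
        then show ?thesis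
          by (simp add: \<tau>_def subst_single single_eq_monomial[of "e i"]) (auto intro!: prod.cong)
      qed
      moreover have "?Z (e i) \<noteq> 0" by (metis lookup_single_eq lookup_zero one_neq_zero)
      ultimately show False by simp
    qed
    ultimately show "lin_poly c dvd dot v (K $ i)"
      using reduced_prime[OF C' c(1)] by (simp add: prime_elem_dvd_mult_iff)
  qed
  ultimately show ?thesis
    using const_poly_dvd_1[OF k] unfolding saito_free_def C'_def by blast
qed

text \<open>\<open>U\<close> stands for the annihilator of a subspace \<open>X\<close>, so that
  \<open>C \<inter> U\<close> consists of the forms of the localization at \<open>X\<close>.
  Suitable coordinates turn \<open>U\<close> into a coordinate subspace.\<close>

lemma saito_free_localization:
  fixes C U :: "('k::field, 'n::{finite,linorder}) vec set"
  assumes "saito_free C" "reduced C" "vec.subspace U"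
  shows "saito_free (C \<inter> U)"
proof -
  obtain G G' :: "(('k, 'n) vec, 'n) vec" and I where G: "G ** G' = mat 1"
    and I: "\<And>c. c \<in> U \<longleftrightarrow> (\<forall>i. i \<notin> I \<longrightarrow> (c v* G) $ i = 0)"
    using subspace_coordinates[OF assms(3)] by blast
  have G': "G' ** G = mat 1" using G by (simp add: matrix_left_right_inverse)
  let ?g = "\<lambda>c. c v* G"
  have "saito_free {c \<in> ?g ` C. \<forall>i. i \<notin> I \<longrightarrow> c $ i = 0}"
    by (rule saito_free_coordinate_localization)
      (rule saito_free_transport[OF G assms(1)], rule reduced_transport[OF G assms(2)])
  also have "{c \<in> ?g ` C. \<forall>i. i \<notin> I \<longrightarrow> c $ i = 0} = ?g ` (C \<inter> U)"
    using I by auto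
  finally have "saito_free ((\<lambda>c. c v* G') ` ?g ` (C \<inter> U))"
    by (rule saito_free_transport[OF G'])
  then show ?thesis
    by (simp add: image_image vector_matrix_mul_assoc G)
qed

subsection \<open>Residues and deletion\<close>

text \<open>The residues along the hyperplane with form \<open>a\<close> of the arrangement \<open>C\<close>: the vectors in \<open>D\<close>
  represent the forms of the restriction, and the residue of \<open>\<eta>\<close> is the reduction of
  \<open>dot v \<eta> / lin_prod D\<close>.\<close>

locale restricted_forms =
  fixes C D :: "('k::field, 'n::{finite,linorder}) vec set" and a v :: "('k, 'n) vec"
  assumes C: "reduced C" and a: "a \<in> C" and av: "eval_form a v = 1" and fin_D: "finite D"
    and D_nonzero: "\<And>d. d \<in> D \<Longrightarrow> d - eval_form d v *s a \<noteq> 0"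
    and D_inj: "\<And>d d' t. d \<in> D \<Longrightarrow> d' \<in> D \<Longrightarrow>
      d' - eval_form d' v *s a = t *s (d - eval_form d v *s a) \<Longrightarrow> d = d'"
    and C_D: "\<And>c. c \<in> C \<Longrightarrow> c \<noteq> a \<Longrightarrow>
      \<exists>d\<in>D. \<exists>t. d - eval_form d v *s a = t *s (c - eval_form c v *s a)"
    and D_C: "\<And>d. d \<in> D \<Longrightarrow>
      \<exists>c\<in>C. c \<noteq> a \<and> (\<exists>t. d - eval_form d v *s a = t *s (c - eval_form c v *s a))"
begin

definition pr :: "('k, 'n) vec \<Rightarrow> ('k, 'n) vec" where "pr c = c - eval_form c v *s a"

abbreviation \<rho> :: "('k, 'n) pring \<Rightarrow> ('k, 'n) pring" where "\<rho> \<equiv> reduce a v"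

lemma a_nonzero: "a \<noteq> 0"
  by (rule reduced_nonzero[OF C a])

lemma prime_a: "prime_elem (lin_poly a)"
  by (rule reduced_prime[OF C a])

lemma eval_pr [simp]: "eval_form (pr c) v = 0"
  by (simp add: pr_def eval_form_diff eval_form_smult av)

lemma \<rho>_lin: "\<rho> (lin_poly c) = lin_poly (pr c)"
  by (simp add: reduce_lin_poly pr_def)

lemma pr_pr [simp]: "pr (pr c) = pr c"
  by (simp add: pr_def[of "pr c"])

lemma pr_nonzero: "c \<in> C \<Longrightarrow> c \<noteq> a \<Longrightarrow> pr c \<noteq> 0"
proof
  assume "c \<in> C" "c \<noteq> a" "pr c = 0"
  then have "c = eval_form c v *s a" by (simp add: pr_def)
  then have "c = a" using C a \<open>c \<in> C\<close> unfolding reduced_def by metis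
  with \<open>c \<noteq> a\<close> show False ..
qed

lemma \<rho>_lin_prod_D_nonzero: "\<rho> (lin_prod D) \<noteq> 0"
  using fin_D D_nonzero by (auto simp: reduce_prod \<rho>_lin pr_def)

text \<open>Two vectors on which \<open>a\<close> is 1 differ by a vector in the hyperplane. This is
  the independence of the residue from the choice of a basis.\<close>

lemma \<rho>_dot_eq:
  assumes "\<eta> \<in> log_module C" "eval_form a w = 1"
  shows "\<rho> (dot w \<eta>) = \<rho> (dot v \<eta>)"
proof -
  have "eval_form a (w - v) = 0" by (simp add: eval_form_diff_right av assms)
  then have "lin_poly a dvd dot (w - v) \<eta>" by (rule log_moduleD[OF assms(1) a])
  then show ?thesis by (simp add: reduce_eq_iff[OF av] dot_diff_left)
qed

text \<open>Since \<open>c\<close> is not a multiple of \<open>a\<close>, the vector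
  \<open>v\<close> can be moved parallel to the hyperplane of \<open>a\<close> into the kernel of
  \<open>c\<close>, to \<open>w\<close>. The contraction with \<open>w\<close> is divisible by
  \<open>c\<close>, and its reduction is the same.\<close>

lemma lin_pr_dvd_\<rho>_dot:
  assumes \<eta>: "\<eta> \<in> log_module C" and c: "c \<in> C" "c \<noteq> a"
  shows "lin_poly (pr c) dvd \<rho> (dot v \<eta>)"
proof -
  obtain u where u: "eval_form (pr c) u = 1"
    using ex_eval_form_1[OF pr_nonzero[OF c]] by blast
  define u' where "u' = u - eval_form a u *s v"
  have u': "eval_form a u' = 0" "eval_form c u' = 1"
    using u by (simp_all add: u'_def eval_form_diff_right eval_form_smult_right av pr_def
        eval_form_diff eval_form_smult mult.commute)
  define w where "w = v - eval_form c v *s u'"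
  have w: "eval_form a w = 1" "eval_form c w = 0"
    by (simp_all add: w_def eval_form_diff_right eval_form_smult_right av u')
  have "lin_poly c dvd dot w \<eta>" by (rule log_moduleD[OF \<eta> c(1) w(2)])
  then have "\<rho> (lin_poly c) dvd \<rho> (dot w \<eta>)" unfolding reduce_def by (rule subst_dvd)
  then show ?thesis by (simp add: \<rho>_lin \<rho>_dot_eq[OF \<eta> w(1)])
qed

text \<open>The reductions of the members of \<open>D\<close> are pairwise non-associated primes,
  each of which divides the reduced contraction. The condition \<open>\<rho> r = r\<close> selects
  the normal form of the residue class modulo \<open>a\<close>.\<close>

lemma residue_exists:
  assumes "\<eta> \<in> log_module C"
  obtains r where "\<rho> r = r" "\<rho> (dot v \<eta>) = \<rho> (lin_prod D) * r"
proof -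
  have "(\<Prod>d\<in>D. lin_poly (pr d)) ^ 1 dvd \<rho> (dot v \<eta>)"
  proof (rule prod_prime_power_dvd[OF fin_D])
    show "prime_elem (lin_poly (pr d))" if "d \<in> D" for d
      by (rule prime_lin_poly) (use D_nonzero[OF that] in \<open>simp add: pr_def\<close>)
    show "d = d'" if "d \<in> D" "d' \<in> D" "lin_poly (pr d) dvd lin_poly (pr d')" for d d'
      using that D_inj[of d d'] D_nonzero[of d]
      by (auto simp: lin_poly_dvd_lin_poly_iff pr_def)
    show "lin_poly (pr d) ^ 1 dvd \<rho> (dot v \<eta>)" if d: "d \<in> D" for d
    proof -
      obtain c t where c: "c \<in> C" "c \<noteq> a" and t: "pr d = t *s pr c"
        using D_C[OF d] by (auto simp: pr_def)
      have "t \<noteq> 0" using t D_nonzero[OF d] by (auto simp: pr_def)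
      then have "pr c = inverse t *s pr d" by (simp add: t)
      then have "lin_poly (pr d) dvd lin_poly (pr c)"
        by (simp add: lin_poly_smult)
      then show ?thesis using lin_pr_dvd_\<rho>_dot[OF assms c] dvd_trans by simp
    qed
  qed
  then obtain r where r: "\<rho> (dot v \<eta>) = \<rho> (lin_prod D) * r"
    by (auto simp: reduce_prod \<rho>_lin dvd_def)
  have "\<rho> (lin_prod D) * \<rho> r = \<rho> (\<rho> (lin_prod D) * r)"
    by (simp only: reduce_simps reduce_reduce[OF av])
  also have "\<dots> = \<rho> (lin_prod D) * r"
    by (simp only: r[symmetric] reduce_reduce[OF av])
  finally have "\<rho> r = r"
    using mult_left_cancel[OF \<rho>_lin_prod_D_nonzero] by blast
  then show thesis using that r by blast
qed

text \<open>A form with numerator \<zeta> over \<open>lin_prod (C - {a})\<close> has numerator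
  \<open>lin_poly a *s \<zeta>\<close> over \<open>lin_prod C\<close>. On numerators, multiplication
  by \<open>a\<close> is thus the inclusion of the module of the deletion.\<close>

lemma lin_a_smult_log_module_iff:
  "lin_poly a *s \<zeta> \<in> log_module C \<longleftrightarrow> \<zeta> \<in> log_module (C - {a})"
proof
  assume L: "lin_poly a *s \<zeta> \<in> log_module C"
  show "\<zeta> \<in> log_module (C - {a})"
  proof (rule log_moduleI)
    fix c w assume c: "c \<in> C - {a}" "eval_form c w = 0"
    then have "lin_poly c dvd lin_poly a * dot w \<zeta>"
      using log_moduleD[OF L, of c w] by (simp add: dot_smult)
    moreover have "\<not> lin_poly c dvd lin_poly a"
      using reduced_dvd[OF C, of c a] c a by auto
    ultimately show "lin_poly c dvd dot w \<zeta>"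
      using reduced_prime[OF C, of c] c by (simp add: prime_elem_dvd_mult_iff)
  qed
next
  assume L: "\<zeta> \<in> log_module (C - {a})"
  show "lin_poly a *s \<zeta> \<in> log_module C"
  proof (rule log_moduleI)
    fix c w assume c: "c \<in> C" "eval_form c w = 0"
    show "lin_poly c dvd dot w (lin_poly a *s \<zeta>)"
      by (cases "c = a") (use c log_moduleD[OF L, of c w] in \<open>auto simp: dot_smult\<close>)
  qed
qed

text \<open>Every axis vector is a multiple of \<open>v\<close> plus a vector in the kernel of
  \<open>a\<close>, so residue zero makes all coefficients divisible by \<open>a\<close>. Such forms
  have no pole along \<open>a\<close>: the kernel of the residue map is the module of the
  deletion.\<close>

lemma lin_a_smultI:
  assumes \<eta>: "\<eta> \<in> log_module C" and "lin_poly a dvd dot v \<eta>"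
  obtains \<zeta> where "\<eta> = lin_poly a *s \<zeta>"
proof -
  have "lin_poly a dvd \<eta> $ i" for i
  proof -
    let ?w = "axis i 1 - eval_form a (axis i 1) *s v"
    have "eval_form a ?w = 0"
      by (simp add: eval_form_diff_right eval_form_smult_right av)
    then have "lin_poly a dvd dot ?w \<eta>" by (rule log_moduleD[OF \<eta> a])
    also have "dot ?w \<eta> = \<eta> $ i - const_poly (a $ i) * dot v \<eta>"
      by (simp add: dot_diff_left dot_smult_left dot_axis)
    finally have "lin_poly a dvd (\<eta> $ i - const_poly (a $ i) * dot v \<eta>) + const_poly (a $ i) * dot v \<eta>"
      by (rule dvd_add) (use assms(2) in simp)
    then show ?thesis by simp
  qed
  then have "\<forall>i. \<exists>x. \<eta> $ i = lin_poly a * x" by (auto simp: dvd_def)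
  then obtain x where "\<forall>i. \<eta> $ i = lin_poly a * x i"
    unfolding choice_iff by (elim exE)
  then show thesis by (intro that[of "\<chi> i. x i"]) (simp add: vec_eq_iff)
qed

lemma homog_lin_prod: "homog tdeg (card X) (lin_prod X)"
  using tdeg.homog_prod[of X "\<lambda>_. 1" lin_poly, OF homog_tdeg_lin_poly] by simp

text \<open>If the residue map is onto, then by homogeneity the residue of one member of a homogeneous basis
  is a non-zero constant; subtracting multiples of it, the other members become divisible by \<open>a\<close>.\<close>

lemma saito_free_deletion_if_residue_1:
  assumes free: "saito_free C" and \<eta>: "\<eta> \<in> log_module C"
    and res: "lin_poly a dvd dot v \<eta> - lin_prod D"
  shows "saito_free (C - {a})"
proof -
  obtain E :: "((('k, 'n) pring, 'n) vec, 'n) vec" and d u where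
    E: "\<And>i. E $ i \<in> log_module C" and u: "u dvd 1" "det E = u * lin_prod C ^ (CARD('n) - 1)"
    and hE: "\<And>i j. homog tdeg (d i) (E $ i $ j)"
    using saito_free_homog[OF free C] by metis
  note span = saito_free_span[OF E C u]
  define P where "P = (\<lambda>i. dot v (E $ i))"
  have hP: "homog tdeg (d i) (P i)" for i
    unfolding P_def dot_def by (intro homog_sum tdeg.homog_const_mult hE)
  have "\<forall>i. \<exists>r. \<rho> r = r \<and> \<rho> (P i) = \<rho> (lin_prod D) * r"
    using residue_exists[OF E] unfolding P_def by metis
  then obtain R where R: "\<And>i. \<rho> (R i) = R i" "\<And>i. \<rho> (P i) = \<rho> (lin_prod D) * R i"
    by metis
  obtain x where x: "\<eta> = (\<Sum>i\<in>UNIV. x i *s E $ i)" using span[OF \<eta>] ..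
  have "\<rho> (lin_prod D) * 1 = \<rho> (dot v \<eta>)"
    using iffD2[OF reduce_eq_iff[OF av] res] by simp
  also have "\<dots> = \<rho> (lin_prod D) * (\<Sum>i\<in>UNIV. \<rho> (x i) * R i)"
    by (simp add: x dot_sum dot_smult R(2)[unfolded P_def] sum_distrib_left mult.left_commute)
  finally have "1 = (\<Sum>i\<in>UNIV. \<rho> (x i) * R i)"
    using mult_left_cancel[OF \<rho>_lin_prod_D_nonzero] by blast
  \<comment> \<open>The residues generate the unit ideal, hence they cannot all vanish at the
    origin.\<close>
  then have "subst (\<lambda>_. 0) 1 = subst (\<lambda>_. 0) (\<Sum>i\<in>UNIV. \<rho> (x i) * R i)"
    by simp
  then have "1 = (\<Sum>i\<in>UNIV. subst (\<lambda>_. 0) (\<rho> (x i)) * subst (\<lambda>_. 0) (R i))"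
    by simp
  then obtain i where "subst (\<lambda>_. 0) (R i) \<noteq> 0"
    by (metis (no_types, lifting) mult_zero_right sum.neutral zero_neq_one)
  then have r: "Poly_Mapping.lookup (R i) 0 \<noteq> 0" by (simp add: subst_zero)
  define r where "r = Poly_Mapping.lookup (R i) 0"
  have "r \<noteq> 0" using r by (simp add: r_def)
  have "lin_poly a dvd P i - lin_prod D * R i"
    using R[of i] by (simp flip: reduce_eq_iff[OF av])
  \<comment> \<open>\<open>card D\<close> is the degree of \<open>lin_prod D\<close>, so only the
    constant term of \<open>R i\<close> enters this component. As \<open>P i\<close> is homogeneous
    with a non-zero part of this degree, it equals that part.\<close>
  then have "lin_poly a dvd hpart tdeg (card D) (P i - lin_prod D * R i)"
    by (rule tdeg.hpart_mult_homog_dvd[OF homog_tdeg_lin_poly])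
  also have "hpart tdeg (card D) (P i - lin_prod D * R i)
      = hpart tdeg (card D) (P i) - lin_prod D * const_poly r"
    using tdeg.hpart_mult_homog[OF homog_lin_prod, of D 0 "R i"]
    by (simp add: hpart_diff hpart_tdeg_0 r_def)
  finally have dvd: "\<rho> (hpart tdeg (card D) (P i)) = \<rho> (lin_prod D) * const_poly r"
    by (simp flip: reduce_eq_iff[OF av])
  then have "hpart tdeg (card D) (P i) \<noteq> 0"
    using \<rho>_lin_prod_D_nonzero \<open>r \<noteq> 0\<close> by auto
  with hpart_homog[OF hP[of i], of "card D"] dvd
  have Pi: "\<rho> (P i) = \<rho> (lin_prod D) * const_poly r" by (simp split: if_splits)
  define s where "s = (\<lambda>j. const_poly (inverse r) * R j)"
  have unit: "const_poly r * const_poly (inverse r) = (1 :: ('k, 'n) pring)"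
    using \<open>r \<noteq> 0\<close> by (simp flip: const_poly_mult)
  have "\<rho> (s j * P i) = \<rho> (P j)" for j
  proof -
    have "\<rho> (s j * P i) = const_poly (inverse r) * R j * (\<rho> (lin_prod D) * const_poly r)"
      by (simp only: s_def reduce_simps R(1) Pi)
    also have "\<dots> = (const_poly r * const_poly (inverse r)) * (\<rho> (lin_prod D) * R j)"
      by (simp only: mult_ac)
    finally show ?thesis by (simp only: unit R(2) mult_1_left)
  qed
  then have Pj: "lin_poly a dvd P j - s j * P i" for j
    by (simp flip: reduce_eq_iff[OF av])
  have "\<exists>z. E $ j - s j *s E $ i = lin_poly a *s z" for j
    using lin_a_smultI[of "E $ j - s j *s E $ i"] Pj[of j]
    by (metis E P_def dot_diff dot_smult log_module_diff log_module_smult)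
  then obtain Z where Z: "\<And>j. E $ j - s j *s E $ i = lin_poly a *s Z j" by metis
  have Z_mem: "Z j \<in> log_module (C - {a})" for j
    unfolding lin_a_smult_log_module_iff[symmetric] Z[symmetric]
    by (intro log_module_diff log_module_smult E)
  \<comment> \<open>Read over the smaller denominator \<open>lin_prod (C - {a})\<close>: row
    \<open>i\<close> stands for \<open>a\<close> times the \<open>i\<close>-th basis form, the other
    rows for the basis forms corrected to residue zero.\<close>
  define F where "F = (\<chi> j. if j = i then E $ i else Z j)"
  show ?thesis
  proof (rule saito_freeI)
    show "F $ j \<in> log_module (C - {a})" for j
      using Z_mem E[of i] log_module_mono[of "C - {a}" C] by (auto simp: F_def)
    show "reduced (C - {a})" using C by (rule reduced_subset) blast
    fix \<zeta> assume "\<zeta> \<in> log_module (C - {a})"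
    then have "lin_poly a *s \<zeta> \<in> log_module C" by (simp add: lin_a_smult_log_module_iff)
    then obtain y where y: "lin_poly a *s \<zeta> = (\<Sum>j\<in>UNIV. y j *s E $ j)"
      using span by blast
    have E_eq: "E $ j = lin_poly a *s Z j + s j *s E $ i" for j
      by (simp flip: Z)
    define b where "b = y i + (\<Sum>j\<in>-{i}. y j * s j)"
    have split: "(\<Sum>j\<in>UNIV. f j) = f i + (\<Sum>j\<in>-{i}. f j)" for f :: "'n \<Rightarrow> (('k, 'n) pring, 'n) vec"
      using sum.remove[of UNIV i f] by (simp add: Compl_eq_Diff_UNIV)
    have eq: "lin_poly a *s \<zeta> = b *s E $ i + lin_poly a *s (\<Sum>j\<in>-{i}. y j *s Z j)"
    proof -
      have "(\<Sum>j\<in>-{i}. y j *s E $ j) = (\<Sum>j\<in>-{i}. lin_poly a *s (y j *s Z j) + (y j * s j) *s E $ i)"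
        by (rule sum.cong[OF refl], subst E_eq) (simp add: vec_eq_iff algebra_simps)
      also have "\<dots> = lin_poly a *s (\<Sum>j\<in>-{i}. y j *s Z j) + (\<Sum>j\<in>-{i}. y j * s j) *s E $ i"
        by (simp add: sum.distrib vec_eq_iff sum_component sum_distrib_left sum_distrib_right)
      finally show ?thesis
        unfolding y split by (simp add: b_def vec_eq_iff algebra_simps)
    qed
    \<comment> \<open>After contraction with \<open>v\<close>, only \<open>b * P i\<close> remains
      modulo \<open>a\<close>. Since \<open>\<rho> (P i)\<close> is non-zero, \<open>a\<close>
      divides \<open>b\<close>, and the whole equation can be divided by \<open>a\<close>.\<close>
    have "lin_poly a * dot v \<zeta> = b * P i + lin_poly a * dot v (\<Sum>j\<in>-{i}. y j *s Z j)"
      using arg_cong[OF eq, of "dot v"] by (simp add: dot_add dot_smult P_def)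
    from arg_cong[OF this, of \<rho>]
    have "\<rho> (lin_poly a) * \<rho> (dot v \<zeta>)
        = \<rho> b * \<rho> (P i) + \<rho> (lin_poly a) * \<rho> (dot v (\<Sum>j\<in>-{i}. y j *s Z j))"
      by (simp only: reduce_simps(1,3))
    moreover have "\<rho> (lin_poly a) = 0"
      by (simp add: reduce_eq_0_iff[OF av])
    ultimately have "\<rho> b = 0"
      using Pi \<open>r \<noteq> 0\<close> \<rho>_lin_prod_D_nonzero by simp
    then obtain b' where b': "b = lin_poly a * b'"
      unfolding reduce_eq_0_iff[OF av] by (rule dvdE)
    have "lin_poly a * \<zeta> $ l = lin_poly a * (b' *s E $ i + (\<Sum>j\<in>-{i}. y j *s Z j)) $ l" for l
      using arg_cong[OF eq, of "\<lambda>z. z $ l"] by (simp add: b' distrib_left mult.assoc)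
    moreover have "lin_poly a \<noteq> 0" using a_nonzero by simp
    ultimately have "\<zeta> $ l = (b' *s E $ i + (\<Sum>j\<in>-{i}. y j *s Z j)) $ l" for l
      by (rule mult_left_cancel[THEN iffD1, rotated])
    then have "\<zeta> = b' *s E $ i + (\<Sum>j\<in>-{i}. y j *s Z j)"
      unfolding vec_eq_iff by (rule allI)
    also have "\<dots> = (\<Sum>j\<in>UNIV. (if j = i then b' else y j) *s F $ j)"
      unfolding split by (simp add: F_def)
    finally show "\<exists>t. \<zeta> = (\<Sum>j\<in>UNIV. t j *s F $ j)"
      by (intro exI[of _ "\<lambda>j. if j = i then b' else y j"])
  qed
qed

end

section \<open>Forms with known residues, and the residue 1 from a free deletion\<close>

context restricted_forms
begin

text \<open>For \<open>c\<close> in \<open>C\<close> other than \<open>a\<close>, these are the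
  forms outside the span of \<open>a\<close> and \<open>c\<close>, that is, of the hyperplanes that
  do not contain the common kernel of \<open>a\<close> and \<open>c\<close>.\<close>

definition others :: "('k, 'n) vec \<Rightarrow> ('k, 'n) vec set" where
  "others c = {c' \<in> C - {a}. \<not> (\<exists>t. pr c' = t *s pr c)}"

lemma others_subset: "others c \<subseteq> C - {a}" and finite_others: "finite (others c)"
  and not_in_others: "c \<notin> others c"
proof -
  show "others c \<subseteq> C - {a}" by (auto simp: others_def)
  then show "finite (others c)" using reduced_finite[OF C] by (auto intro: finite_subset)
  show "c \<notin> others c" by (auto simp: others_def intro: exI[of _ 1])
qed

text \<open>A multiple of the form dual to the Euler derivation of the localization of \<open>C\<close> at the
  codimension two subspace defined by \<open>a\<close> and \<open>c\<close>.\<close>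

definition euler_form :: "('k, 'n) vec \<Rightarrow> (('k, 'n) pring, 'n) vec" where
  "euler_form c = lin_prod (others c) *s (lin_poly c *s dform a - lin_poly a *s dform c)"

lemma dot_euler_form: "dot w (euler_form c)
    = lin_prod (others c) * (lin_poly c * const_poly (eval_form a w) - lin_poly a * const_poly (eval_form c w))"
  by (simp add: euler_form_def dot_smult dot_diff dot_dform)

text \<open>The members of \<open>others c\<close> divide the prefactor. Any remaining form besides
  \<open>a\<close> is \<open>c' = t c + s a\<close> with \<open>t \<noteq> 0\<close>. On its kernel
  \<open>t c(w) = - s a(w)\<close>, so \<open>t\<close> times the second factor of the contraction
  is \<open>a(w)\<close> times \<open>c'\<close>.\<close>

lemma euler_form_mem:
  assumes c: "c \<in> C" "c \<noteq> a"
  shows "euler_form c \<in> log_module C"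
proof (rule log_moduleI)
  fix c' w assume c': "c' \<in> C" and w: "eval_form c' w = 0"
  consider "c' = a" | "c' \<in> others c" | t where "c' \<noteq> a" "pr c' = t *s pr c"
    using c' by (auto simp: others_def)
  then show "lin_poly c' dvd dot w (euler_form c)"
  proof cases
    case 1
    then show ?thesis using w by (simp add: dot_euler_form)
  next
    case 2
    then show ?thesis using finite_others by (simp add: dot_euler_form dvd_prodI)
  next
    case (3 t)
    then have "t \<noteq> 0" using pr_nonzero[OF c'] by auto
    define s where "s = eval_form c' v - t * eval_form c v"
    have c'_eq: "c' = t *s c + s *s a"
      using 3(2) by (simp add: pr_def s_def vec_eq_iff algebra_simps)
    then have "t * eval_form c w = - (s * eval_form a w)"
      using w by (simp add: eval_form_add eval_form_smult eq_neg_iff_add_eq_0)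
    then have tc: "const_poly t * const_poly (eval_form c w)
        = - (const_poly s * const_poly (eval_form a w) :: ('k, 'n) pring)"
      by (simp flip: const_poly_mult const_poly_uminus)
    have "const_poly t * (lin_poly c * const_poly (eval_form a w) - lin_poly a * const_poly (eval_form c w))
       = (const_poly t * lin_poly c + const_poly s * lin_poly a) * const_poly (eval_form a w)"
      unfolding right_diff_distrib mult.left_commute[of "const_poly t" "lin_poly a"] tc
      by (simp add: algebra_simps)
    then have "lin_poly c' dvd const_poly t * (lin_poly c * const_poly (eval_form a w) - lin_poly a * const_poly (eval_form c w))"
      by (simp add: c'_eq lin_poly_add lin_poly_smult)
    moreover have "\<not> lin_poly c' dvd const_poly t"
      using const_poly_dvd_1[OF \<open>t \<noteq> 0\<close>] not_unit_lin_poly dvd_trans by blast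
    ultimately have "lin_poly c' dvd lin_poly c * const_poly (eval_form a w) - lin_poly a * const_poly (eval_form c w)"
      using reduced_prime[OF C c'] prime_elem_dvd_mult_iff by blast
    then show ?thesis by (simp add: dot_euler_form)
  qed
qed

lemma dot_v_euler_form: "dot v (euler_form c) = lin_prod (others c) * lin_poly (pr c)"
  by (simp add: dot_euler_form av pr_def lin_poly_diff lin_poly_smult mult.commute[of "lin_poly a"])

lemma homog_euler_form: "homog tdeg (card (others c) + 1) (dot v (euler_form c))"
  unfolding dot_v_euler_form by (intro tdeg.homog_mult homog_lin_prod homog_tdeg_lin_poly)

text \<open>The prime \<open>pr c\<close> occurs only once here, and up to a constant it also occurs
  in the reduction of \<open>lin_prod D\<close>. Hence the residue of \<open>euler_form c\<close>,
  the quotient of the two, is not divisible by \<open>pr c\<close>.\<close>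

lemma \<rho>_euler_form: "\<rho> (dot v (euler_form c)) = (\<Prod>c'\<in>insert c (others c). lin_poly (pr c'))"
  using finite_others[of c] not_in_others[of c]
  by (simp add: dot_v_euler_form reduce_prod \<rho>_lin mult.commute)

lemma \<rho>_euler_form_nonzero:
  assumes "c \<in> C" "c \<noteq> a"
  shows "\<rho> (dot v (euler_form c)) \<noteq> 0"
  unfolding \<rho>_euler_form using finite_others[of c] others_subset[of c] assms pr_nonzero by auto

text \<open>The matrix of the relations between the residues \<open>dot v (E $ j)\<close> has determinant \<open>a\<close> up to a
  unit. Hence it has corank one at the origin, and \<open>c\<close> below is a vector of its maximal minors.\<close>

lemma proportional_residues:
  fixes E :: "((('k, 'n) pring, 'n) vec, 'n) vec"
  assumes E: "\<And>i. E $ i \<in> log_module C" and u: "u dvd 1"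
    and detE: "det E = u * lin_prod C ^ (CARD('n) - 1)"
    and free: "saito_free (C - {a})" and k: "\<not> lin_poly a dvd dot v (E $ k)"
  obtains j0 c where "Poly_Mapping.lookup (c j0) 0 \<noteq> 0"
    "\<And>j. lin_poly a dvd c j0 * dot v (E $ j) - c j * dot v (E $ j0)"
proof -
  let ?N = "CARD('n) - 1" and ?C' = "C - {a}"
  note span = saito_free_span[OF E C u detE]
  obtain Z :: "((('k, 'n) pring, 'n) vec, 'n) vec" and z where
    Z: "\<And>i. Z $ i \<in> log_module ?C'" and z: "z dvd 1" "det Z = z * lin_prod ?C' ^ ?N"
    using free unfolding saito_free_def by blast
  have "\<exists>t. lin_poly a *s Z $ i = (\<Sum>j\<in>UNIV. t j *s E $ j)" for i
    by (rule span) (simp add: lin_a_smult_log_module_iff Z)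
  then have "\<forall>i. \<exists>t. lin_poly a *s Z $ i = (\<Sum>j\<in>UNIV. t j *s E $ j)" by blast
  then obtain t where t: "\<forall>i. lin_poly a *s Z $ i = (\<Sum>j\<in>UNIV. t i j *s E $ j)"
    unfolding choice_iff by (elim exE)
  define T :: "((('k, 'n) pring, 'n) vec, 'n) vec" where "T = (\<chi> i j. t i j)"
  have aZ: "(\<chi> i. lin_poly a *s Z $ i) = T ** E"
    using t by (simp add: vec_eq_iff matrix_matrix_mult_def sum_component T_def)
  obtain u' where u': "u * u' = 1" using u by (auto simp: dvd_def)
  let ?q = "lin_prod ?C'"
  have q: "?q \<noteq> 0" by (rule lin_prod_neq_0) (rule reduced_subset[OF C], blast)
  have Q: "lin_prod C = lin_poly a * ?q"
    using reduced_finite[OF C] a by (simp add: prod.remove)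
  \<comment> \<open>Scaling all \<open>n\<close> rows by \<open>a\<close> contributes one power of
    \<open>a\<close> more than the exponent \<open>n - 1\<close> in \<open>det E\<close> does; the
    surplus factor \<open>a\<close> is what remains of \<open>det T\<close>.\<close>
  have "det T * (u * (lin_poly a * ?q) ^ ?N) = det (\<chi> i. lin_poly a *s Z $ i)"
    by (simp add: aZ det_mul detE Q)
  also have "\<dots> = lin_poly a ^ Suc ?N * (z * ?q ^ ?N)"
    by (simp add: det_rows_mul z)
  also have "\<dots> = (lin_poly a * ?q) ^ ?N * (lin_poly a * z)"
    by (simp only: power_mult_distrib power_Suc mult_ac)
  finally have "(lin_poly a * ?q) ^ ?N * (det T * u) = (lin_poly a * ?q) ^ ?N * (lin_poly a * z)"
    by (simp only: mult_ac)
  moreover have "(lin_poly a * ?q) ^ ?N \<noteq> 0" using q a_nonzero by simp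
  ultimately have "det T * u = lin_poly a * z"
    by (rule mult_left_cancel[THEN iffD1, rotated])
  then have "det T * u * u' = lin_poly a * z * u'" by simp
  then have detT: "det T = lin_poly a * (z * u')" by (simp add: mult.assoc u')
  have "z * u' dvd 1"
    using mult_dvd_mono[OF z(1), of u' 1] u' by (metis dvd_triv_right mult_1_left)
  then have "hpart tdeg 0 (z * u') \<noteq> 0"
    by (simp add: hpart_tdeg_0 unit_lookup_0_neq_0)
  \<comment> \<open>The linear part of \<open>det T\<close> is a non-zero multiple of
    \<open>a\<close>. So the degrees of the rows add up to 1: one row \<open>i0\<close> contributes
    its linear part, each other row its value at the origin.\<close>
  then have "hpart tdeg (1 + 0) (det T) \<noteq> 0"
    using a_nonzero unfolding detT tdeg.hpart_mult_homog[OF homog_tdeg_lin_poly] by simp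
  from tdeg.det_hpart_rows[OF this] obtain d where d: "(\<Sum>i\<in>UNIV. d i) = (1::nat)"
    and "hpart tdeg (1 + 0) (det (\<chi> i j. hpart tdeg (d i) (T $ i $ j))) \<noteq> 0" by auto
  then have det0: "det (\<chi> i j. hpart tdeg (d i) (T $ i $ j)) \<noteq> 0" by auto
  obtain i0 where i0: "d i0 \<noteq> 0" using d by (metis sum.neutral zero_neq_one)
  have d0: "d i = 0" if "i \<noteq> i0" for i
  proof -
    have "d i + d i0 \<le> (\<Sum>i\<in>UNIV. d i)"
      using sum_mono2[of UNIV "{i, i0}" d] that by simp
    then show ?thesis using i0 d by simp
  qed
  \<comment> \<open>\<open>det (M j)\<close> is the cofactor of \<open>T\<close> at row
    \<open>i0\<close> and column \<open>j\<close>. Expanding the determinant just obtained along row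
    \<open>i0\<close> shows that one of these cofactors does not vanish at the origin.\<close>
  define M where "M = (\<lambda>j. \<chi> r. if r = i0 then axis j 1 else T $ r)"
  define K where "K = (\<chi> r j. hpart tdeg 0 (T $ r $ j))"
  define x where "x = (\<chi> j. hpart tdeg (d i0) (T $ i0 $ j))"
  have "(\<chi> i j. hpart tdeg (d i) (T $ i $ j)) = (\<chi> r. if r = i0 then x else K $ r)"
    by (auto simp: vec_eq_iff d0 K_def x_def)
  with det0 have "(\<Sum>j\<in>UNIV. x $ j * det (\<chi> r. if r = i0 then axis j 1 else K $ r)) \<noteq> 0"
    by (simp only: det_expand_row[of i0 x K] not_False_eq_True)
  then obtain j0 where "det (\<chi> r. if r = i0 then axis j0 1 else K $ r) \<noteq> 0"
    by (metis (no_types, lifting) mult_zero_right sum.neutral)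
  moreover have "(\<chi> r. if r = i0 then axis j0 1 else K $ r)
      = (\<chi> r l. subst (\<lambda>_. 0) (M j0 $ r $ l))"
    by (auto simp: M_def K_def vec_eq_iff hpart_tdeg_0 subst_zero axis_def)
  ultimately have "subst (\<lambda>_. 0) (det (M j0)) \<noteq> 0"
    by (simp add: subst_det)
  then have lookup: "Poly_Mapping.lookup (det (M j0)) 0 \<noteq> 0" by (simp add: subst_zero)
  define P where "P = (\<lambda>j. dot v (E $ j))"
  have "lin_poly a dvd det (M j0) * P j - det (M j) * P j0" for j
  proof -
    \<comment> \<open>Modulo \<open>a\<close>, the vector \<open>P\<close> is orthogonal to the rows
      of \<open>T\<close>, as these express forms of residue zero; it is orthogonal to
      \<open>y\<close> by construction. So \<open>a\<close> divides \<open>P k * det W\<close>, and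
      the expansion of \<open>det W\<close> along \<open>y\<close> is the wanted difference.\<close>
    define y where "y = P j *s axis j0 1 - P j0 *s axis j 1"
    define W where "W = (\<chi> r. if r = i0 then y else T $ r)"
    have "lin_poly a dvd (\<Sum>l\<in>UNIV. W $ i $ l * P l)" for i
    proof (cases "i = i0")
      case True
      then have "(\<Sum>l\<in>UNIV. W $ i $ l * P l)
          = (\<Sum>l\<in>UNIV. (if l = j0 then P j * P l else 0) - (if l = j then P j0 * P l else 0))"
        by (intro sum.cong) (auto simp: W_def y_def axis_def algebra_simps)
      also have "\<dots> = 0"
        by (simp add: sum_subtractf sum.delta)
      finally show ?thesis by simp
    next
      case False
      then have "(\<Sum>l\<in>UNIV. W $ i $ l * P l) = dot v (lin_poly a *s Z $ i)"
        using t by (simp add: W_def T_def P_def dot_sum dot_smult)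
      then show ?thesis by (simp add: dot_smult)
    qed
    then have "lin_poly a dvd P k * det W" by (rule dvd_mult_det)
    then have "lin_poly a dvd det W"
      using k prime_a unfolding P_def by (simp add: prime_elem_dvd_mult_iff)
    moreover have "det W = (\<Sum>l\<in>UNIV. y $ l * det (M l))"
      unfolding W_def M_def by (rule det_expand_row)
    also have "\<dots> = (\<Sum>l\<in>UNIV. (if l = j0 then P j * det (M l) else 0) - (if l = j then P j0 * det (M l) else 0))"
      by (intro sum.cong) (auto simp: y_def axis_def algebra_simps)
    also have "\<dots> = det (M j0) * P j - det (M j) * P j0"
      by (simp add: sum_subtractf sum.delta mult.commute)
    ultimately show ?thesis by simp
  qed
  with lookup show thesis using that[of "\<lambda>j. det (M j)" j0] by (simp add: P_def)
qed

text \<open>All residues being proportional, the residue \<open>r\<close> of \<open>E $ j0\<close>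
  divides those of the Euler forms. The Euler form of one fixed \<open>c1\<close> bounds
  \<open>r\<close> by a product of linear forms; a factor \<open>pr c\<close> of \<open>r\<close> is
  then excluded by the Euler form of that same \<open>c\<close>. An inverse of \<open>r\<close>
  rescales \<open>E $ j0\<close> to residue 1.\<close>

lemma residue_1_if_saito_free_deletion:
  assumes free: "saito_free C" and free': "saito_free (C - {a})"
  obtains \<eta> where "\<eta> \<in> log_module C" "lin_poly a dvd dot v \<eta> - lin_prod D"
proof (cases "C = {a}")
  case True
  \<comment> \<open>There is no Euler form in this case, but \<open>lin_prod D = 1\<close> is the
    contraction of \<open>dform a\<close> with \<open>v\<close>.\<close>
  then have "D = {}" using D_C by auto
  moreover have "dform a \<in> log_module C"
    using True by (auto simp: log_module_def dot_dform)
  ultimately show thesis using that[of "dform a"] by (simp add: dot_dform av)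
next
  case False
  then obtain c1 where c1: "c1 \<in> C" "c1 \<noteq> a" using a by blast
  obtain E :: "((('k, 'n) pring, 'n) vec, 'n) vec" and d u where
    E: "\<And>i. E $ i \<in> log_module C" and u: "u dvd 1" "det E = u * lin_prod C ^ (CARD('n) - 1)"
    and hE: "\<And>i j. homog tdeg (d i) (E $ i $ j)"
    using saito_free_homog[OF free C] by metis
  note span = saito_free_span[OF E C u]
  have "\<exists>k. \<not> lin_poly a dvd dot v (E $ k)"
  proof (rule ccontr)
    assume no: "\<not> (\<exists>k. \<not> lin_poly a dvd dot v (E $ k))"
    obtain x where "euler_form c1 = (\<Sum>i\<in>UNIV. x i *s E $ i)"
      using span[OF euler_form_mem[OF c1]] by blast
    then have "lin_poly a dvd dot v (euler_form c1)"
      using no by (auto simp: dot_sum dot_smult intro!: dvd_sum dvd_mult)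
    then show False
      using \<rho>_euler_form_nonzero[OF c1] by (simp add: reduce_eq_0_iff[OF av])
  qed
  then obtain k where "\<not> lin_poly a dvd dot v (E $ k)" ..
  from proportional_residues[OF E u free' this] obtain j0 y where
    y0: "Poly_Mapping.lookup (y j0) 0 \<noteq> 0"
    and y: "\<And>j. lin_poly a dvd y j0 * dot v (E $ j) - y j * dot v (E $ j0)" by metis
  define P where "P = dot v (E $ j0)"
  have hP: "homog tdeg (d j0) P"
    unfolding P_def dot_def by (intro homog_sum tdeg.homog_const_mult hE)
  obtain r where r: "\<rho> r = r" "\<rho> P = \<rho> (lin_prod D) * r"
    unfolding P_def by (rule residue_exists[OF E])
  have dvd: "\<rho> (lin_prod D) * r dvd \<rho> (dot v (euler_form c))" if c: "c \<in> C" "c \<noteq> a" for c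
  proof -
    let ?f = "dot v (euler_form c)" and ?g = "card (others c) + 1"
    obtain x where x: "euler_form c = (\<Sum>i\<in>UNIV. x i *s E $ i)"
      using span[OF euler_form_mem[OF c]] by blast
    define s where "s = (\<Sum>i\<in>UNIV. x i * y i)"
    have "?f * y j0 - P * s = (\<Sum>i\<in>UNIV. x i * (y j0 * dot v (E $ i) - y i * P))"
      by (simp add: x s_def dot_sum dot_smult sum_distrib_left sum_distrib_right
          right_diff_distrib sum_subtractf mult_ac)
    then have "lin_poly a dvd ?f * y j0 - P * s"
      using y by (auto simp: P_def intro!: dvd_sum dvd_mult)
    \<comment> \<open>In the degree \<open>?g\<close> of the homogeneous \<open>?f\<close>, only the
      constant term of \<open>y j0\<close> contributes to \<open>?f * y j0\<close>. A factor that
      merely does not vanish at the origin is thus replaced by a non-zero constant.\<close>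
    then have "lin_poly a dvd hpart tdeg (?g + 0) (?f * y j0 - P * s)"
      by (rule tdeg.hpart_mult_homog_dvd[OF homog_tdeg_lin_poly])
    also have "hpart tdeg (?g + 0) (?f * y j0 - P * s)
        = ?f * const_poly (Poly_Mapping.lookup (y j0) 0) - hpart tdeg (?g + 0) (P * s)"
      unfolding hpart_diff tdeg.hpart_mult_homog[OF homog_euler_form] hpart_tdeg_0 ..
    finally have eq: "\<rho> (?f * const_poly (Poly_Mapping.lookup (y j0) 0)) = \<rho> (hpart tdeg (?g + 0) (P * s))"
      by (simp only: reduce_eq_iff[OF av])
    have "P dvd hpart tdeg (?g + 0) (P * s)"
      by (rule tdeg.hpart_mult_homog_dvd[OF hP]) simp
    then have "\<rho> P dvd \<rho> (hpart tdeg (?g + 0) (P * s))"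
      unfolding reduce_def by (rule subst_dvd)
    then have "\<rho> P dvd \<rho> ?f * const_poly (Poly_Mapping.lookup (y j0) 0)"
      by (simp only: eq[symmetric] reduce_simps)
    moreover obtain e :: "('k, 'n) pring" where e: "const_poly (Poly_Mapping.lookup (y j0) 0) * e = 1"
      using const_poly_dvd_1[OF y0] by (metis dvdE)
    ultimately have "\<rho> P dvd \<rho> ?f * const_poly (Poly_Mapping.lookup (y j0) 0) * e"
      by (rule_tac dvd_mult2)
    then show ?thesis by (simp add: mult.assoc e r(2))
  qed
  have "r dvd 1"
  proof (rule dvd_prod_primes_imp_unit)
    show "finite (insert c1 (others c1))" by (simp add: finite_others)
    show "prime_elem (lin_poly (pr c))" if "c \<in> insert c1 (others c1)" for c
      by (rule prime_lin_poly, rule pr_nonzero) (use that c1 others_subset[of c1] in auto)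
    show "r dvd (\<Prod>c\<in>insert c1 (others c1). lin_poly (pr c))"
      using dvd[OF c1] unfolding \<rho>_euler_form by (rule dvd_mult_right)
    show "\<not> lin_poly (pr c) dvd r" if "c \<in> insert c1 (others c1)" for c
    proof
      assume "lin_poly (pr c) dvd r"
      have c: "c \<in> C" "c \<noteq> a" using that c1 others_subset[of c1] by auto
      have prime: "prime_elem (lin_poly (pr c))"
        by (rule prime_lin_poly, rule pr_nonzero) (use c in auto)
      obtain e t where e: "e \<in> D" "pr e = t *s pr c"
        using C_D[OF c] by (auto simp: pr_def)
      have "lin_poly (pr c) dvd lin_poly (pr e)"
        by (simp add: e(2) lin_poly_smult)
      also have "\<dots> dvd \<rho> (lin_prod D)"
        unfolding reduce_prod \<rho>_lin using fin_D e(1) by (rule dvd_prodI)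
      \<comment> \<open>Two factors \<open>pr c\<close> must fit into a product that contains it
        once, the other factors not being proportional to it.\<close>
      finally have "lin_poly (pr c) * lin_poly (pr c) dvd \<rho> (lin_prod D) * r"
        using \<open>lin_poly (pr c) dvd r\<close> by (rule mult_dvd_mono)
      also have "\<dots> dvd lin_poly (pr c) * (\<Prod>c'\<in>others c. lin_poly (pr c'))"
        using dvd[OF c] finite_others[of c] not_in_others[of c] by (simp add: \<rho>_euler_form)
      finally have "lin_poly (pr c) dvd (\<Prod>c'\<in>others c. lin_poly (pr c'))"
        using pr_nonzero[OF c] by simp
      moreover have "\<not> lin_poly (pr c) dvd (\<Prod>c'\<in>others c. lin_poly (pr c'))"
        by (rule prime_not_dvd_prod[OF prime])
          (use lin_poly_dvd_lin_poly_iff[OF pr_nonzero[OF c]] in \<open>auto simp: others_def\<close>)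
      ultimately show False by contradiction
    qed
  qed
  then obtain s where s: "r * s = 1" by (metis dvdE)
  have "\<rho> r * \<rho> s = 1" using arg_cong[OF s, of \<rho>] by simp
  then have "\<rho> s * r = 1" using r(1) by (simp add: mult.commute)
  then have "\<rho> (dot v (s *s E $ j0)) = \<rho> (lin_prod D)"
    using r(2) by (simp add: dot_smult mult.left_commute flip: P_def)
  then show thesis
    using that[of "s *s E $ j0"] log_module_smult[OF E] by (simp only: reduce_eq_iff[OF av])
qed

end

subsection \<open>Arrangements and freeness\<close>

lemma proportional_if_kernel_subset:
  assumes "c \<noteq> 0" and ker: "\<And>v. eval_form c v = 0 \<Longrightarrow> eval_form d v = 0"
  shows "\<exists>t. d = t *s c"
proof -
  obtain v where v: "eval_form c v = 1" using ex_eval_form_1[OF assms(1)] ..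
  have "d $ i = eval_form d v * c $ i" for i
  proof -
    have "eval_form d (axis i 1 - c $ i *s v) = 0"
      by (rule ker) (simp add: eval_form_diff_right eval_form_smult_right v)
    then show ?thesis
      by (simp add: eval_form_diff_right eval_form_smult_right mult.commute)
  qed
  then have "d = eval_form d v *s c" by (simp add: vec_eq_iff)
  then show ?thesis ..
qed

lemma hyperplane_alpha:
  assumes "hyperplane H"
  shows "alpha H \<noteq> 0" "v \<in> H \<longleftrightarrow> eval_form (alpha H) v = 0"
proof -
  obtain c where c: "c \<noteq> 0" "H = {v. eval_form c v = 0}"
    using assms by (auto simp: hyperplane_def)
  have "H = {v \<in> UNIV. eval_form (alpha H) v = 0}"
    unfolding def_form_def by (rule someI[of _ c]) (simp add: c(2))
  then show H: "v \<in> H \<longleftrightarrow> eval_form (alpha H) v = 0" for v by auto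
  obtain v where "eval_form c v = 1" using ex_eval_form_1[OF c(1)] ..
  then have "v \<notin> H" by (simp add: c(2))
  then show "alpha H \<noteq> 0" using H[of v] by auto
qed

lemma hyperplane_eqI:
  assumes "hyperplane H" "hyperplane K" "alpha K = t *s alpha H"
  shows "H = K"
proof -
  have "t \<noteq> 0" using hyperplane_alpha(1)[OF assms(2)] assms(3) by auto
  then show ?thesis
    using hyperplane_alpha(2)[OF assms(1)] hyperplane_alpha(2)[OF assms(2)] assms(3)
    by (auto simp: eval_form_smult)
qed

context
  fixes A :: "('k::field, 'n::finite) vec set set"
  assumes A: "arrangement A"
begin

lemma arrangement_hyperplane: "H \<in> A \<Longrightarrow> hyperplane H"
  using A by (auto simp: arrangement_def)

lemma inj_on_alpha: "inj_on alpha A"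
proof (rule inj_onI)
  fix H K assume "H \<in> A" "K \<in> A" "alpha H = alpha K"
  then show "H = K"
    by (intro hyperplane_eqI[of H K 1] arrangement_hyperplane) simp_all
qed

lemma reduced_alpha: "reduced (alpha ` A)"
  unfolding reduced_def
proof (intro conjI ballI allI impI)
  show "finite (alpha ` A)" using A by (simp add: arrangement_def)
  show "0 \<notin> alpha ` A"
  proof
    assume "0 \<in> alpha ` A"
    then obtain H where "0 = alpha H" "H \<in> A" by (rule imageE)
    then show False using hyperplane_alpha(1)[OF arrangement_hyperplane, of H] by simp
  qed
  fix c d t assume "c \<in> alpha ` A" "d \<in> alpha ` A" and t: "d = t *s c"
  then obtain H K where HK: "H \<in> A" "K \<in> A" "c = alpha H" "d = alpha K"
    by (elim imageE)
  have "H = K"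
    by (rule hyperplane_eqI[OF _ _ t[unfolded HK(3,4)]]) (intro arrangement_hyperplane HK)+
  with HK show "d = c" by simp
qed

end

lemma def_poly_UNIV:
  fixes A :: "('k::field, 'n::{finite,linorder}) vec set set"
  assumes "arrangement A"
  shows "def_poly UNIV A = lin_prod (alpha ` A)"
  by (simp add: def_poly_def prod.reindex[OF inj_on_alpha[OF assms]])

text \<open>If \<open>c $ k \<noteq> 0\<close>, the entries in column \<open>k\<close> of the wedge
  product express each coefficient of \<eta> modulo \<open>c\<close> as a multiple of that of
  \<open>c\<close>, and contraction with a vector in the kernel kills this multiple. Conversely,
  entry \<open>(i, j)\<close> is the contraction with \<open>c_j e_i - c_i e_j\<close>, a vector in
  the kernel; the quotients by \<open>c\<close> inherit the alternating property by
  cancellation.\<close>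

lemma wedge_dform_iff:
  fixes \<eta> :: "(('k::field, 'n::{finite,linorder}) pring, 'n) vec"
  assumes "c \<noteq> 0"
  shows "(\<exists>\<theta>\<in>two_forms. wedge \<eta> (dform c) = (\<chi> i j. lin_poly c * \<theta> $ i $ j))
    \<longleftrightarrow> (\<forall>v. eval_form c v = 0 \<longrightarrow> lin_poly c dvd dot v \<eta>)"
proof (intro iffI allI impI)
  fix v assume "\<exists>\<theta>\<in>two_forms. wedge \<eta> (dform c) = (\<chi> i j. lin_poly c * \<theta> $ i $ j)"
    and v: "eval_form c v = 0"
  then obtain \<theta> where "wedge \<eta> (dform c) = (\<chi> i j. lin_poly c * \<theta> $ i $ j)"
    by (elim bexE)
  then have \<theta>: "\<eta> $ i * const_poly (c $ j) - \<eta> $ j * const_poly (c $ i) = lin_poly c * \<theta> $ i $ j" for i j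
    by (simp add: vec_eq_iff wedge_def dform_def)
  obtain k where k: "c $ k \<noteq> 0" using assms by (auto simp: vec_eq_iff)
  have eq: "\<eta> $ i * const_poly (c $ k) = lin_poly c * \<theta> $ i $ k + \<eta> $ k * const_poly (c $ i)" for i
    by (simp flip: \<theta>)
  have "const_poly (c $ k) * dot v \<eta> = (\<Sum>i\<in>UNIV. const_poly (v $ i) * (\<eta> $ i * const_poly (c $ k)))"
    by (simp add: dot_def sum_distrib_left mult_ac)
  also have "\<dots> = (\<Sum>i\<in>UNIV. const_poly (v $ i) * (lin_poly c * \<theta> $ i $ k)) + \<eta> $ k * const_poly (eval_form c v)"
    unfolding eq
    by (simp add: distrib_left sum.distrib eval_form_def const_poly_sum const_poly_mult sum_distrib_left mult_ac)
  finally have "lin_poly c dvd const_poly (c $ k) * dot v \<eta>"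
    by (simp add: v dvd_sum)
  moreover have "\<not> lin_poly c dvd const_poly (c $ k)"
    using const_poly_dvd_1[OF k] not_unit_lin_poly dvd_trans by blast
  ultimately show "lin_poly c dvd dot v \<eta>"
    using prime_elem_dvd_mult_iff[OF prime_lin_poly[OF assms]] by blast
next
  assume dvd: "\<forall>v. eval_form c v = 0 \<longrightarrow> lin_poly c dvd dot v \<eta>"
  have "lin_poly c dvd wedge \<eta> (dform c) $ i $ j" for i j
  proof -
    have "lin_poly c dvd dot (c $ j *s axis i 1 - c $ i *s axis j 1) \<eta>"
      using dvd by (simp add: eval_form_diff_right eval_form_smult_right)
    then show ?thesis
      by (simp add: dot_diff_left dot_smult_left dot_axis wedge_def dform_def mult.commute)
  qed
  then have "\<forall>i j. \<exists>x. wedge \<eta> (dform c) $ i $ j = lin_poly c * x" by (auto simp: dvd_def)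
  then obtain x where x: "\<forall>i j. wedge \<eta> (dform c) $ i $ j = lin_poly c * x i j"
    unfolding choice_iff by (elim exE)
  have "lin_poly c * x i i = lin_poly c * 0" for i
    by (simp flip: x add: wedge_def)
  then have diag: "x i i = 0" for i using assms by simp
  have "lin_poly c * x j i = lin_poly c * - x i j" for i j
  proof -
    have "lin_poly c * x j i = - (lin_poly c * x i j)"
      unfolding x[rule_format, symmetric] by (simp add: wedge_def)
    then show ?thesis by simp
  qed
  moreover have "lin_poly c \<noteq> 0" using assms by simp
  ultimately have "x j i = - x i j" for i j
    by (rule mult_left_cancel[THEN iffD1, rotated])
  note anti = this
  have "(\<chi> i j. x i j) \<in> two_forms"
    unfolding two_forms_def by (simp add: diag, intro allI, rule anti)
  moreover have "wedge \<eta> (dform c) = (\<chi> i j. lin_poly c * (\<chi> i j. x i j) $ i $ j)"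
    using x by (simp add: vec_eq_iff)
  ultimately show "\<exists>\<theta>\<in>two_forms. wedge \<eta> (dform c) = (\<chi> i j. lin_poly c * \<theta> $ i $ j)" ..
qed

lemma log_forms_iff:
  fixes A :: "('k::field, 'n::{finite,linorder}) vec set set"
  assumes "arrangement A"
  shows "\<omega> \<in> log_forms A
    \<longleftrightarrow> (\<exists>\<eta>\<in>log_module (alpha ` A). scale_form (def_poly UNIV A) \<omega> = to_rat_form \<eta>)"
proof -
  have "(\<exists>\<theta>\<in>two_forms. wedge \<eta> (dform (alpha L)) = (\<chi> i j. lin_poly (alpha L) * \<theta> $ i $ j))
    \<longleftrightarrow> (\<forall>v. eval_form (alpha L) v = 0 \<longrightarrow> lin_poly (alpha L) dvd dot v \<eta>)" if "L \<in> A" for L \<eta>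
    by (rule wedge_dform_iff) (rule hyperplane_alpha(1)[OF arrangement_hyperplane[OF assms that]])
  then have "(\<forall>L\<in>A. \<exists>\<theta>\<in>two_forms. wedge \<eta> (dform (alpha L)) = (\<chi> i j. lin_poly (alpha L) * \<theta> $ i $ j))
    \<longleftrightarrow> \<eta> \<in> log_module (alpha ` A)" for \<eta>
    by (simp add: log_module_def)
  then show ?thesis
    unfolding log_forms_def mem_Collect_eq Bex_def by (simp only: conj_commute)
qed

section \<open>From fractional forms to their numerators\<close>

lemma to_rat_form_add: "to_rat_form (\<eta> + \<zeta>) = to_rat_form \<eta> + to_rat_form \<zeta>"
  and to_rat_form_0: "to_rat_form 0 = 0"
  and to_rat_form_smult: "to_rat_form (f *s \<eta>) = scale_form f (to_rat_form \<eta>)"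
  by (simp_all add: to_rat_form_def scale_form_def vec_eq_iff)

lemma to_rat_form_sum: "to_rat_form (\<Sum>i\<in>I. \<eta> i) = (\<Sum>i\<in>I. to_rat_form (\<eta> i))"
  by (induction I rule: infinite_finite_induct) (simp_all add: to_rat_form_add to_rat_form_0)

lemma to_rat_form_eq_iff: "to_rat_form \<eta> = to_rat_form \<zeta> \<longleftrightarrow> \<eta> = \<zeta>"
  by (simp add: to_rat_form_def vec_eq_iff)

lemma scale_form_cancel: "p \<noteq> 0 \<Longrightarrow> scale_form p \<omega> = scale_form p \<omega>' \<longleftrightarrow> \<omega> = \<omega>'"
  by (simp add: scale_form_def vec_eq_iff)

lemma ex_scale_form_eq_to_rat_form:
  assumes "p \<noteq> 0"
  obtains \<omega> where "scale_form p \<omega> = to_rat_form \<eta>"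
  using assms by (intro that[of "inverse (to_fract p) *s to_rat_form \<eta>"]) (simp add: scale_form_def)

lemma span_range_forms:
  fixes b :: "'n \<Rightarrow> ('k::field, 'n::{finite,linorder}) rat_one_form"
  assumes "inj b"
  shows "forms.span (range b) = range (\<lambda>a. \<Sum>i\<in>UNIV. scale_form (a i) (b i))"
proof -
  have eq: "(\<Sum>v\<in>range b. scale_form (u v) v) = (\<Sum>i\<in>UNIV. scale_form (u (b i)) (b i))" for u
    by (simp add: sum.reindex[OF assms])
  have "(\<Sum>i\<in>UNIV. scale_form (a i) (b i)) \<in> range (\<lambda>u. \<Sum>v\<in>range b. scale_form (u v) v)" for a
  proof -
    have "(\<Sum>i\<in>UNIV. scale_form (a i) (b i)) = (\<Sum>v\<in>range b. scale_form (a (inv_into UNIV b v)) v)"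
      using eq[of "\<lambda>v. a (inv_into UNIV b v)"] assms by simp
    then show ?thesis by (rule range_eqI[where x = "\<lambda>v. a (inv_into UNIV b v)"])
  qed
  moreover have "forms.span (range b) = range (\<lambda>u. \<Sum>v\<in>range b. scale_form (u v) v)"
    by (rule forms.span_finite) simp
  ultimately show ?thesis by (auto simp: eq)
qed

lemma common_denominator:
  fixes u :: "'x \<Rightarrow> 'a::idom fract"
  assumes "finite T"
  shows "\<exists>D. D \<noteq> 0 \<and> (\<forall>x\<in>T. \<exists>p. to_fract D * u x = to_fract p)"
  using assms
proof (induction T rule: finite_induct)
  case empty
  show ?case by (rule exI[of _ 1]) simp
next
  case (insert y T)
  then obtain D where D: "D \<noteq> 0" "\<forall>x\<in>T. \<exists>p. to_fract D * u x = to_fract p" by blast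
  obtain a b where ab: "u y = Fract a b" "b \<noteq> 0" by (cases "u y") auto
  have "to_fract (D * b) * u y = to_fract (D * a)"
    using ab by (simp add: Fract_conv_to_fract)
  then have "\<exists>p. to_fract (D * b) * u y = to_fract p" ..
  moreover have "\<exists>p. to_fract (D * b) * u x = to_fract p" if x: "x \<in> T" for x
  proof -
    obtain p where p: "to_fract D * u x = to_fract p" using D(2) x by blast
    have "to_fract (D * b) * u x = to_fract b * (to_fract D * u x)"
      by (simp only: to_fract_mult mult_ac)
    also have "\<dots> = to_fract (b * p)" by (simp only: p to_fract_mult)
    finally show ?thesis ..
  qed
  ultimately show ?case
    using D(1) ab(2) by (intro exI[of _ "D * b"]) (simp only: ball_simps insert_iff mult_eq_0_iff, blast)
qed

text \<open>Clear denominators in a linear relation over the fraction field. This is how the size of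
  a basis of logarithmic forms is controlled.\<close>

lemma independent_vec_if_forms_independent:
  assumes "forms.independent B"
  shows "vec.independent B"
proof
  assume "vec.dependent B"
  then obtain T u v0 where T: "finite T" "T \<subseteq> B" "(\<Sum>v\<in>T. u v *s v) = 0" "v0 \<in> T" "u v0 \<noteq> 0"
    unfolding vec.dependent_explicit by blast
  obtain D where D: "D \<noteq> 0" "\<forall>x\<in>T. \<exists>p. to_fract D * u x = to_fract p"
    using common_denominator[OF T(1)] by blast
  from D(2) obtain p where p: "\<forall>x\<in>T. to_fract D * u x = to_fract (p x)"
    unfolding bchoice_iff by (elim exE)
  have "(\<Sum>v\<in>T. scale_form (p v) v) = (\<Sum>v\<in>T. to_fract D *s (u v *s v))"
    by (rule sum.cong) (simp_all add: scale_form_def flip: p[rule_format])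
  also have "\<dots> = to_fract D *s (\<Sum>v\<in>T. u v *s v)"
    by (rule vec.scale_sum_right[symmetric])
  finally have "(\<Sum>v\<in>T. scale_form (p v) v) = 0" by (simp add: T(3))
  then have "p v0 = 0"
    by (rule forms.independentD[OF assms T(1,2) _ T(4)])
  then have "to_fract D * u v0 = 0" using p T(4) by simp
  with D(1) T(5) show False by simp
qed

text \<open>The forms \<open>dx_i = (Q dx_i) / Q\<close> are logarithmic, so a basis of the module
  spans the space over the fraction field. Being independent there too, it has exactly
  \<open>n\<close> members, and \<open>saito_freeI\<close> applies. Conversely,
  \<open>saito_free_span\<close> gives generation, and a non-zero determinant gives
  independence.\<close>

lemma free_arrangement_iff_saito_free:
  fixes A :: "('k::field, 'n::{finite,linorder}) vec set set"
  assumes A: "arrangement A"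
  shows "free_arrangement A \<longleftrightarrow> saito_free (alpha ` A)"
proof
  let ?C = "alpha ` A" and ?Q = "def_poly UNIV A"
  note C = reduced_alpha[OF A]
  have Q: "?Q \<noteq> 0" unfolding def_poly_UNIV[OF A] by (rule lin_prod_neq_0[OF C])
  {
    assume "free_arrangement A"
    then obtain B where ind: "forms.independent B" and span: "forms.span B = log_forms A"
      unfolding free_arrangement_def by blast
    have ind': "vec.independent B" by (rule independent_vec_if_forms_independent[OF ind])
    have "axis i 1 \<in> vec.span B" for i
    proof -
      have "scale_form ?Q (axis i 1) = to_rat_form (?Q *s axis i 1)"
        by (simp add: scale_form_def to_rat_form_def vec_eq_iff axis_def)
      moreover have "?Q *s axis i 1 \<in> log_module ?C"
      proof (rule log_module_if_dvd[OF refl])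
        show "lin_poly c dvd ?Q" if "c \<in> ?C" for c
          unfolding def_poly_UNIV[OF A] using reduced_finite[OF C] that by (rule dvd_prodI)
      qed
      ultimately have "axis i 1 \<in> forms.span B"
        unfolding span log_forms_iff[OF A] by blast
      then show ?thesis
      proof (induction rule: forms.span_induct_alt)
        case (step c x y)
        then show ?case
          unfolding scale_form_def by (intro vec.span_add[OF vec.span_scale[OF vec.span_base]])
      qed (rule vec.span_zero)
    qed
    then have "cart_basis \<subseteq> vec.span B" by (auto simp: cart_basis_def)
    then have "vec.span cart_basis \<subseteq> vec.span B" by (rule vec.span_minimal[OF _ vec.subspace_span])
    then have "vec.span B = UNIV" by (simp add: top_unique)
    then have "card B = CARD('n)"
      using vec.basis_card_eq_dim[OF _ _ ind', of UNIV] by (simp add: vec_dim_card card_cart_basis)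
    then obtain b where "bij_betw b (UNIV :: 'n set) B"
      using vec.finiteI_independent[OF ind'] by (metis finite_same_card_bij finite_class.finite_UNIV)
    then have b: "inj b" "range b = B" by (auto simp: bij_betw_def)
    have "\<forall>i. \<exists>\<eta>. \<eta> \<in> log_module ?C \<and> scale_form ?Q (b i) = to_rat_form \<eta>"
    proof
      fix i
      have "b i \<in> log_forms A" unfolding span[symmetric] by (rule forms.span_base) (use b in blast)
      then show "\<exists>\<eta>. \<eta> \<in> log_module ?C \<and> scale_form ?Q (b i) = to_rat_form \<eta>"
        unfolding log_forms_iff[OF A] by blast
    qed
    then obtain e where e: "\<forall>i. e i \<in> log_module ?C \<and> scale_form ?Q (b i) = to_rat_form (e i)"
      unfolding choice_iff by (elim exE)
    show "saito_free ?C"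
    proof (rule saito_freeI[of "\<chi> i. e i", OF _ C])
      show "(\<chi> i. e i) $ i \<in> log_module ?C" for i using e by simp
      fix \<eta> assume \<eta>: "\<eta> \<in> log_module ?C"
      obtain \<omega> where \<omega>: "scale_form ?Q \<omega> = to_rat_form \<eta>"
        by (rule ex_scale_form_eq_to_rat_form[OF Q])
      then have "\<omega> \<in> forms.span (range b)"
        unfolding b(2) span log_forms_iff[OF A] using \<eta> by blast
      then obtain t where "\<omega> = (\<Sum>i\<in>UNIV. scale_form (t i) (b i))"
        unfolding span_range_forms[OF b(1)] by (rule rangeE)
      then have "to_rat_form \<eta> = (\<Sum>i\<in>UNIV. scale_form (t i) (scale_form ?Q (b i)))"
        unfolding \<omega>[symmetric] by (simp add: forms.scale_sum_right mult.commute)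
      also have "\<dots> = to_rat_form (\<Sum>i\<in>UNIV. t i *s e i)"
        using e by (simp add: to_rat_form_sum to_rat_form_smult)
      finally have "\<eta> = (\<Sum>i\<in>UNIV. t i *s (\<chi> i. e i) $ i)"
        unfolding to_rat_form_eq_iff by simp
      then show "\<exists>t. \<eta> = (\<Sum>i\<in>UNIV. t i *s (\<chi> i. e i) $ i)"
        by (rule exI[of _ t])
    qed
  }
  assume "saito_free ?C"
  then obtain E :: "((('k, 'n) pring, 'n) vec, 'n) vec" and u where
    E: "\<And>i. E $ i \<in> log_module ?C" and u: "u dvd 1" "det E = u * lin_prod ?C ^ (CARD('n) - 1)"
    unfolding saito_free_def by blast
  have det: "det E \<noteq> 0" using u lin_prod_neq_0[OF C] by auto
  have "\<forall>i. \<exists>\<omega>. scale_form ?Q \<omega> = to_rat_form (E $ i)"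
    by (rule allI, rule ex_scale_form_eq_to_rat_form[OF Q], rule exI)
  then obtain b where b: "\<forall>i. scale_form ?Q (b i) = to_rat_form (E $ i)"
    unfolding choice_iff by (elim exE)
  have "inj b"
  proof (rule injI, rule ccontr)
    fix i j assume "b i = b j" "i \<noteq> j"
    then have "to_rat_form (E $ i) = to_rat_form (E $ j)" by (simp flip: b[rule_format])
    then have "row i E = row j E" by (simp add: to_rat_form_eq_iff row_def)
    then have "det E = 0" by (rule det_identical_rows[OF \<open>i \<noteq> j\<close>])
    with det show False ..
  qed
  have scale_b: "scale_form ?Q (\<Sum>i\<in>UNIV. scale_form (t i) (b i)) = to_rat_form (\<Sum>i\<in>UNIV. t i *s E $ i)" for t
  proof -
    have "scale_form ?Q (\<Sum>i\<in>UNIV. scale_form (t i) (b i)) = (\<Sum>i\<in>UNIV. scale_form (t i) (scale_form ?Q (b i)))"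
      by (simp add: forms.scale_sum_right mult.commute)
    then show ?thesis
      by (simp add: b to_rat_form_sum to_rat_form_smult)
  qed
  have "forms.independent (range b)"
  proof
    assume "forms.dependent (range b)"
    then obtain t where t: "(\<Sum>v\<in>range b. scale_form (t v) v) = 0" "\<exists>v\<in>range b. t v \<noteq> 0"
      using forms.dependent_finite[of "range b"] by auto
    then obtain k where k: "t (b k) \<noteq> 0" by blast
    have "(\<Sum>i\<in>UNIV. scale_form (t (b i)) (b i)) = 0"
      using t(1) by (simp add: sum.reindex[OF \<open>inj b\<close>])
    then have "to_rat_form (\<Sum>i\<in>UNIV. t (b i) *s E $ i) = to_rat_form 0"
      using scale_b[of "\<lambda>i. t (b i)"] by (simp add: to_rat_form_0)
    then have "(\<Sum>i\<in>UNIV. t (b i) *s E $ i) = 0"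
      by (simp only: to_rat_form_eq_iff)
    then have "t (b k) * det E = 0"
      using det_replace_row[of k "\<lambda>i. t (b i)" E] by (simp only: det_row_0)
    with det k show False by simp
  qed
  moreover have "forms.span (range b) = log_forms A"
  proof (intro equalityI subsetI)
    fix \<omega> assume "\<omega> \<in> forms.span (range b)"
    then obtain t where \<omega>: "\<omega> = (\<Sum>i\<in>UNIV. scale_form (t i) (b i))"
      unfolding span_range_forms[OF \<open>inj b\<close>] by (rule rangeE)
    have "(\<Sum>i\<in>UNIV. t i *s E $ i) \<in> log_module ?C"
      by (intro log_module_sum log_module_smult E)
    then show "\<omega> \<in> log_forms A"
      unfolding log_forms_iff[OF A] \<omega>
      by (intro bexI[of _ "\<Sum>i\<in>UNIV. t i *s E $ i"] scale_b)
  next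
    fix \<omega> assume "\<omega> \<in> log_forms A"
    then obtain \<eta> where \<eta>: "\<eta> \<in> log_module ?C" "scale_form ?Q \<omega> = to_rat_form \<eta>"
      unfolding log_forms_iff[OF A] by blast
    obtain t where "\<eta> = (\<Sum>i\<in>UNIV. t i *s E $ i)"
      using saito_free_span[OF E C u \<eta>(1)] ..
    then have "scale_form ?Q \<omega> = scale_form ?Q (\<Sum>i\<in>UNIV. scale_form (t i) (b i))"
      by (simp only: scale_b \<eta>(2))
    then have "\<omega> = (\<Sum>i\<in>UNIV. scale_form (t i) (b i))"
      by (simp only: scale_form_cancel[OF Q])
    then show "\<omega> \<in> forms.span (range b)"
      unfolding span_range_forms[OF \<open>inj b\<close>] by (rule range_eqI[where x = t])
  qed
  ultimately show "free_arrangement A"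
    unfolding free_arrangement_def by blast
qed

subsection \<open>The residue map\<close>

lemma alpha_ideal_iff: "f \<in> alpha_ideal H \<longleftrightarrow> lin_poly (alpha H) dvd f"
  by (auto simp: alpha_ideal_def cgenideal_def poly_ring_def dvd_def mult.commute)

lemma ideal_alpha_ideal: "ideal (alpha_ideal H) poly_ring"
  unfolding alpha_ideal_def
  by (rule cring.cgenideal_ideal[OF cring_poly_ring]) (simp add: poly_ring_def)

lemma bar_iff: "f \<in> bar H g \<longleftrightarrow> lin_poly (alpha H) dvd f - g"
proof -
  have "bar H g = {x + g | x. x \<in> alpha_ideal H}"
    by (auto simp: bar_def a_r_coset_def r_coset_def poly_ring_def)
  then have "f \<in> bar H g \<longleftrightarrow> f - g \<in> alpha_ideal H"
    by (auto simp: algebra_simps intro: exI[of _ "f - g"])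
  then show ?thesis by (simp add: alpha_ideal_iff)
qed

lemma bar_eq_iff: "bar H f = bar H g \<longleftrightarrow> lin_poly (alpha H) dvd f - g"
proof
  assume "bar H f = bar H g"
  moreover have "f \<in> bar H f" by (simp add: bar_iff)
  ultimately show "lin_poly (alpha H) dvd f - g" by (simp add: bar_iff)
next
  assume dvd: "lin_poly (alpha H) dvd f - g"
  have "lin_poly (alpha H) dvd x - f \<longleftrightarrow> lin_poly (alpha H) dvd x - g" for x
    using dvd_add_left_iff[OF dvd, of "x - f"] by simp
  then show "bar H f = bar H g" by (auto simp: bar_iff)
qed

lemma carrier_coord_ring: "carrier (coord_ring H) = range (bar H)"
  by (auto simp: coord_ring_def FactRing_def A_RCOSETS_def' bar_def poly_ring_def)

lemma bar_mult: "bar H f \<otimes>\<^bsub>coord_ring H\<^esub> bar H g = bar H (f * g)"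
  using ideal.rcoset_mult_add[OF ideal_alpha_ideal, of f g H]
  by (simp add: coord_ring_def FactRing_def bar_def poly_ring_def)

lemma def_form_restriction:
  assumes L: "hyperplane L" and "Y = H \<inter> L"
  shows "v \<in> Y \<longleftrightarrow> v \<in> H \<and> eval_form (def_form H Y) v = 0"
proof -
  have "Y = {v \<in> H. eval_form (alpha L) v = 0}"
    using hyperplane_alpha(2)[OF L] assms(2) by blast
  then have "Y = {v \<in> H. eval_form (def_form H Y) v = 0}"
    unfolding def_form_def by (rule someI)
  then show ?thesis by blast
qed

lemma inj_on_def_form:
  assumes "arrangement B"
  shows "inj_on (def_form H) (restriction B H)"
proof (rule inj_onI)
  fix Y Y' assume "Y \<in> restriction B H" "Y' \<in> restriction B H" and eq: "def_form H Y = def_form H Y'"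
  then obtain L L' where L: "L \<in> B" "Y = H \<inter> L" "L' \<in> B" "Y' = H \<inter> L'"
    unfolding restriction_def by blast
  show "Y = Y'"
    using def_form_restriction[OF arrangement_hyperplane[OF assms L(1)] L(2)]
      def_form_restriction[OF arrangement_hyperplane[OF assms L(3)] L(4)] eq by auto
qed

text \<open>The chosen form \<open>def_form H Y\<close> is determined only up to scalars and
  multiples of \<open>alpha H\<close>. Its representative \<open>pr\<close> vanishing at
  \<open>v\<close> has the same restriction to \<open>H\<close>, so proportionality of such
  representatives is equality of the kernels in \<open>H\<close>.\<close>

lemma restricted_forms_arrangement:
  fixes B :: "('k::field, 'n::{finite,linorder}) vec set set"
  assumes B: "arrangement B" and H: "H \<in> B" and v: "eval_form (alpha H) v = 1"
  shows "restricted_forms (alpha ` B) (def_form H ` restriction B H) (alpha H) v"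
proof -
  let ?a = "alpha H"
  define pr :: "('k, 'n) vec \<Rightarrow> ('k, 'n) vec" where "pr = (\<lambda>c. c - eval_form c v *s ?a)"
  note hyp = arrangement_hyperplane[OF B]
  have H_iff: "w \<in> H \<longleftrightarrow> eval_form ?a w = 0" for w
    by (rule hyperplane_alpha(2)[OF hyp[OF H]])
  have pr_v: "eval_form (pr c) v = 0" for c
    by (simp add: pr_def eval_form_diff eval_form_smult v)
  have pr_H: "eval_form (pr c) w = eval_form c w" if "w \<in> H" for c w
    using that by (simp add: pr_def eval_form_diff eval_form_smult H_iff)
  have pr_alpha: "pr (alpha L) \<noteq> 0" if L: "L \<in> B" "L \<noteq> H" for L
  proof
    assume "pr (alpha L) = 0"
    then have "alpha L = eval_form (alpha L) v *s ?a" by (simp add: pr_def)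
    then have "H = L" by (rule hyperplane_eqI[OF hyp[OF H] hyp[OF L(1)]])
    with L show False by simp
  qed
  have proportional: "\<exists>t. pr (def_form H (H \<inter> L)) = t *s pr (alpha L)" if L: "L \<in> B" "L \<noteq> H" for L
  proof (rule proportional_if_kernel_subset[OF pr_alpha[OF L]])
    fix w assume w: "eval_form (pr (alpha L)) w = 0"
    \<comment> \<open>The projection of \<open>w\<close> to \<open>H\<close> along \<open>v\<close>:
      the forms \<open>pr c\<close> do not notice it, and on \<open>H\<close> they agree with
      \<open>c\<close>.\<close>
    define w0 where "w0 = w - eval_form ?a w *s v"
    have w0: "w0 \<in> H"
      by (simp add: w0_def H_iff eval_form_diff_right eval_form_smult_right v)
    have pr_w0: "eval_form (pr c) w0 = eval_form (pr c) w" for c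
      by (simp add: w0_def eval_form_diff_right eval_form_smult_right pr_v)
    have "eval_form (alpha L) w0 = 0" using pr_H[OF w0] pr_w0 w by simp
    then have "w0 \<in> H \<inter> L" using w0 hyperplane_alpha(2)[OF hyp[OF L(1)]] by blast
    then have "eval_form (def_form H (H \<inter> L)) w0 = 0"
      using def_form_restriction[OF hyp[OF L(1)] refl, of w0 H] by simp
    then show "eval_form (pr (def_form H (H \<inter> L))) w = 0"
      using pr_H[OF w0] pr_w0 by simp
  qed
  have nonzero: "pr (def_form H (H \<inter> L)) \<noteq> 0" if L: "L \<in> B" "L \<noteq> H" for L
  proof
    assume 0: "pr (def_form H (H \<inter> L)) = 0"
    have "w \<in> L" if "w \<in> H" for w
      using def_form_restriction[OF hyp[OF L(1)] refl, of w H] pr_H[OF that, of "def_form H (H \<inter> L)"] that 0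
      by auto
    then have "\<exists>t. alpha L = t *s ?a"
      using hyperplane_alpha(2)[OF hyp[OF L(1)]] H_iff
      by (intro proportional_if_kernel_subset hyperplane_alpha(1)[OF hyp[OF H]]) blast
    then obtain t where "alpha L = t *s ?a" ..
    then have "H = L" by (rule hyperplane_eqI[OF hyp[OF H] hyp[OF L(1)]])
    with L show False by simp
  qed
  have restr: "\<exists>L. L \<in> B \<and> L \<noteq> H \<and> d = def_form H (H \<inter> L)" if "d \<in> def_form H ` restriction B H" for d
    using that unfolding restriction_def by blast
  show ?thesis
  proof unfold_locales
    show "reduced (alpha ` B)" by (rule reduced_alpha[OF B])
    show "?a \<in> alpha ` B" using H by (rule imageI)
    show "eval_form ?a v = 1" by (rule v)
    have "restriction B H = (\<lambda>L. H \<inter> L) ` (B - {H})" by (auto simp: restriction_def)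
    then show "finite (def_form H ` restriction B H)" using B by (simp add: arrangement_def)
  next
    fix d assume "d \<in> def_form H ` restriction B H"
    then obtain L where L: "L \<in> B" "L \<noteq> H" "d = def_form H (H \<inter> L)" using restr by blast
    show "d - eval_form d v *s ?a \<noteq> 0"
      using nonzero[OF L(1,2)] by (simp add: L(3) pr_def)
    obtain t where "pr (def_form H (H \<inter> L)) = t *s pr (alpha L)" using proportional[OF L(1,2)] ..
    moreover have "alpha L \<noteq> ?a" using inj_onD[OF inj_on_alpha[OF B] _ L(1) H] L(2) by blast
    ultimately show "\<exists>c\<in>alpha ` B. c \<noteq> ?a \<and> (\<exists>t. d - eval_form d v *s ?a = t *s (c - eval_form c v *s ?a))"
      using L(1,3) by (intro bexI[of _ "alpha L"] conjI exI[of _ t]) (auto simp: pr_def)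
  next
    fix c assume "c \<in> alpha ` B" "c \<noteq> ?a"
    then obtain L where L: "L \<in> B" "L \<noteq> H" "c = alpha L" by blast
    obtain t where t: "pr (def_form H (H \<inter> L)) = t *s pr (alpha L)" using proportional[OF L(1,2)] ..
    have "def_form H (H \<inter> L) \<in> def_form H ` restriction B H"
      using L by (auto simp: restriction_def)
    then show "\<exists>d\<in>def_form H ` restriction B H. \<exists>t. d - eval_form d v *s ?a = t *s (c - eval_form c v *s ?a)"
      using t by (intro bexI[of _ "def_form H (H \<inter> L)"] exI[of _ t]) (simp_all add: pr_def L(3))
  next
    fix d d' t assume d: "d \<in> def_form H ` restriction B H" and d': "d' \<in> def_form H ` restriction B H"
      and t: "d' - eval_form d' v *s ?a = t *s (d - eval_form d v *s ?a)"
    obtain L where L: "L \<in> B" "L \<noteq> H" "d = def_form H (H \<inter> L)"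
      using restr[OF d] by (elim exE conjE)
    obtain L' where L': "L' \<in> B" "L' \<noteq> H" "d' = def_form H (H \<inter> L')"
      using restr[OF d'] by (elim exE conjE)
    have t': "pr d' = t *s pr d" using t by (simp add: pr_def)
    have "t \<noteq> 0" using nonzero[OF L'(1,2)] t' L'(3) by auto
    have "H \<inter> L = H \<inter> L'"
    proof -
      have "w \<in> H \<inter> L \<longleftrightarrow> w \<in> H \<inter> L'" for w
      proof (cases "w \<in> H")
        case True
        then have "eval_form d' w = t * eval_form d w"
          using arg_cong[OF t', of "\<lambda>c. eval_form c w"] by (simp add: pr_H eval_form_smult)
        then show ?thesis
          using def_form_restriction[OF hyp[OF L(1)] refl, of w H]
            def_form_restriction[OF hyp[OF L'(1)] refl, of w H] \<open>t \<noteq> 0\<close> L(3) L'(3) by auto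
      qed simp
      then show ?thesis by blast
    qed
    then show "d = d'" by (simp add: L(3) L'(3))
  qed
qed

lemma def_poly_restriction:
  fixes B :: "('k::field, 'n::{finite,linorder}) vec set set"
  assumes "arrangement B"
  shows "def_poly H (restriction B H) = lin_prod (def_form H ` restriction B H)"
  by (simp add: def_poly_def prod.reindex[OF inj_on_def_form[OF assms]])

section \<open>Coefficients of a form in a basis that contains \<open>alpha H\<close>\<close>

lemma to_fract_dot:
  fixes \<eta> :: "(('k::field, 'n::{finite,linorder}) pring, 'n) vec"
  assumes "scale_form q \<omega> = to_rat_form \<eta>"
  shows "to_fract (dot w \<eta>) = to_fract q * (\<Sum>j\<in>UNIV. to_fract (const_poly (w $ j)) * \<omega> $ j)"
proof -
  have "to_fract q * \<omega> $ j = to_fract (\<eta> $ j)" for j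
    using arg_cong[OF assms, of "\<lambda>z. z $ j"] by (simp add: scale_form_def to_rat_form_def)
  then show ?thesis
    by (simp add: dot_def sum_distrib_left mult.left_commute[of "to_fract q"])
qed

lemma coefficient_eq:
  fixes b :: "'n \<Rightarrow> ('k::field, 'n::{finite,linorder}) vec"
  assumes "\<And>i. eval_form (b i) w = (if i = h then 1 else 0)"
    and "\<omega> = (\<Sum>i\<in>UNIV. f i *s to_rat_form (dform (b i)))"
  shows "(\<Sum>j\<in>UNIV. to_fract (const_poly (w $ j)) * \<omega> $ j) = f h"
proof -
  have "(\<Sum>j\<in>UNIV. to_fract (const_poly (w $ j)) * \<omega> $ j)
      = (\<Sum>j\<in>UNIV. \<Sum>i\<in>UNIV. f i * to_fract (const_poly (b i $ j * w $ j)))"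
    by (simp add: assms(2) sum_component to_rat_form_def dform_def const_poly_mult sum_distrib_left mult_ac)
  also have "\<dots> = (\<Sum>i\<in>UNIV. \<Sum>j\<in>UNIV. f i * to_fract (const_poly (b i $ j * w $ j)))"
    by (rule sum.swap)
  also have "\<dots> = (\<Sum>i\<in>UNIV. f i * to_fract (const_poly (eval_form (b i) w)))"
    by (simp add: eval_form_def const_poly_sum sum_distrib_left)
  also have "\<dots> = (\<Sum>i\<in>UNIV. if i = h then f i else 0)"
    by (intro sum.cong refl) (simp add: assms(1))
  finally show ?thesis by (simp add: sum.delta)
qed

lemma is_basis_dual:
  fixes b :: "'n \<Rightarrow> 'k::field ^ 'n" and h :: 'n
  assumes "is_basis b"
  obtains w where "\<forall>i. eval_form (b i) w = (if i = h then 1 else 0)"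
proof -
  obtain G where G: "(\<chi> i. b i) ** G = mat 1" using is_basis_inverse[OF assms] by blast
  have "eval_form (b i) (\<chi> j. G $ j $ h) = ((\<chi> i. b i) ** G) $ i $ h" for i
    by (simp add: eval_form_def matrix_matrix_mult_def)
  then show thesis by (intro that[of "\<chi> j. G $ j $ h"]) (simp add: G mat_def)
qed

lemma is_basis_expand:
  fixes b :: "'n \<Rightarrow> ('k::field, 'n::{finite,linorder}) vec" and \<omega> :: "('k, 'n) rat_one_form"
  assumes "is_basis b"
  obtains f where "\<omega> = (\<Sum>i\<in>UNIV. f i *s to_rat_form (dform (b i)))"
proof -
  obtain G where G: "G ** (\<chi> i. b i) = mat 1" using is_basis_inverse[OF assms] by blast
  have Gb: "(\<Sum>i\<in>UNIV. G $ j $ i * b i $ l) = (if j = l then 1 else 0)" for j l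
    using arg_cong[OF G, of "\<lambda>M. M $ j $ l"] by (simp add: matrix_matrix_mult_def mat_def)
  define f where "f = (\<lambda>i. \<Sum>j\<in>UNIV. \<omega> $ j * to_fract (const_poly (G $ j $ i)))"
  have "(\<Sum>i\<in>UNIV. f i *s to_rat_form (dform (b i))) $ l = \<omega> $ l" for l
  proof -
    have "(\<Sum>i\<in>UNIV. f i *s to_rat_form (dform (b i))) $ l
        = (\<Sum>i\<in>UNIV. \<Sum>j\<in>UNIV. \<omega> $ j * to_fract (const_poly (G $ j $ i * b i $ l)))"
      by (simp add: f_def sum_component to_rat_form_def dform_def const_poly_mult sum_distrib_right mult.assoc)
    also have "\<dots> = (\<Sum>j\<in>UNIV. \<Sum>i\<in>UNIV. \<omega> $ j * to_fract (const_poly (G $ j $ i * b i $ l)))"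
      by (rule sum.swap)
    also have "\<dots> = (\<Sum>j\<in>UNIV. \<omega> $ j * to_fract (const_poly (\<Sum>i\<in>UNIV. G $ j $ i * b i $ l)))"
      by (simp add: const_poly_sum sum_distrib_left)
    also have "\<dots> = (\<Sum>j\<in>UNIV. if j = l then \<omega> $ j else 0)"
      by (intro sum.cong refl) (simp add: Gb)
    finally show ?thesis by (simp add: sum.delta)
  qed
  then have "\<omega> = (\<Sum>i\<in>UNIV. f i *s to_rat_form (dform (b i)))"
    unfolding vec_eq_iff by (rule allI[OF sym])
  then show thesis by (rule that)
qed

context
  fixes B :: "('k::field, 'n::{finite,linorder}) vec set set" and H v
  assumes B: "arrangement B" and H: "H \<in> B" and v: "eval_form (alpha H) v = 1"
begin

interpretation restricted_forms "alpha ` B" "def_form H ` restriction B H" "alpha H" v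
  by (rule restricted_forms_arrangement[OF B H v])

text \<open>In any basis with \<open>b h = alpha H\<close>, the coefficient \<open>f h\<close> is
  the contraction with the dual vector \<open>w\<close>. Since \<open>alpha H\<close> is 1 on
  \<open>w\<close>, its numerator reduces as for \<open>v\<close>. Uniqueness holds because the
  reduction of the polynomial of the restriction is non-zero in a domain.\<close>

lemma residue_eq:
  assumes \<eta>: "\<eta> \<in> log_module (alpha ` B)" and \<omega>: "scale_form (def_poly UNIV B) \<omega> = to_rat_form \<eta>"
    and r: "\<rho> r = r" "\<rho> (dot v \<eta>) = \<rho> (def_poly H (restriction B H)) * r"
  shows "residue B H \<omega> = bar H r"
  unfolding residue_def
proof (rule the_equality)
  let ?Q = "def_poly H (restriction B H)"
  have bar_iff_\<rho>: "bar H f = bar H g \<longleftrightarrow> \<rho> f = \<rho> g" for f g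
    by (simp add: bar_eq_iff reduce_eq_iff[OF v])
  obtain b h where b: "is_basis b" "b h = alpha H"
    by (rule ex_is_basis_at[OF a_nonzero])
  obtain w where w: "\<forall>i. eval_form (b i) w = (if i = h then 1 else 0)"
    by (rule is_basis_dual[OF b(1), where h = h])
  obtain f where f: "\<omega> = (\<Sum>i\<in>UNIV. f i *s to_rat_form (dform (b i)))"
    by (rule is_basis_expand[OF b(1)])
  have "eval_form (alpha H) w = 1" using w[rule_format, of h] b(2) by simp
  then have "\<rho> (dot w \<eta>) = \<rho> (dot v \<eta>)" by (rule \<rho>_dot_eq[OF \<eta>])
  then have "bar H ?Q \<otimes>\<^bsub>coord_ring H\<^esub> bar H r = bar H (dot w \<eta>)"
    by (simp only: bar_mult bar_iff_\<rho> r reduce_simps(3))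
  moreover have carr: "bar H r \<in> carrier (coord_ring H)"
    unfolding carrier_coord_ring by (rule rangeI)
  moreover have "to_fract (dot w \<eta>) = to_fract (def_poly UNIV B) * f h"
    by (simp only: to_fract_dot[OF \<omega>] coefficient_eq[OF w[rule_format] f])
  ultimately show "bar H r \<in> carrier (coord_ring H) \<and>
      (\<exists>b h f p. is_basis b \<and> b h = alpha H \<and>
         \<omega> = (\<Sum>i\<in>UNIV. f i *s to_rat_form (dform (b i))) \<and>
         to_fract p = to_fract (def_poly UNIV B) * f h \<and>
         bar H ?Q \<otimes>\<^bsub>coord_ring H\<^esub> bar H r = bar H p)"
    using b f by (intro conjI exI[of _ b] exI[of _ h] exI[of _ f] exI[of _ "dot w \<eta>"])
  fix g assume g: "g \<in> carrier (coord_ring H) \<and>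
      (\<exists>b h f p. is_basis b \<and> b h = alpha H \<and>
         \<omega> = (\<Sum>i\<in>UNIV. f i *s to_rat_form (dform (b i))) \<and>
         to_fract p = to_fract (def_poly UNIV B) * f h \<and>
         bar H ?Q \<otimes>\<^bsub>coord_ring H\<^esub> g = bar H p)"
  then obtain g' where g': "g = bar H g'" by (auto simp: carrier_coord_ring)
  from g obtain b h f p where b: "is_basis b" "b h = alpha H"
    and f: "\<omega> = (\<Sum>i\<in>UNIV. f i *s to_rat_form (dform (b i)))"
    and p: "to_fract p = to_fract (def_poly UNIV B) * f h"
    and g_eq: "bar H ?Q \<otimes>\<^bsub>coord_ring H\<^esub> g = bar H p" by (elim conjE exE)
  obtain w where w: "\<forall>i. eval_form (b i) w = (if i = h then 1 else 0)"
    by (rule is_basis_dual[OF b(1), where h = h])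
  have "to_fract p = to_fract (dot w \<eta>)"
    by (simp only: to_fract_dot[OF \<omega>] coefficient_eq[OF w[rule_format] f] p)
  then have "p = dot w \<eta>" by (simp only: to_fract_eq_iff)
  moreover have "eval_form (alpha H) w = 1" using w[rule_format, of h] b(2) by simp
  ultimately have "\<rho> p = \<rho> (dot v \<eta>)" by (simp only: \<rho>_dot_eq[OF \<eta>])
  moreover have "\<rho> (?Q * g') = \<rho> p"
    using g_eq by (simp only: g' bar_mult bar_iff_\<rho>)
  ultimately have "\<rho> ?Q * \<rho> g' = \<rho> ?Q * r" by (simp only: r(2) reduce_simps(3))
  moreover have "\<rho> ?Q \<noteq> 0"
    unfolding def_poly_restriction[OF B] by (rule \<rho>_lin_prod_D_nonzero)
  ultimately have "\<rho> g' = r" by (rule mult_left_cancel[THEN iffD1, rotated])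
  then show "g = bar H r" by (simp only: g' bar_iff_\<rho> r(1))
qed

text \<open>The right side says that \<eta> has residue 1; multiplying \<eta> by \<open>g\<close>
  then yields the class of \<open>g\<close> as a residue.\<close>

lemma residue_ideal_eq_carrier_iff:
  "residue_ideal B H = carrier (coord_ring H) \<longleftrightarrow>
    (\<exists>\<eta>\<in>log_module (alpha ` B). lin_poly (alpha H) dvd dot v \<eta> - def_poly H (restriction B H))"
proof
  let ?Q = "def_poly H (restriction B H)"
  have Q: "?Q = lin_prod (def_form H ` restriction B H)" by (rule def_poly_restriction[OF B])
  have nz: "def_poly UNIV B \<noteq> 0"
    unfolding def_poly_UNIV[OF B] by (rule lin_prod_neq_0[OF reduced_alpha[OF B]])
  have ex: "\<exists>\<eta> r. \<eta> \<in> log_module (alpha ` B) \<and> \<rho> r = r \<and> \<rho> (dot v \<eta>) = \<rho> ?Q * r \<and> residue B H \<omega> = bar H r"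
    if \<omega>: "\<omega> \<in> log_forms B" for \<omega>
  proof -
    obtain \<eta> where \<eta>: "\<eta> \<in> log_module (alpha ` B)" "scale_form (def_poly UNIV B) \<omega> = to_rat_form \<eta>"
      using \<omega> unfolding log_forms_iff[OF B] by (rule bexE)
    obtain r where r: "\<rho> r = r" "\<rho> (dot v \<eta>) = \<rho> ?Q * r"
      unfolding Q by (rule residue_exists[OF \<eta>(1)])
    from \<eta>(1) r residue_eq[OF \<eta> r] show ?thesis by (intro exI[of _ \<eta>] exI[of _ r] conjI)
  qed
  {
    assume "residue_ideal B H = carrier (coord_ring H)"
    then have "bar H 1 \<in> residue_ideal B H" by (simp add: carrier_coord_ring)
    then obtain \<omega> where \<omega>: "\<omega> \<in> log_forms B" "bar H 1 = residue B H \<omega>"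
      unfolding residue_ideal_def by (elim imageE)
    from ex[OF \<omega>(1)] obtain \<eta> r where \<eta>: "\<eta> \<in> log_module (alpha ` B)" "\<rho> r = r"
      "\<rho> (dot v \<eta>) = \<rho> ?Q * r" and "residue B H \<omega> = bar H r" by (elim exE conjE)
    then have bar: "bar H 1 = bar H r" by (simp only: \<omega>(2))
    have "\<rho> 1 = \<rho> r"
      using bar unfolding bar_eq_iff reduce_eq_iff[OF v] .
    then have "r = 1" unfolding \<eta>(2) reduce_simps(5) by (rule sym)
    then have "\<rho> (dot v \<eta>) = \<rho> ?Q" using \<eta>(3) by (simp only: mult_1_right)
    then show "\<exists>\<eta>\<in>log_module (alpha ` B). lin_poly (alpha H) dvd dot v \<eta> - ?Q"
      using \<eta>(1) unfolding reduce_eq_iff[OF v] by (rule bexI)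
  }
  assume "\<exists>\<eta>\<in>log_module (alpha ` B). lin_poly (alpha H) dvd dot v \<eta> - ?Q"
  then obtain \<eta> where \<eta>: "\<eta> \<in> log_module (alpha ` B)" and "\<rho> (dot v \<eta>) = \<rho> ?Q"
    unfolding reduce_eq_iff[OF v] by (rule bexE)
  then have \<rho>\<eta>: "\<rho> (dot v (g *s \<eta>)) = \<rho> ?Q * \<rho> g" for g
    by (simp add: dot_smult)
  show "residue_ideal B H = carrier (coord_ring H)"
  proof (intro equalityI subsetI)
    fix x assume "x \<in> residue_ideal B H"
    then obtain \<omega> where \<omega>: "x = residue B H \<omega>" "\<omega> \<in> log_forms B"
      unfolding residue_ideal_def by (rule imageE)
    from ex[OF \<omega>(2)] obtain r where r: "residue B H \<omega> = bar H r" by (elim exE conjE)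
    show "x \<in> carrier (coord_ring H)"
      unfolding \<omega>(1) carrier_coord_ring r by (rule rangeI)
  next
    fix x assume "x \<in> carrier (coord_ring H)"
    then obtain g where g: "x = bar H g" unfolding carrier_coord_ring by (rule rangeE)
    obtain \<omega> where \<omega>: "scale_form (def_poly UNIV B) \<omega> = to_rat_form (g *s \<eta>)"
      by (rule ex_scale_form_eq_to_rat_form[OF nz])
    have mem: "g *s \<eta> \<in> log_module (alpha ` B)" by (rule log_module_smult[OF \<eta>])
    have "residue B H \<omega> = bar H (\<rho> g)"
      by (rule residue_eq[OF mem \<omega> _ \<rho>\<eta>]) (rule reduce_reduce[OF v])
    also have "\<dots> = x"
      unfolding g bar_eq_iff reduce_eq_iff[OF v, symmetric] by (rule reduce_reduce[OF v])
    finally have "x = residue B H \<omega>" ..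
    moreover have "\<omega> \<in> log_forms B"
      unfolding log_forms_iff[OF B] using \<omega> mem by (rule bexI)
    ultimately show "x \<in> residue_ideal B H"
      unfolding residue_ideal_def by (rule image_eqI)
  qed
qed

lemma residue_ideal_eq_carrier_iff_free_deletion:
  assumes free: "free_arrangement B"
  shows "residue_ideal B H = carrier (coord_ring H) \<longleftrightarrow> free_arrangement (B - {H})"
proof -
  have del: "alpha ` (B - {H}) = alpha ` B - {alpha H}"
    using inj_on_image_set_diff[OF inj_on_alpha[OF B], of B "{H}"] H by simp
  have B': "arrangement (B - {H})" using B by (auto simp: arrangement_def)
  have sf: "saito_free (alpha ` B)" using free unfolding free_arrangement_iff_saito_free[OF B] .
  show ?thesis
    unfolding residue_ideal_eq_carrier_iff free_arrangement_iff_saito_free[OF B'] del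
      def_poly_restriction[OF B]
  proof
    assume "\<exists>\<eta>\<in>log_module (alpha ` B).
      lin_poly (alpha H) dvd dot v \<eta> - lin_prod (def_form H ` restriction B H)"
    then show "saito_free (alpha ` B - {alpha H})"
      using saito_free_deletion_if_residue_1[OF sf] by (elim bexE)
  next
    assume "saito_free (alpha ` B - {alpha H})"
    then show "\<exists>\<eta>\<in>log_module (alpha ` B).
      lin_poly (alpha H) dvd dot v \<eta> - lin_prod (def_form H ` restriction B H)"
      by (rule residue_1_if_saito_free_deletion[OF sf]) (rule bexI)
  qed
qed

end

text \<open>A hyperplane contains \<open>X\<close> iff its form annihilates \<open>X\<close>, so the
  localization corresponds to the annihilator \<open>?U\<close>.\<close>

lemma free_localization:
  fixes A :: "('k::field, 'n::{finite,linorder}) vec set set"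
  assumes A: "arrangement A" and "free_arrangement A"
  shows "free_arrangement (localization A X)"
proof -
  let ?U = "{c. \<forall>w\<in>X. eval_form c w = 0}"
  have "arrangement (localization A X)"
    using A by (auto simp: arrangement_def localization_def)
  moreover have "alpha ` localization A X = alpha ` A \<inter> ?U"
    using hyperplane_alpha(2)[OF arrangement_hyperplane[OF A]]
    by (auto simp: localization_def)
  moreover have "vec.subspace ?U"
    unfolding vec.subspace_def by (simp add: eval_form_add eval_form_smult)
  ultimately show ?thesis
    using saito_free_localization[OF _ reduced_alpha[OF A], of ?U] assms
    by (simp add: free_arrangement_iff_saito_free)
qed

theorem corollary4p3:
  fixes A :: "('k::field ^ 'n::{finite, linorder}) set set"
    and H :: "('k ^ 'n::{finite, linorder}) set"
  assumes "arrangement A"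
    and "free_arrangement A"
    and "H \<in> A"
  shows "Xi A H = NFT A H"
proof -
  have "residue_ideal (localization A X) H = carrier (coord_ring H)
      \<longleftrightarrow> free_arrangement (localization A X - {H})"
    if "X \<in> intersections H (restriction A H)" for X
  proof -
    \<comment> \<open>This keeps \<open>H\<close> in the localization, which is free as well, so
      that the criterion for the deletion of \<open>H\<close> applies to it.\<close>
    have "X \<subseteq> H" using that by (auto simp: intersections_def)
    then have "H \<in> localization A X" using assms(3) by (simp add: localization_def)
    moreover have "arrangement (localization A X)"
      using assms(1) by (auto simp: arrangement_def localization_def)
    moreover obtain v where "eval_form (alpha H) v = 1"
      using ex_eval_form_1[OF hyperplane_alpha(1)[OF arrangement_hyperplane[OF assms(1,3)]]] ..
    ultimately show ?thesis
      by (intro residue_ideal_eq_carrier_iff_free_deletion free_localization[OF assms(1,2)])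
  qed
  then show ?thesis by (auto simp: Xi_def NFT_def)
qed

end
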